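(* Let $d\ge1$, let $\Omega\subset\mathbb{R}^2$ be a piecewise conic domain and $\triangle$ a triangulation of $\Omega$ with constants $R,A,B$, all as described in the context. Let $$M_0:=\Big(D_{d,\triangle_0}\setminus\partial\Omega\Big)\cup\bigcup_{T\in\triangle_P}D^*_{d-1,T}\cup\bigcup_{T\in\triangle_B}D^0_{d+1,T},$$ where the domain points $\xi\in M_0$ are identified with the corresponding linear functionals $\lambda_\xi$ on $S_{d,0}(\triangle)$ defined in the context. Then $M_0$ is a stable local minimal determining set for the space $S_{d,0}(\triangle)$ with $\ell=1$, $\kappa$ depending only on $d$, $K_1$ depending only on $d$ and $B$, and $K_2$ depending only on $d$ and $A$. That is, $M_0$ is a minimal determining set for $S_{d,0}(\triangle)$, it is $1$-local with respect to some family of supporting sets $\omega_\lambda$, $\lambda\in M_0$, its covering number is at most $\kappa$, and $$|\lambda(s)|\le K_1\|s\|_{L^\infty(\omega_\lambda)}\ \ (\lambda\in M_0),\qquad \|s\|_{L^\infty(T)}\le K_2\max_{\lambda\in\Lambda_T}|\lambda(s)|\ \ (T\in\triangle)$$ for all $s\in S_{d,0}(\triangle)$, where $\Lambda=M_0$.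
   Context: Domain. $\mathbb{P}_d$ is the space of bivariate polynomials of total degree at most $d$. $\Omega\subset\mathbb{R}^2$ is a bounded, simply connected curvilinear polygonal domain with $\partial\Omega=\bigcup_{j=1}^n\overline{\Gamma}_j$, where each $\Gamma_j$ is an open arc of an algebraic curve of order at most two (a straight line or a conic). $Z=\{z_1,\dots,z_n\}$ is the set of endpoints of the arcs, numbered counter-clockwise, with $z_j,z_{j+1}$ the endpoints of $\Gamma_j$ (indices mod $n$). The internal angle $\omega_j$ at $z_j$ between the tangents to $\Gamma_j$ and $\Gamma_{j-1}$ satisfies $0<\omega_j\le2\pi$. For each $j$, $q_j\in\mathbb{P}_2$ is a polynomial with $\Gamma_j\subset\{x: q_j(x)=0\}$, with sign chosen so that $\partial_{\nu_x}q_j(x)<0$ for $x$ in the interior of $\Gamma_j$ ($\nu_x$ the unit outer normal); $q_j\in\mathbb{P}_1$ if $\Gamma_j$ is a straight interval and $q_j\in\mathbb{P}_2\setminus\mathbb{P}_1$ if $\Gamma_j$ is a genuine conic arc. $\partial_a:=a\cdot\nabla$. Triangulation. $\triangle$ is a subdivision of $\Omega$ into triangles, where each $T\in\triangle$ has at most one edge replaced by a curved segment of $\partial\Omega$, and the intersection of any two triangles is, if non-empty, a common vertex or a common straight edge. Triangles with a curved edge are pie-shaped (set $\triangle_P$); non-pie-shaped triangles sharing at least one edge with a pie-shaped triangle are buffer triangles (set $\triangle_B$); the others are ordinary (set $\triangle_0$). It is assumed that: (a) every $z_j$ is a vertex of $\triangle$; (b) no interior edge has both endpoints on the boundary; (c)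 if $q_j/q_{j-1}\neq$ const and at least one of $q_j,q_{j-1}$ is in $\mathbb{P}_2\setminus\mathbb{P}_1$, then at least one $T\in\triangle_B$ is attached to $z_j$; (d) every $T\in\triangle_P$ is star-shaped with respect to its interior vertex $v$; (e) for any $T\in\triangle_P$ with curved side on $\Gamma_j$, $q_j(z)>0$ for all $z\in T\setminus\overline{\Gamma}_j$. For $T\in\triangle_P$, $T^*$ is the straight triangle with the same three vertices as $T$. Constants. $h_T$ is the diameter of $T$; $\rho_T$ is the radius of the disk inscribed in $T$ (if $T\in\triangle_0\cup\triangle_B$) or in $T\cap T^*$ (if $T\in\triangle_P$). $R,A,B>0$ are constants with $h_T\le R\rho_T$ for all $T\in\triangle$ and, for any $T\in\triangle_P$ with curved edge contained in $\Gamma_j$ and interior vertex $v$: $q_j(z)\le A\,q_j(v)$ for all $z\in T$, and $\partial_{v-z}q_j(z)\ge B\,q_j(v)$ for all $z\in T\cap\Gamma_j$. Space. $S_{d,0}(\triangle)$ is the space of $s\in C^0(\Omega)$ with $s|_T\in\mathbb{P}_d$ for $T\in\triangle_0$, $s|_T\in\mathbb{P}_{d+1}$ for $T\in\triangle_P\cup\triangle_B$, and $s|_{\partial\Omega}=0$. Domain points and functionals. For a triangle $T=\langle v_1,v_2,v_3\rangle$, $B^d_{ijk}=\frac{d!}{i!j!k!}b_1^ib_2^jb_3^k$ ($i+j+k=d$), with $b_1,b_2,b_3$ the barycentric coordinates, are the Bernstein polynomials; $D_{d,T}=\{\xi_{ijk}=(iv_1+jv_2+kv_3)/d: i+j+k=d,\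 i,j,k\ge0\}$ is the set of domain points, $B^d_\xi:=B^d_{ijk}$ for $\xi=\xi_{ijk}$; the BB-coefficients $c_\xi$ of $p\in\mathbb{P}_d$ are given by $p=\sum_{\xi\in D_{d,T}}c_\xi B^d_\xi$. $D_{d,\triangle_0}=\bigcup_{T\in\triangle_0}D_{d,T}$; for $\xi\in D_{d,\triangle_0}$, $\lambda_\xi(s)$ is the BB-coefficient at $\xi$ of $s|_T\in\mathbb{P}_d$ for a $T\in\triangle_0$ containing $\xi$. For $T\in\triangle_B$, $D^0_{d+1,T}$ is the subset of $D_{d+1,T}$ obtained by removing all domain points on those edges of $T$ that are shared with triangles in either $\triangle_0$ or $\triangle_P$, and $\lambda_\xi(s)$ for $\xi\in D^0_{d+1,T}$ is the BB-coefficient at $\xi$ of $s|_T\in\mathbb{P}_{d+1}$. For $T\in\triangle_P$ with curved edge on $\Gamma_j$ and interior vertex $v$, let $q=q_j/q_j(v)$ (so $q(v)=1$); $D^*_{d-1,T}$ is the set of domain points of degree $d-1$ over $T^*$ (for $d=1$ it is the single point $v$), and for $\xi\in D^*_{d-1,T}$, $\lambda_\xi(s)$ is the coefficient $c_\xi$ in $s|_T=q\sum_{\xi\in D^*_{d-1,T}}c_\xi B^{d-1}_\xi$, with Bernstein polynomials with respect to $T^*$ (every $s|_T$ is of this form). At the interior vertex $v$ of a pie-shaped triangle the functional is $\lambda_v(s)=s(v)$, whether $v$ is regarded as an element of $D^*_{d-1,T}$ or of $D_{d,\triangle_0}$. MDS notions. Let $S=S_{d,0}(\triangle)$, with dual space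 $S^*$. $\Lambda\subset S^*$ is a determining set if $\lambda(s)=0$ for all $\lambda\in\Lambda$ implies $s=0$; it is a minimal determining set (MDS) if no smaller determining set exists, i.e. $\Lambda$ is a basis of $S^*$. Its dual basis $\{s_\lambda\}$ of $S$ satisfies $\lambda(s_\mu)=\delta_{\lambda,\mu}$. $\Lambda_T=\{\lambda\in\Lambda: T\subset\operatorname{supp}s_\lambda\}$; the covering number is $\max_{T\in\triangle}|\Lambda_T|$. A set $\omega\subset\Omega$ is a supporting set of $\lambda$ if $\lambda(s)=0$ for all $s\in S$ with $s|_\omega=0$. For a set $E$, $\operatorname{star}(E)=\operatorname{star}^1(E)$ is the union of all $T\in\triangle$ with $T\cap E\ne\emptyset$, and $\operatorname{star}^\ell(E)=\operatorname{star}(\operatorname{star}^{\ell-1}(E))$ for $\ell\ge2$. $\Lambda$ is $\ell$-local if there are supporting sets $\omega_\lambda$ of $\lambda\in\Lambda$ such that $\omega_\lambda\subset\operatorname{star}^\ell(T)$ for any $T\in\triangle$ with $\lambda\in\Lambda_T$.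
   Formalization: K_1 and K_2 may also depend on the shape constant R (independence of R is false for thin pie-shaped triangles), and domain points on ∂Ω are also removed from D^0_{d+1,T}, since they would give the zero functional when a buffer triangle has a boundary edge. *)

theory Defs
  imports "HOL-Complex_Analysis.Complex_Analysis"
begin

text \<open>
  The plane is the type \<^typ>\<open>complex\<close> (as for the Jordan curve theorem and winding numbers in the
  library). Arc indices run through \<open>{..<n}\<close> and are taken modulo \<open>n\<close>. The arc with index \<open>j\<close>
  is given by a parametrisation \<open>\<gamma> j\<close> over \<open>[0,1]\<close> running from \<open>z\<^sub>j\<close> to \<open>z\<^sub>j\<^sub>+\<^sub>1\<close>, so that
  \<open>z\<^sub>j\<close> is \<open>pathstart (\<gamma> j)\<close>.
\<close>

definition poly2 :: "nat \<Rightarrow> (complex \<Rightarrow> real) set" where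
  "poly2 d = {p. \<exists>c :: nat \<Rightarrow> nat \<Rightarrow> real.
     \<forall>x. p x = (\<Sum>i\<le>d. \<Sum>j\<le>d - i. c i j * Re x ^ i * Im x ^ j)}"

definition dir_deriv :: "complex \<Rightarrow> (complex \<Rightarrow> real) \<Rightarrow> complex \<Rightarrow> real" where
  "dir_deriv a f x = frechet_derivative f (at x) a"

subsection \<open>Piecewise conic domains\<close>

definition open_arc :: "(real \<Rightarrow> complex) \<Rightarrow> complex set" where
  "open_arc g = g ` {0<..<1}"

definition velocity :: "(real \<Rightarrow> complex) \<Rightarrow> real \<Rightarrow> complex" where
  "velocity g t = vector_derivative g (at t within {0..1})"

text \<open>A single closed arc (\<open>n = 1\<close>) is allowed, hence \<^const>\<open>simple_path\<close> rather than
  \<^const>\<open>arc\<close>.\<close>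

definition regular_arc :: "(real \<Rightarrow> complex) \<Rightarrow> bool" where
  "regular_arc g \<longleftrightarrow> simple_path g \<and>
     (\<forall>t\<in>{0..1}. (g has_vector_derivative velocity g t) (at t within {0..1}) \<and> velocity g t \<noteq> 0) \<and>
     continuous_on {0..1} (velocity g)"

definition conic_arc :: "(real \<Rightarrow> complex) \<Rightarrow> bool" where
  "conic_arc g \<longleftrightarrow> (\<exists>p\<in>poly2 2. (\<forall>l\<in>poly2 1. \<forall>m\<in>poly2 1. p \<noteq> (\<lambda>x. l x * m x)) \<and>
     open_arc g \<subseteq> {x. p x = 0})"

definition straight_arc :: "(real \<Rightarrow> complex) \<Rightarrow> bool" where
  "straight_arc g \<longleftrightarrow> open_arc g = open_segment (pathstart g) (pathfinish g)"

text \<open>The arcs run through one after the other, as a single closed path over \<open>[0,1]\<close>.\<close>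

definition boundary_loop :: "nat \<Rightarrow> (nat \<Rightarrow> real \<Rightarrow> complex) \<Rightarrow> real \<Rightarrow> complex" where
  "boundary_loop n \<gamma> t = \<gamma> (nat \<lfloor>real n * t\<rfloor> mod n) (frac (real n * t))"

text \<open>As the boundary is traversed counter-clockwise, the domain lies to the left of each arc.\<close>

definition outer_normal :: "(real \<Rightarrow> complex) \<Rightarrow> real \<Rightarrow> complex" where
  "outer_normal g t = - \<i> * sgn (velocity g t)"

text \<open>The angle \<open>\<omega>\<close> of the sector swept counter-clockwise from \<open>\<tau>\<close> to \<open>\<tau>'\<close> (the unit tangents at
  \<open>z\<close> to the outgoing and to the incoming arc, both pointing away from \<open>z\<close>). The last two conditions
  say that this sector is the one on the side of the domain; in particular they distinguish
  \<open>\<omega> = 0\<close> from \<open>\<omega> = 2\<pi>\<close>.\<close>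

definition internal_angle :: "complex set \<Rightarrow> complex \<Rightarrow> complex \<Rightarrow> complex \<Rightarrow> real \<Rightarrow> bool" where
  "internal_angle \<Omega> z \<tau> \<tau>' \<omega> \<longleftrightarrow> 0 \<le> \<omega> \<and> \<omega> \<le> 2 * pi \<and> \<tau>' = cis \<omega> * \<tau> \<and>
     (\<forall>\<theta>\<in>{0<..<\<omega>}. \<forall>\<^sub>F r in at_right 0. z + of_real r * cis \<theta> * \<tau> \<in> \<Omega>) \<and>
     (\<forall>\<theta>\<in>{\<omega><..<2 * pi}. \<forall>\<^sub>F r in at_right 0. z + of_real r * cis \<theta> * \<tau> \<notin> \<Omega>)"

definition piecewise_conic_domain ::
  "complex set \<Rightarrow> nat \<Rightarrow> (nat \<Rightarrow> real \<Rightarrow> complex) \<Rightarrow> (nat \<Rightarrow> complex \<Rightarrow> real) \<Rightarrow> bool" where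
  "piecewise_conic_domain \<Omega> n \<gamma> q \<longleftrightarrow>
     open \<Omega> \<and> \<Omega> \<noteq> {} \<and> bounded \<Omega> \<and> simply_connected \<Omega> \<and> 1 \<le> n \<and>
     (\<forall>j<n. regular_arc (\<gamma> j) \<and> (straight_arc (\<gamma> j) \<or> conic_arc (\<gamma> j))) \<and>
     (\<forall>j<n. pathfinish (\<gamma> j) = pathstart (\<gamma> (Suc j mod n))) \<and>
     inj_on (\<lambda>j. pathstart (\<gamma> j)) {..<n} \<and>
     (\<forall>i<n. \<forall>j<n. pathstart (\<gamma> i) \<notin> open_arc (\<gamma> j)) \<and>
     (\<forall>i<n. \<forall>j<n. i \<noteq> j \<longrightarrow> open_arc (\<gamma> i) \<inter> open_arc (\<gamma> j) = {}) \<and>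
     frontier \<Omega> = (\<Union>j<n. closure (open_arc (\<gamma> j))) \<and>
     (\<forall>z\<in>\<Omega>. winding_number (boundary_loop n \<gamma>) z = 1) \<and>
     (\<forall>j<n. \<exists>\<omega>. internal_angle \<Omega> (pathstart (\<gamma> j))
                 (sgn (velocity (\<gamma> j) 0)) (- sgn (velocity (\<gamma> ((j + n - 1) mod n)) 1)) \<omega> \<and>
               0 < \<omega> \<and> \<omega> \<le> 2 * pi) \<and>
     (\<forall>j<n. open_arc (\<gamma> j) \<subseteq> {x. q j x = 0} \<and>
            (straight_arc (\<gamma> j) \<longrightarrow> q j \<in> poly2 1) \<and>
            (conic_arc (\<gamma> j) \<longrightarrow> q j \<in> poly2 2 - poly2 1) \<and>
            (\<forall>t\<in>{0<..<1}. dir_deriv (outer_normal (\<gamma> j) t) (q j) (\<gamma> j t) < 0))"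

subsection \<open>Triangulations\<close>

text \<open>A triangle is its vertex set together with the closed region it occupies; for a pie-shaped
  triangle the region does not determine the vertices.\<close>

record cell =
  verts :: "complex set"
  region :: "complex set"

definition star_triangle :: "cell \<Rightarrow> complex set" where
  "star_triangle T = convex hull (verts T)"

definition straight_cell :: "cell \<Rightarrow> bool" where
  "straight_cell T \<longleftrightarrow> card (verts T) = 3 \<and> \<not> affine_dependent (verts T) \<and>
     region T = convex hull (verts T)"

text \<open>The edge opposite to the vertex \<open>v\<close> is replaced by the piece \<open>C\<close> of the conic arc with index
  \<open>j\<close>; the region is what is enclosed by the resulting closed curve \<open>J\<close>.\<close>

definition pie_cell :: "nat \<Rightarrow> (nat \<Rightarrow> real \<Rightarrow> complex) \<Rightarrow> nat \<Rightarrow> complex \<Rightarrow> cell \<Rightarrow> bool" where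
  "pie_cell n \<gamma> j v T \<longleftrightarrow> card (verts T) = 3 \<and> \<not> affine_dependent (verts T) \<and>
     j < n \<and> conic_arc (\<gamma> j) \<and>
     (\<exists>s t a b C J. 0 \<le> s \<and> s < t \<and> t \<le> 1 \<and> a = \<gamma> j s \<and> b = \<gamma> j t \<and> C = \<gamma> j ` {s..t} \<and>
        verts T = {v, a, b} \<and>
        closed_segment v a \<inter> C = {a} \<and> closed_segment v b \<inter> C = {b} \<and>
        J = closed_segment v a \<union> closed_segment v b \<union> C \<and>
        region T = J \<union> inside J)"

definition straight_edges :: "nat \<Rightarrow> (nat \<Rightarrow> real \<Rightarrow> complex) \<Rightarrow> cell \<Rightarrow> complex set set" where
  "straight_edges n \<gamma> T = {closed_segment u w | u w. u \<in> verts T \<and> w \<in> verts T \<and> u \<noteq> w \<and>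
     (\<forall>j v. pie_cell n \<gamma> j v T \<longrightarrow> u = v \<or> w = v)}"

definition pies :: "nat \<Rightarrow> (nat \<Rightarrow> real \<Rightarrow> complex) \<Rightarrow> cell set \<Rightarrow> cell set" where
  "pies n \<gamma> \<T> = {T \<in> \<T>. \<exists>j v. pie_cell n \<gamma> j v T}"

definition buffers :: "nat \<Rightarrow> (nat \<Rightarrow> real \<Rightarrow> complex) \<Rightarrow> cell set \<Rightarrow> cell set" where
  "buffers n \<gamma> \<T> = {T \<in> \<T> - pies n \<gamma> \<T>.
     \<exists>T'\<in>pies n \<gamma> \<T>. straight_edges n \<gamma> T \<inter> straight_edges n \<gamma> T' \<noteq> {}}"

definition ordinaries :: "nat \<Rightarrow> (nat \<Rightarrow> real \<Rightarrow> complex) \<Rightarrow> cell set \<Rightarrow> cell set" where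
  "ordinaries n \<gamma> \<T> = \<T> - pies n \<gamma> \<T> - buffers n \<gamma> \<T>"

text \<open>In the condition on the corner \<open>z\<^sub>j\<close> the quotient of \<open>q\<^sub>j\<close> and \<open>q\<^sub>j\<^sub>-\<^sub>1\<close> being constant is
  expressed without division; neither of the two polynomials is zero.\<close>

definition conic_triangulation ::
  "complex set \<Rightarrow> nat \<Rightarrow> (nat \<Rightarrow> real \<Rightarrow> complex) \<Rightarrow> (nat \<Rightarrow> complex \<Rightarrow> real) \<Rightarrow> cell set \<Rightarrow> bool"
where
  "conic_triangulation \<Omega> n \<gamma> q \<T> \<longleftrightarrow>
     finite \<T> \<and>
     (\<forall>T\<in>\<T>. straight_cell T \<or> (\<exists>j v. pie_cell n \<gamma> j v T)) \<and>
     (\<Union>T\<in>\<T>. region T) = closure \<Omega> \<and>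
     (\<forall>T\<in>\<T>. \<forall>T'\<in>\<T>. T \<noteq> T' \<longrightarrow>
        region T \<inter> region T' = {} \<or>
        (\<exists>u \<in> verts T \<inter> verts T'. region T \<inter> region T' = {u}) \<or>
        region T \<inter> region T' \<in> straight_edges n \<gamma> T \<inter> straight_edges n \<gamma> T') \<and>
     (\<forall>j<n. \<exists>T\<in>\<T>. pathstart (\<gamma> j) \<in> verts T) \<and>
     (\<forall>T\<in>\<T>. \<forall>u w. closed_segment u w \<in> straight_edges n \<gamma> T \<and> \<not> closed_segment u w \<subseteq> frontier \<Omega> \<longrightarrow>
        \<not> (u \<in> frontier \<Omega> \<and> w \<in> frontier \<Omega>)) \<and>
     (\<forall>j<n. let i = (j + n - 1) mod n in
        (\<nexists>c. \<forall>x. q j x = c * q i x) \<and> (q j \<in> poly2 2 - poly2 1 \<or> q i \<in> poly2 2 - poly2 1) \<longrightarrow>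
        (\<exists>T\<in>buffers n \<gamma> \<T>. pathstart (\<gamma> j) \<in> verts T)) \<and>
     (\<forall>T\<in>\<T>. \<forall>j v. pie_cell n \<gamma> j v T \<longrightarrow>
        v \<in> \<Omega> \<and> (\<forall>x\<in>region T. closed_segment v x \<subseteq> region T) \<and>
        (\<forall>x \<in> region T - closure (open_arc (\<gamma> j)). 0 < q j x))"

definition inradius :: "complex set \<Rightarrow> real" where
  "inradius X = Sup {r. 0 \<le> r \<and> (\<exists>c. cball c r \<subseteq> X)}"

text \<open>For a straight triangle \<open>T\<close> the intersection below is \<open>T\<close> itself.\<close>

definition rho :: "cell \<Rightarrow> real" where
  "rho T = inradius (region T \<inter> star_triangle T)"

definition shape_constants ::
  "nat \<Rightarrow> (nat \<Rightarrow> real \<Rightarrow> complex) \<Rightarrow> (nat \<Rightarrow> complex \<Rightarrow> real) \<Rightarrow> cell set \<Rightarrow>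
   real \<Rightarrow> real \<Rightarrow> real \<Rightarrow> bool" where
  "shape_constants n \<gamma> q \<T> R A B \<longleftrightarrow> 0 < R \<and> 0 < A \<and> 0 < B \<and>
     (\<forall>T\<in>\<T>. diameter (region T) \<le> R * rho T) \<and>
     (\<forall>T\<in>\<T>. \<forall>j v. pie_cell n \<gamma> j v T \<longrightarrow>
        (\<forall>x\<in>region T. q j x \<le> A * q j v) \<and>
        (\<forall>x\<in>region T \<inter> open_arc (\<gamma> j). dir_deriv (v - x) (q j) x \<ge> B * q j v))"

subsection \<open>The spline space\<close>

text \<open>Splines are functions on \<open>closure \<Omega>\<close>, extended by zero, so that equality of splines is
  equality of functions.\<close>

definition spline_space ::
  "complex set \<Rightarrow> nat \<Rightarrow> (nat \<Rightarrow> real \<Rightarrow> complex) \<Rightarrow> cell set \<Rightarrow> nat \<Rightarrow> (complex \<Rightarrow> real) set" where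
  "spline_space \<Omega> n \<gamma> \<T> d = {s. continuous_on (closure \<Omega>) s \<and>
     (\<forall>x\<in>- closure \<Omega>. s x = 0) \<and> (\<forall>x\<in>frontier \<Omega>. s x = 0) \<and>
     (\<forall>T\<in>ordinaries n \<gamma> \<T>. \<exists>p\<in>poly2 d. \<forall>x\<in>region T. s x = p x) \<and>
     (\<forall>T\<in>pies n \<gamma> \<T> \<union> buffers n \<gamma> \<T>. \<exists>p\<in>poly2 (d + 1). \<forall>x\<in>region T. s x = p x)}"

subsection \<open>Bernstein--Bezier form\<close>

text \<open>Everything is indexed by the vertex set \<open>V\<close> instead of an ordered triple of vertices: a
  multi-index is a function on \<open>V\<close>.\<close>

definition bary :: "complex set \<Rightarrow> complex \<Rightarrow> complex \<Rightarrow> real" where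
  "bary V u x = (THE b. (\<forall>w. w \<notin> V \<longrightarrow> b w = 0) \<and> (\<Sum>w\<in>V. b w) = 1 \<and> (\<Sum>w\<in>V. b w *\<^sub>R w) = x) u"

definition domain_points :: "complex set \<Rightarrow> nat \<Rightarrow> complex set" where
  "domain_points V k = {(\<Sum>u\<in>V. real (\<alpha> u) *\<^sub>R u) /\<^sub>R real k | \<alpha> :: complex \<Rightarrow> nat. (\<Sum>u\<in>V. \<alpha> u) = k}"

definition bernstein :: "complex set \<Rightarrow> nat \<Rightarrow> (complex \<Rightarrow> nat) \<Rightarrow> complex \<Rightarrow> real" where
  "bernstein V k \<alpha> x = fact k / (\<Prod>u\<in>V. fact (\<alpha> u)) * (\<Prod>u\<in>V. bary V u x ^ \<alpha> u)"

text \<open>The multi-index of a domain point of degree \<open>k\<close> is \<open>k\<close> times its barycentric coordinates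
  (these products are natural numbers, so nothing is rounded). For \<open>k = 0\<close> it is zero for every
  point, whence the Bernstein polynomial is the constant one.\<close>

definition bernstein_at :: "complex set \<Rightarrow> nat \<Rightarrow> complex \<Rightarrow> complex \<Rightarrow> real" where
  "bernstein_at V k \<xi> = bernstein V k (\<lambda>u. nat \<lfloor>real k * bary V u \<xi>\<rfloor>)"

definition pie_points :: "complex \<Rightarrow> complex set \<Rightarrow> nat \<Rightarrow> complex set" where
  "pie_points v V k = (if k = 0 then {v} else domain_points V k)"

text \<open>The coefficients, indexed by \<open>D\<close>, of \<open>s\<close> on \<open>X\<close> as \<open>w\<close> times a polynomial of degree \<open>k\<close>.\<close>

definition bb_coeffs ::
  "(complex \<Rightarrow> real) \<Rightarrow> complex set \<Rightarrow> complex set \<Rightarrow> nat \<Rightarrow> complex set \<Rightarrow> (complex \<Rightarrow> real) \<Rightarrow> complex \<Rightarrow> real"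
where
  "bb_coeffs w X V k D s = (THE c. (\<forall>\<xi>. \<xi> \<notin> D \<longrightarrow> c \<xi> = 0) \<and>
     (\<forall>x\<in>X. s x = w x * (\<Sum>\<xi>\<in>D. c \<xi> * bernstein_at V k \<xi> x)))"

subsection \<open>Determining sets\<close>

type_synonym functional = "(complex \<Rightarrow> real) \<Rightarrow> real"

text \<open>Functionals on \<open>S\<close> are extensional, so that their equality is equality on \<open>S\<close>.\<close>

definition dual_space :: "(complex \<Rightarrow> real) set \<Rightarrow> functional set" where
  "dual_space S = {f \<in> extensional S.
     (\<forall>s\<in>S. \<forall>t\<in>S. f (\<lambda>x. s x + t x) = f s + f t) \<and> (\<forall>c. \<forall>s\<in>S. f (\<lambda>x. c * s x) = c * f s)}"

definition determining_set :: "(complex \<Rightarrow> real) set \<Rightarrow> functional set \<Rightarrow> bool" where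
  "determining_set S \<Lambda> \<longleftrightarrow> \<Lambda> \<subseteq> dual_space S \<and> (\<forall>s\<in>S. (\<forall>f\<in>\<Lambda>. f s = 0) \<longrightarrow> s = (\<lambda>x. 0))"

definition minimal_determining_set :: "(complex \<Rightarrow> real) set \<Rightarrow> functional set \<Rightarrow> bool" where
  "minimal_determining_set S \<Lambda> \<longleftrightarrow> finite \<Lambda> \<and> determining_set S \<Lambda> \<and>
     (\<forall>\<Lambda>'. finite \<Lambda>' \<and> determining_set S \<Lambda>' \<longrightarrow> card \<Lambda> \<le> card \<Lambda>')"

definition dual_spline :: "(complex \<Rightarrow> real) set \<Rightarrow> functional set \<Rightarrow> functional \<Rightarrow> complex \<Rightarrow> real" where
  "dual_spline S \<Lambda> f = (THE s. s \<in> S \<and> (\<forall>g\<in>\<Lambda>. g s = (if g = f then 1 else 0)))"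

definition active :: "(complex \<Rightarrow> real) set \<Rightarrow> functional set \<Rightarrow> cell \<Rightarrow> functional set" where
  "active S \<Lambda> T = {f \<in> \<Lambda>. region T \<subseteq> closure {x. dual_spline S \<Lambda> f x \<noteq> 0}}"

definition covering_number :: "(complex \<Rightarrow> real) set \<Rightarrow> cell set \<Rightarrow> functional set \<Rightarrow> nat" where
  "covering_number S \<T> \<Lambda> = Max ((\<lambda>T. card (active S \<Lambda> T)) ` \<T>)"

definition supporting_set :: "(complex \<Rightarrow> real) set \<Rightarrow> complex set \<Rightarrow> functional \<Rightarrow> complex set \<Rightarrow> bool" where
  "supporting_set S \<Omega> f X \<longleftrightarrow> X \<subseteq> closure \<Omega> \<and> (\<forall>s\<in>S. (\<forall>x\<in>X. s x = 0) \<longrightarrow> f s = 0)"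

definition star :: "cell set \<Rightarrow> complex set \<Rightarrow> complex set" where
  "star \<T> E = (\<Union>T \<in> {T \<in> \<T>. region T \<inter> E \<noteq> {}}. region T)"

definition local_wrt ::
  "(complex \<Rightarrow> real) set \<Rightarrow> complex set \<Rightarrow> cell set \<Rightarrow> functional set \<Rightarrow> nat \<Rightarrow> (functional \<Rightarrow> complex set) \<Rightarrow> bool"
where
  "local_wrt S \<Omega> \<T> \<Lambda> l supp \<longleftrightarrow> (\<forall>f\<in>\<Lambda>. supporting_set S \<Omega> f (supp f)) \<and>
     (\<forall>T\<in>\<T>. \<forall>f\<in>active S \<Lambda> T. supp f \<subseteq> (star \<T> ^^ l) (region T))"

definition sup_norm :: "complex set \<Rightarrow> (complex \<Rightarrow> real) \<Rightarrow> real" where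
  "sup_norm X s = (SUP x\<in>X. \<bar>s x\<bar>)"

text \<open>The maximum over an empty set of functionals is zero.\<close>

definition stable_local_MDS ::
  "(complex \<Rightarrow> real) set \<Rightarrow> complex set \<Rightarrow> cell set \<Rightarrow> functional set \<Rightarrow> nat \<Rightarrow> nat \<Rightarrow> real \<Rightarrow> real \<Rightarrow> bool"
where
  "stable_local_MDS S \<Omega> \<T> \<Lambda> l \<kappa> K1 K2 \<longleftrightarrow>
     minimal_determining_set S \<Lambda> \<and> covering_number S \<T> \<Lambda> \<le> \<kappa> \<and>
     (\<exists>supp. local_wrt S \<Omega> \<T> \<Lambda> l supp \<and>
        (\<forall>f\<in>\<Lambda>. \<forall>s\<in>S. \<bar>f s\<bar> \<le> K1 * sup_norm (supp f) s)) \<and>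
     (\<forall>T\<in>\<T>. \<forall>s\<in>S. sup_norm (region T) s \<le> K2 * Max (insert 0 ((\<lambda>f. \<bar>f s\<bar>) ` active S \<Lambda> T)))"

subsection \<open>The set \<open>M\<^sub>0\<close>\<close>

definition straight_functional :: "(complex \<Rightarrow> real) set \<Rightarrow> nat \<Rightarrow> cell \<Rightarrow> complex \<Rightarrow> functional" where
  "straight_functional S k T \<xi> =
     (\<lambda>s\<in>S. bb_coeffs (\<lambda>x. 1) (region T) (verts T) k (domain_points (verts T) k) s \<xi>)"

definition pie_functional ::
  "(complex \<Rightarrow> real) set \<Rightarrow> (complex \<Rightarrow> real) \<Rightarrow> complex \<Rightarrow> nat \<Rightarrow> cell \<Rightarrow> complex \<Rightarrow> functional" where
  "pie_functional S qj v k T \<xi> =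
     (\<lambda>s\<in>S. bb_coeffs (\<lambda>x. qj x / qj v) (region T) (verts T) k (pie_points v (verts T) k) s \<xi>)"

text \<open>A buffer triangle may have an edge on a straight piece of the boundary. All splines vanish
  there, so the domain points on the boundary have to be removed, too (a minimal determining set
  does not contain the zero functional). If no edge of the buffer triangle lies on the boundary,
  this removes nothing more: its only boundary vertex is on an edge shared with a pie-shaped
  triangle.\<close>

definition buffer_points ::
  "complex set \<Rightarrow> nat \<Rightarrow> (nat \<Rightarrow> real \<Rightarrow> complex) \<Rightarrow> cell set \<Rightarrow> nat \<Rightarrow> cell \<Rightarrow> complex set" where
  "buffer_points \<Omega> n \<gamma> \<T> k T = domain_points (verts T) k - frontier \<Omega> -
     (\<Union>T' \<in> ordinaries n \<gamma> \<T> \<union> pies n \<gamma> \<T>. \<Union>(straight_edges n \<gamma> T \<inter> straight_edges n \<gamma> T'))"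

text \<open>As a set of functionals; domain points of different triangles that give the same functional
  on \<open>S\<close> are thereby identified. (Points alone would not do: the triangles \<open>T\<^sup>*\<close> can overlap
  other triangles.)\<close>

definition M0 ::
  "complex set \<Rightarrow> nat \<Rightarrow> (nat \<Rightarrow> real \<Rightarrow> complex) \<Rightarrow> (nat \<Rightarrow> complex \<Rightarrow> real) \<Rightarrow> cell set \<Rightarrow> nat \<Rightarrow>
   functional set" where
  "M0 \<Omega> n \<gamma> q \<T> d = (let S = spline_space \<Omega> n \<gamma> \<T> d in
     {straight_functional S d T \<xi> | T \<xi>.
        T \<in> ordinaries n \<gamma> \<T> \<and> \<xi> \<in> domain_points (verts T) d - frontier \<Omega>} \<union>
     {pie_functional S (q j) v (d - 1) T \<xi> | T j v \<xi>.
        T \<in> pies n \<gamma> \<T> \<and> pie_cell n \<gamma> j v T \<and> \<xi> \<in> pie_points v (verts T) (d - 1)} \<union>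
     {straight_functional S (d + 1) T \<xi> | T \<xi>.
        T \<in> buffers n \<gamma> \<T> \<and> \<xi> \<in> buffer_points \<Omega> n \<gamma> \<T> (d + 1) T})"

end

(* On a cell T a spline has the form w * sum of Bernstein terms, where w = 1 on a straight cell and
   w = q_j / q_j(v) on a pie-shaped one: a polynomial that vanishes on an arc of an irreducible conic
   is divisible by its equation.  Prescribed free coefficients determine the ordinary and pie-shaped
   cells; these pieces agree on common edges, since two pie-shaped cells with a common edge have
   proportional conics (at a corner between two different conics there is a buffer triangle, and a
   planarity argument excludes a third cell between two pies sharing the edge).  The remaining
   coefficients of the buffer triangles, of degree d + 1, are then read off along the shared edges.

   The coefficients of a polynomial are bounded by its values on the positive part of the standard
   simplex, and those of s / w are controlled on a disc where w is bounded below: along rays from the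
   interior vertex v the function w is a quadratic, and the condition on its derivative at the curved
   side gives w >= min 1 B / 2 on the image of T under the homothety of ratio 1/2 about v, which
   contains a disc of radius comparable to the diameter of T.

   Cutting off a coefficient family outside a cell shows that a functional represented in two cells
   belongs to a point of both of them; hence the supports are 1-local. *)
theory Submission
  imports Defs "HOL-Computational_Algebra.Computational_Algebra" "HOL-Computational_Algebra.Field_as_Ring"
begin

text \<open>The three kinds of cells carry expansions of different type. A pie has
  \<open>weight\<close> times degree \<open>d - 1\<close> over a straight triangle that need neither
  contain the cell nor lie in it; buffers have degree \<open>d + 1\<close>, which lets them take up
  along an edge both a pie (a conic times degree \<open>d - 1\<close>) and an ordinary cell (degree
  \<open>d\<close>). Domain points of a pie can fall into foreign cells, so a point alone does not
  identify a functional. Hence \<open>spline_interpolation\<close> asks the data to agree only at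
  points of both cells where the two coefficients coincide on all splines. Data of the form
  \<open>g (functional T \<xi>)\<close> meet this automatically, so arbitrary values can be
  prescribed without deciding which domain points coincide. This yields dual splines, hence
  minimality by counting. Stability is first proved with \<open>local_set\<close>, an explicit list
  of functionals that contains the active ones; passing to the active ones costs nothing, since on a
  cell a spline equals the active part of its expansion. \<open>R\<close> enters the constants only
  through \<open>spread\<close>, the ratio at which bounds are extended from a disc.\<close>

section \<open>Polynomials in two variables: coefficient bounds and growth\<close>

lemma poly2_add: "f \<in> poly2 k \<Longrightarrow> g \<in> poly2 k \<Longrightarrow> (\<lambda>x. f x + g x) \<in> poly2 k"
proof -
  assume "f \<in> poly2 k" "g \<in> poly2 k"
  then obtain c c' where c: "\<forall>x. f x = (\<Sum>i\<le>k. \<Sum>j\<le>k - i. c i j * Re x ^ i * Im x ^ j)"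
    and c': "\<forall>x. g x = (\<Sum>i\<le>k. \<Sum>j\<le>k - i. c' i j * Re x ^ i * Im x ^ j)" by (auto simp: poly2_def)
  show ?thesis unfolding poly2_def
    by (rule CollectI, rule exI[of _ "\<lambda>i j. c i j + c' i j"]) (simp add: c c' sum.distrib algebra_simps)
qed

lemma poly2_scale: "f \<in> poly2 k \<Longrightarrow> (\<lambda>x. a * f x) \<in> poly2 k"
proof -
  assume "f \<in> poly2 k"
  then obtain c where c: "\<forall>x. f x = (\<Sum>i\<le>k. \<Sum>j\<le>k - i. c i j * Re x ^ i * Im x ^ j)"
    by (auto simp: poly2_def)
  show ?thesis unfolding poly2_def
    by (rule CollectI, rule exI[of _ "\<lambda>i j. a * c i j"]) (simp add: c sum_distrib_left algebra_simps)
qed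

lemma poly2_monomial:
  assumes "i + j \<le> k" shows "(\<lambda>x. Re x ^ i * Im x ^ j) \<in> poly2 k"
proof -
  have "(\<Sum>i'\<le>k. \<Sum>j'\<le>k - i'. (if i' = i \<and> j' = j then 1 else 0) * Re x ^ i' * Im x ^ j')
        = Re x ^ i * Im x ^ j" for x
  proof -
    have "(\<Sum>j'\<le>k - i'. (if i' = i \<and> j' = j then 1 else 0) * Re x ^ i' * Im x ^ j') =
        (if i' = i then \<Sum>j'\<le>k - i'. if j' = j then Re x ^ i * Im x ^ j else 0 else 0)" for i'
    proof -
      have "(if i' = i \<and> j' = j then 1 else 0) * Re x ^ i' * Im x ^ j' =
          (if i' = i then if j' = j then Re x ^ i * Im x ^ j else 0 else 0)" for j' by auto
      then show ?thesis by (simp only:) (cases "i' = i"; simp)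
    qed
    then show ?thesis using assms by simp
  qed
  then show ?thesis unfolding poly2_def by (intro CollectI exI[of _ "\<lambda>i' j'. if i' = i \<and> j' = j then 1 else 0"]) simp
qed

lemma poly2_const: "(\<lambda>x. a) \<in> poly2 k"
  using poly2_scale[OF poly2_monomial[of 0 0 k], of a] by simp

lemma poly2_sum: "(\<And>i. i \<in> I \<Longrightarrow> f i \<in> poly2 k) \<Longrightarrow> (\<lambda>x. \<Sum>i\<in>I. f i x) \<in> poly2 k"
  by (induction I rule: infinite_finite_induct) (auto intro: poly2_add poly2_const)

text \<open>Monomials span, and the case \<open>mono\<close> keeps the total degree; closure under
  products and affine substitution then needs degree counting on monomials only.\<close>

lemma poly2_induct [consumes 1, case_names mono add scale]:
  assumes f: "f \<in> poly2 k"
    and m: "\<And>i j. i + j \<le> k \<Longrightarrow> P (\<lambda>x. Re x ^ i * Im x ^ j)"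
    and a: "\<And>f g. P f \<Longrightarrow> P g \<Longrightarrow> P (\<lambda>x. f x + g x)"
    and s: "\<And>c f. P f \<Longrightarrow> P (\<lambda>x. c * f x)"
  shows "P f"
proof -
  obtain c where c: "f = (\<lambda>x. \<Sum>i\<le>k. \<Sum>j\<le>k - i. c i j * Re x ^ i * Im x ^ j)"
    using f by (auto simp: poly2_def)
  have z: "P (\<lambda>x. 0)" using s[OF m[of 0 0], of 0] by simp
  have su: "P (\<lambda>x. \<Sum>i\<in>I. h i x)" if "\<And>i. i \<in> I \<Longrightarrow> P (h i)" for h :: "nat \<Rightarrow> complex \<Rightarrow> real" and I
    using that by (induction I rule: infinite_finite_induct) (auto intro: z a)
  show ?thesis unfolding c mult.assoc by (intro su s m) auto
qed

lemma poly2_mono: "f \<in> poly2 k \<Longrightarrow> k \<le> l \<Longrightarrow> f \<in> poly2 l"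
  by (induction f rule: poly2_induct) (auto intro: poly2_monomial poly2_add poly2_scale)

lemma poly2_mult:
  assumes "f \<in> poly2 k" "g \<in> poly2 l" shows "(\<lambda>x. f x * g x) \<in> poly2 (k + l)"
  using assms(1)
proof (induction f rule: poly2_induct)
  case (mono i j)
  show ?case using assms(2)
  proof (induction g rule: poly2_induct)
    case (mono i' j')
    with poly2_monomial[of "i + i'" "j + j'" "k + l"] \<open>i + j \<le> k\<close> show ?case
      by (simp add: power_add algebra_simps)
  next
    case (add f g) then show ?case by (auto dest: poly2_add simp: algebra_simps)
  next
    case (scale c f) then show ?case
      using poly2_scale[of _ "k + l" c] by (fastforce simp: algebra_simps)
  qed
next
  case (add f g) then show ?case by (auto dest: poly2_add simp: algebra_simps)
next
  case (scale c f) then show ?case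
    using poly2_scale[of _ "k + l" c] by (fastforce simp: algebra_simps)
qed

lemma poly2_power: "f \<in> poly2 k \<Longrightarrow> (\<lambda>x. f x ^ m) \<in> poly2 (m * k)"
  by (induction m) (auto intro: poly2_const poly2_mult)

lemma poly2_linear: "(\<lambda>x. a + b * Re x + c * Im x) \<in> poly2 1"
proof -
  have "(\<lambda>x. a) \<in> poly2 1" "(\<lambda>x. b * (Re x ^ 1 * Im x ^ 0)) \<in> poly2 1" "(\<lambda>x. c * (Re x ^ 0 * Im x ^ 1)) \<in> poly2 1"
    by (intro poly2_const poly2_scale poly2_monomial; simp)+
  from poly2_add[OF poly2_add[OF this(1,2)] this(3)] show ?thesis by simp
qed

lemma poly2_2E:
  assumes "f \<in> poly2 2"
  obtains a b c d e h where
    "\<And>x. f x = a + b * Re x + c * Im x + d * (Re x)\<^sup>2 + e * Re x * Im x + h * (Im x)\<^sup>2"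
proof -
  obtain c where c: "\<forall>x. f x = (\<Sum>i\<le>2. \<Sum>j\<le>2 - i. c i j * Re x ^ i * Im x ^ j)"
    using assms by (auto simp: poly2_def)
  have "f x = c 0 0 + c 1 0 * Re x + c 0 1 * Im x + c 2 0 * (Re x)\<^sup>2 + c 1 1 * Re x * Im x + c 0 2 * (Im x)\<^sup>2" for x
    by (simp add: c eval_nat_numeral)
  then show ?thesis using that by blast
qed

lemma poly2_comp:
  assumes "f \<in> poly2 k" "(\<lambda>x. Re (\<phi> x)) \<in> poly2 1" "(\<lambda>x. Im (\<phi> x)) \<in> poly2 1"
  shows "(\<lambda>x. f (\<phi> x)) \<in> poly2 k"
  using assms(1)
proof (induction f rule: poly2_induct)
  case (mono i j)
  have "(\<lambda>x. Re (\<phi> x) ^ i * Im (\<phi> x) ^ j) \<in> poly2 (i * 1 + j * 1)"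
    by (intro poly2_mult poly2_power assms)
  then show ?case using mono by (auto intro: poly2_mono)
qed (auto intro: poly2_add poly2_scale)

lemma continuous_on_poly2: "f \<in> poly2 k \<Longrightarrow> continuous_on X f"
  by (induction f rule: poly2_induct) (auto intro!: continuous_intros)

text \<open>The degree bookkeeping is left to \<open>real poly\<close>; the explicit coefficient
  list is the form to which the one-variable bound \<open>abs_coeff_le\<close> applies.\<close>

lemma poly2_on_line:
  assumes "f \<in> poly2 k"
  shows "\<exists>a. \<forall>t. f (x + t *\<^sub>R h) = (\<Sum>i\<le>k. a i * t ^ i)"
proof -
  have "\<exists>p :: real poly. degree p \<le> k \<and> (\<forall>t. f (x + t *\<^sub>R h) = poly p t)"
    using assms
  proof (induction f rule: poly2_induct)
    case (mono i j)
    have "degree ([:Re x, Re h:] ^ i * [:Im x, Im h:] ^ j) \<le> degree ([:Re x, Re h:] ^ i) + degree ([:Im x, Im h:] ^ j)"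
      by (rule degree_mult_le)
    also have "degree ([:Re x, Re h:] ^ i) \<le> i"
      using degree_power_le[of "[:Re x, Re h:]" i] by (auto split: if_splits)
    also have "degree ([:Im x, Im h:] ^ j) \<le> j"
      using degree_power_le[of "[:Im x, Im h:]" j] by (auto split: if_splits)
    finally show ?case using mono
      by (intro exI[of _ "[:Re x, Re h:] ^ i * [:Im x, Im h:] ^ j"]) (simp add: poly_power)
  next
    case (add f g)
    then obtain p q where "degree p \<le> k" "degree q \<le> k" "\<forall>t. f (x + t *\<^sub>R h) = poly p t" "\<forall>t. g (x + t *\<^sub>R h) = poly q t" by blast
    then show ?case by (intro exI[of _ "p + q"]) (simp add: degree_add_le)
  next
    case (scale c f)
    then obtain p where "degree p \<le> k" "\<forall>t. f (x + t *\<^sub>R h) = poly p t" by blast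
    then show ?case by (intro exI[of _ "smult c p"]) (simp add: degree_smult_le[THEN order_trans])
  qed
  then obtain p where p: "degree p \<le> k" "\<forall>t. f (x + t *\<^sub>R h) = poly p t" by blast
  then have "f (x + t *\<^sub>R h) = (\<Sum>i\<le>k. coeff p i * t ^ i)" for t
    unfolding p(2)[rule_format] by (subst poly_altdef, intro sum.mono_neutral_left) (auto simp: coeff_eq_0)
  then show ?thesis by blast
qed

text \<open>The coefficient of \<open>X ^ Suc k\<close> is eliminated by passing from \<open>g(X)\<close> to
  \<open>g(X) - 2 ^ Suc k * g(X / 2)\<close>.\<close>

fun coeff_bound :: "nat \<Rightarrow> real" where
  "coeff_bound 0 = 1"
| "coeff_bound (Suc k) = 1 + (k + 1) * (coeff_bound k * (1 + 2 ^ Suc k)) + coeff_bound k * (1 + 2 ^ Suc k)"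

lemma coeff_bound_ge_1: "1 \<le> coeff_bound k"
  by (induction k) (auto intro!: add_nonneg_nonneg add_increasing2 mult_nonneg_nonneg)

text \<open>Equivalence of norms in a fixed degree, with an explicit constant that visibly depends
  on the degree alone. Zero is left out of the interval because later bounds come from points with
  strictly positive barycentric coordinates.\<close>

lemma abs_coeff_le:
  assumes "\<And>t. 0 < t \<Longrightarrow> t \<le> 1 \<Longrightarrow> \<bar>\<Sum>i\<le>k. a i * t ^ i\<bar> \<le> M" "i \<le> k"
  shows "\<bar>a i\<bar> \<le> coeff_bound k * M"
  using assms
proof (induction k arbitrary: a M i)
  case 0
  then show ?case using "0.prems"(1)[of 1] by simp
next
  case (Suc k)
  let ?K = "coeff_bound k * (1 + 2 ^ Suc k)"
  have M0: "0 \<le> M" using Suc.prems(1)[of 1] by linarith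
  have K0: "0 \<le> ?K" using coeff_bound_ge_1[of k] by auto
  \<comment> \<open>Coefficient of X^i in g(X) - 2^(k+1) g(X/2); the one of index
    \<open>Suc k\<close> is zero.\<close>
  define b where "b i = a i * (1 - 2 ^ (Suc k - i))" for i
  have b: "\<bar>\<Sum>i\<le>k. b i * t ^ i\<bar> \<le> (1 + 2 ^ Suc k) * M" if t: "0 < t" "t \<le> 1" for t
  proof -
    have "(\<Sum>i\<le>k. b i * t ^ i) = (\<Sum>i\<le>Suc k. b i * t ^ i)" by (simp add: b_def)
    also have "\<dots> = (\<Sum>i\<le>Suc k. a i * t ^ i) - 2 ^ Suc k * (\<Sum>i\<le>Suc k. a i * (t/2) ^ i)"
      unfolding sum_distrib_left sum_subtractf[symmetric]
      by (rule sum.cong) (auto simp: b_def power_divide power_diff field_simps)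
    finally have "\<bar>\<Sum>i\<le>k. b i * t ^ i\<bar> \<le> \<bar>\<Sum>i\<le>Suc k. a i * t ^ i\<bar> + 2 ^ Suc k * \<bar>\<Sum>i\<le>Suc k. a i * (t/2) ^ i\<bar>"
      using abs_triangle_ineq4[of "\<Sum>i\<le>Suc k. a i * t ^ i" "2 ^ Suc k * (\<Sum>i\<le>Suc k. a i * (t/2) ^ i)"]
      by (simp only: abs_mult) simp
    also have "\<dots> \<le> M + 2 ^ Suc k * M"
      using Suc.prems(1)[of t] Suc.prems(1)[of "t/2"] t by (intro add_mono mult_left_mono) auto
    finally show ?thesis by (simp add: algebra_simps)
  qed
  have low: "\<bar>a i\<bar> \<le> ?K * M" if "i \<le> k" for i
  proof -
    have "\<bar>b i\<bar> \<le> coeff_bound k * ((1 + 2 ^ Suc k) * M)" using Suc.IH[OF b that] .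
    \<comment> \<open>For \<open>i \<le> k\<close> the exponent is at least 1, so the factor has
      modulus at least 1 and dividing by it loses nothing.\<close>
    moreover have "(2::real) ^ 1 \<le> 2 ^ (Suc k - i)" using that by (intro power_increasing) auto
    then have "1 \<le> \<bar>1 - (2::real) ^ (Suc k - i)\<bar>" by auto
    then have "\<bar>a i\<bar> * 1 \<le> \<bar>b i\<bar>" unfolding b_def abs_mult by (intro mult_left_mono) auto
    ultimately show ?thesis by (simp add: mult.assoc)
  qed
  \<comment> \<open>The top coefficient is recovered from the value at 1.\<close>
  have "a (Suc k) = (\<Sum>i\<le>Suc k. a i * 1 ^ i) - (\<Sum>i\<le>k. a i)" by simp
  then have "\<bar>a (Suc k)\<bar> \<le> M + (\<Sum>i\<le>k. \<bar>a i\<bar>)"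
    using Suc.prems(1)[of 1] sum_abs[of a "{..k}"] by (smt (verit))
  also have "(\<Sum>i\<le>k. \<bar>a i\<bar>) \<le> (\<Sum>i\<le>k. ?K * M)" using low by (intro sum_mono) auto
  also have "\<dots> = (k + 1) * ?K * M" by simp
  finally have top: "\<bar>a (Suc k)\<bar> \<le> M + (k + 1) * ?K * M" by simp
  have "coeff_bound (Suc k) * M = M + (k + 1) * ?K * M + ?K * M" by (simp add: algebra_simps)
  moreover have "0 \<le> ?K * M" "0 \<le> (k + 1) * ?K * M" using M0 K0 by auto
  ultimately show ?case using low[of i] top Suc.prems(2) M0 by (cases "i = Suc k") auto
qed

text \<open>The factor gained when a bound on a disc is carried to the disc \<open>L\<close> times
  as large: \<open>k + 1\<close> coefficients along a ray, each multiplied by at most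
  \<open>L ^ k\<close>.\<close>

definition growth :: "nat \<Rightarrow> real \<Rightarrow> real" where
  "growth k L = (k + 1) * (coeff_bound k * L ^ k)"

lemma growth_nonneg: "0 \<le> L \<Longrightarrow> 0 \<le> growth k L"
  using coeff_bound_ge_1[of k] by (auto simp: growth_def)

text \<open>The coefficient bound applies on the ray from \<open>c\<close> through \<open>y\<close>,
  scaled so that parameters in (0,1] stay in the disc and \<open>t = L\<close> gives
  \<open>y\<close>.\<close>

lemma poly2_growth:
  assumes f: "f \<in> poly2 k" and "0 < \<delta>" "1 \<le> L" "dist c y \<le> L * \<delta>"
    and M: "\<And>x. dist c x \<le> \<delta> \<Longrightarrow> \<bar>f x\<bar> \<le> M"
  shows "\<bar>f y\<bar> \<le> growth k L * M"
proof -
  obtain a where a: "\<And>t. f (c + t *\<^sub>R ((1/L) *\<^sub>R (y - c))) = (\<Sum>i\<le>k. a i * t ^ i)"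
    using poly2_on_line[OF f] by blast
  have L: "0 < L" using assms by simp
  have M0: "0 \<le> M" using M[of c] \<open>0 < \<delta>\<close> by (auto intro: order_trans[OF abs_ge_zero])
  have "\<bar>\<Sum>i\<le>k. a i * t ^ i\<bar> \<le> M" if "0 < t" "t \<le> 1" for t
  proof -
    have "dist c (c + t *\<^sub>R ((1/L) *\<^sub>R (y - c))) = t * (dist c y / L)"
      using that L by (simp add: dist_norm norm_minus_commute)
    also have "\<dots> \<le> 1 * \<delta>" using that assms L by (intro mult_mono) (auto simp: field_simps)
    finally show ?thesis using M a by fastforce
  qed
  then have ai: "\<bar>a i\<bar> \<le> coeff_bound k * M" if "i \<le> k" for i using abs_coeff_le that by blast
  have "f y = (\<Sum>i\<le>k. a i * L ^ i)" using a[of L] L by simp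
  also have "\<bar>\<dots>\<bar> \<le> (\<Sum>i\<le>k. \<bar>a i * L ^ i\<bar>)" by (rule sum_abs)
  also have "\<dots> \<le> (\<Sum>i\<le>k. coeff_bound k * M * L ^ k)"
    using ai assms coeff_bound_ge_1[of k] M0 L
    by (intro sum_mono) (auto simp: abs_mult intro!: mult_mono power_increasing mult_nonneg_nonneg)
  also have "\<dots> = growth k L * M" by (simp add: growth_def algebra_simps)
  finally show ?thesis .
qed

text \<open>The growth estimate with bound 0 reaches every point \<open>y\<close>, since
  \<open>L\<close> may be as large as the distance requires.\<close>

lemma poly2_zero_open:
  assumes f: "f \<in> poly2 k" and "open O'" "O' \<noteq> {}" "\<And>x. x \<in> O' \<Longrightarrow> f x = 0"
  shows "f y = 0"
proof -
  obtain c \<delta> where d: "0 < \<delta>" "cball c \<delta> \<subseteq> O'" using assms by (metis ex_in_conv open_contains_cball)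
  define L where "L = max 1 (dist c y / \<delta>)"
  have "dist c y \<le> L * \<delta>" "1 \<le> L" using d(1) by (auto simp: L_def field_simps max_def)
  then have "\<bar>f y\<bar> \<le> growth k L * 0"
    using d assms(4) by (intro poly2_growth[OF f d(1), of L c y]) force+
  then show ?thesis by simp
qed

section \<open>Coefficient bounds in several variables\<close>

text \<open>A full box of exponents, although only the homogeneous ones in
  \<open>multi_indices\<close> carry coefficients later: a box splits off one variable at a time, as
  the induction on the variables needs.\<close>

definition exponents :: "'a set \<Rightarrow> nat \<Rightarrow> ('a \<Rightarrow> nat) set" where
  "exponents V k = {\<alpha>. (\<forall>u. \<alpha> u \<le> k) \<and> (\<forall>u. u \<notin> V \<longrightarrow> \<alpha> u = 0)}"

definition multi_indices :: "'a set \<Rightarrow> nat \<Rightarrow> ('a \<Rightarrow> nat) set" where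
  "multi_indices V k = {\<alpha>. (\<forall>u. u \<notin> V \<longrightarrow> \<alpha> u = 0) \<and> (\<Sum>u\<in>V. \<alpha> u) = k}"

lemma exponents_empty: "exponents {} k = {\<lambda>_. 0}"
  by (auto simp: exponents_def)

lemma exponents_insert:
  assumes "u \<notin> V" shows "exponents (insert u V) k = (\<lambda>(i, \<alpha>). \<alpha>(u := i)) ` ({..k} \<times> exponents V k)"
proof (intro equalityI subsetI)
  fix \<alpha> assume a: "\<alpha> \<in> exponents (insert u V) k"
  show "\<alpha> \<in> (\<lambda>(i, \<alpha>). \<alpha>(u := i)) ` ({..k} \<times> exponents V k)"
    by (rule image_eqI[of _ _ "(\<alpha> u, \<alpha>(u := 0))"]) (use a assms in \<open>auto simp: exponents_def\<close>)
qed (use assms in \<open>auto simp: exponents_def\<close>)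

lemma inj_on_exponents:
  assumes "u \<notin> V" shows "inj_on (\<lambda>(i, \<alpha>). \<alpha>(u := i)) ({..k} \<times> exponents V k)"
proof (rule inj_onI, clarify)
  fix i \<alpha> j \<beta> assume a: "\<alpha> \<in> exponents V k" "\<beta> \<in> exponents V k" "\<alpha>(u := i) = \<beta>(u := j)"
  have "\<alpha> v = \<beta> v" for v
  proof (cases "v = u")
    case False
    have "(\<alpha>(u := i)) v = (\<beta>(u := j)) v" by (simp only: a(3))
    then show ?thesis unfolding fun_upd_other[OF False] .
  qed (use assms a(1,2) in \<open>auto simp: exponents_def\<close>)
  moreover have "i = j" using fun_cong[OF a(3), of u] by simp
  ultimately show "i = j \<and> \<alpha> = \<beta>" by auto
qed

lemma finite_exponents: "finite V \<Longrightarrow> finite (exponents V k)"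
  by (induction V rule: finite_induct) (auto simp: exponents_empty exponents_insert)

lemma card_exponents: "finite V \<Longrightarrow> card (exponents V k) = (k + 1) ^ card V"
  by (induction V rule: finite_induct) (auto simp: exponents_empty exponents_insert card_image inj_on_exponents card_cartesian_product)

text \<open>For fixed values of the other variables the one-variable bound controls each coefficient
  polynomial \<open>g i\<close>; the induction hypothesis then bounds the coefficients of
  \<open>g i\<close>.\<close>

lemma abs_coeff_le_box:
  assumes "finite V"
    and "\<And>y. (\<forall>u\<in>V. 0 < y u \<and> y u \<le> 1) \<Longrightarrow> \<bar>\<Sum>\<alpha>\<in>exponents V k. a \<alpha> * (\<Prod>u\<in>V. y u ^ \<alpha> u)\<bar> \<le> M"
    and "\<alpha> \<in> exponents V k"
  shows "\<bar>a \<alpha>\<bar> \<le> coeff_bound k ^ card V * M"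
  using assms
proof (induction V arbitrary: a M \<alpha> rule: finite_induct)
  case empty
  then show ?case by (simp add: exponents_empty)
next
  case (insert u V)
  obtain i \<beta> where \<alpha>: "\<alpha> = \<beta>(u := i)" "i \<le> k" "\<beta> \<in> exponents V k"
    using insert.prems(2) insert.hyps by (auto simp: exponents_insert)
  have step: "\<bar>a (\<beta>(u := i))\<bar> \<le> coeff_bound k ^ card V * (coeff_bound k * M)"
  proof (rule insert.IH[where a = "\<lambda>\<beta>. a (\<beta>(u := i))", OF _ \<alpha>(3)])
    fix y assume y: "\<forall>u\<in>V. (0::real) < y u \<and> y u \<le> 1"
    define g where "g i = (\<Sum>\<alpha>\<in>exponents V k. a (\<alpha>(u := i)) * (\<Prod>v\<in>V. y v ^ \<alpha> v))" for i
    have "\<bar>\<Sum>i\<le>k. g i * t ^ i\<bar> \<le> M" if t: "0 < t" "t \<le> 1" for t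
    proof -
      have pr: "(\<Prod>v\<in>V. (y(u := t)) v ^ (\<alpha>(u := i)) v) = (\<Prod>v\<in>V. y v ^ \<alpha> v)" for \<alpha> i
        using insert.hyps by (intro prod.cong) auto
      have "(\<Sum>\<alpha>\<in>exponents (insert u V) k. a \<alpha> * (\<Prod>v\<in>insert u V. (y(u := t)) v ^ \<alpha> v)) =
          (\<Sum>(i, \<alpha>)\<in>{..k} \<times> exponents V k. a (\<alpha>(u := i)) * (t ^ i * (\<Prod>v\<in>V. y v ^ \<alpha> v)))"
        unfolding exponents_insert[OF insert.hyps(2)] sum.reindex[OF inj_on_exponents[OF insert.hyps(2)]]
        using insert.hyps pr by (intro sum.cong) auto
      also have "\<dots> = (\<Sum>i\<le>k. g i * t ^ i)"
        unfolding g_def sum_distrib_right sum.cartesian_product by (intro sum.cong) auto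
      finally show ?thesis using insert.prems(1)[of "y(u := t)"] y t by auto
    qed
    from abs_coeff_le[OF this \<alpha>(2)] show "\<bar>\<Sum>\<beta>\<in>exponents V k. a (\<beta>(u := i)) * (\<Prod>v\<in>V. y v ^ \<beta> v)\<bar> \<le> coeff_bound k * M"
      by (simp add: g_def)
  qed
  then show ?case unfolding \<alpha>(1) card_insert_disjoint[OF insert.hyps] by (simp only: power_Suc mult_ac)
qed

subsection \<open>Barycentric coordinates\<close>

text \<open>Vertices, edges and triangles at once. A nonempty subset is again of this kind, so
  restriction to an edge stays within one theory.\<close>

definition independent_verts :: "complex set \<Rightarrow> bool" where
  "independent_verts V \<longleftrightarrow> finite V \<and> V \<noteq> {} \<and> \<not> affine_dependent V"

lemma independent_verts_subset:
  "independent_verts V \<Longrightarrow> F \<subseteq> V \<Longrightarrow> F \<noteq> {} \<Longrightarrow> independent_verts F"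
  by (auto simp: independent_verts_def affine_dependent_subset intro: finite_subset)

lemma bary_unique:
  assumes V: "independent_verts V"
    and b: "\<And>w. w \<notin> V \<Longrightarrow> b w = 0" "(\<Sum>w\<in>V. b w) = 1" "(\<Sum>w\<in>V. b w *\<^sub>R w) = x"
  shows "bary V u x = b u"
proof -
  have fin: "finite V" and ind: "\<not> affine_dependent V" using V by (auto simp: independent_verts_def)
  have "b' = b" if b': "\<forall>w. w \<notin> V \<longrightarrow> b' w = 0" "(\<Sum>w\<in>V. b' w) = 1" "(\<Sum>w\<in>V. b' w *\<^sub>R w) = x" for b'
  proof -
    have s: "sum (\<lambda>w. b' w - b w) V = 0" "(\<Sum>w\<in>V. (b' w - b w) *\<^sub>R w) = 0"
      using b b' by (simp_all add: sum_subtractf scaleR_left_diff_distrib)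
    then have "\<forall>w\<in>V. b' w - b w = 0"
      using ind unfolding affine_dependent_explicit_finite[OF fin] by blast
    then show ?thesis using b(1) b'(1) by (auto simp: fun_eq_iff)
  qed
  then have "(THE b. (\<forall>w. w \<notin> V \<longrightarrow> b w = 0) \<and> (\<Sum>w\<in>V. b w) = 1 \<and> (\<Sum>w\<in>V. b w *\<^sub>R w) = x) = b"
    using b by (intro the_equality) auto
  then show ?thesis unfolding bary_def by simp
qed

lemma bary_props:
  assumes V: "independent_verts V" and x: "x \<in> affine hull V"
  shows bary_outside: "\<And>w. w \<notin> V \<Longrightarrow> bary V w x = 0"
    and sum_bary: "(\<Sum>w\<in>V. bary V w x) = 1"
    and sum_bary_scaleR: "(\<Sum>w\<in>V. bary V w x *\<^sub>R w) = x"
proof -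
  have fin: "finite V" using V by (auto simp: independent_verts_def)
  obtain c where c: "sum c V = 1" "(\<Sum>w\<in>V. c w *\<^sub>R w) = x"
    using x unfolding affine_hull_finite[OF fin] by auto
  define b where "b w = (if w \<in> V then c w else 0)" for w
  have b: "\<And>w. w \<notin> V \<Longrightarrow> b w = 0" "(\<Sum>w\<in>V. b w) = 1" "(\<Sum>w\<in>V. b w *\<^sub>R w) = x"
    using c by (auto simp: b_def)
  have "bary V u x = b u" for u by (rule bary_unique[OF V b])
  then show "\<And>w. w \<notin> V \<Longrightarrow> bary V w x = 0" "(\<Sum>w\<in>V. bary V w x) = 1" "(\<Sum>w\<in>V. bary V w x *\<^sub>R w) = x"
    using b by auto
qed

text \<open>Coordinates with respect to the face, extended by zero, satisfy the conditions that
  determine those with respect to \<open>V\<close>.\<close>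

lemma bary_face:
  assumes V: "independent_verts V" and F: "F \<subseteq> V" and x: "x \<in> affine hull F"
  shows "bary V u x = bary F u x"
proof -
  have fin: "finite V" using V by (auto simp: independent_verts_def)
  have "F \<noteq> {}" using x by auto
  then have F': "independent_verts F" using independent_verts_subset V F by blast
  note p = bary_props[OF F' x]
  show ?thesis
  proof (rule bary_unique[OF V])
    show "bary F w x = 0" if "w \<notin> V" for w using p(1) that F by auto
    show "(\<Sum>w\<in>V. bary F w x) = 1"
      using p fin F by (subst sum.mono_neutral_right[of V F]) auto
    show "(\<Sum>w\<in>V. bary F w x *\<^sub>R w) = x"
      using p fin F by (subst sum.mono_neutral_right[of V F]) auto
  qed
qed

lemma bary_vertex:
  assumes "independent_verts V" "w \<in> V" shows "bary V u w = (if u = w then 1 else 0)"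
proof -
  have "finite V" using assms by (auto simp: independent_verts_def)
  then show ?thesis using assms
    by (intro bary_unique) (auto simp: if_distrib[where f = "\<lambda>z. z *\<^sub>R _"] cong: if_cong)
qed

lemma bary_combination:
  assumes V: "independent_verts V" and b: "(\<Sum>w\<in>V. b w) = 1" and u: "u \<in> V"
  shows "bary V u (\<Sum>w\<in>V. b w *\<^sub>R w) = b u"
  using bary_unique[OF V, of "\<lambda>w. if w \<in> V then b w else 0"] b u by (auto cong: sum.cong)

lemma combination_in_affine_hull:
  assumes "independent_verts V" "(\<Sum>w\<in>V. b w) = 1" shows "(\<Sum>w\<in>V. b w *\<^sub>R w) \<in> affine hull V"
  using assms by (auto simp: affine_hull_finite independent_verts_def)

lemma in_convex_hull_bary:
  assumes V: "independent_verts V"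
  shows "x \<in> convex hull V \<longleftrightarrow> x \<in> affine hull V \<and> (\<forall>u\<in>V. 0 \<le> bary V u x)"
proof
  assume x: "x \<in> convex hull V"
  have fin: "finite V" using V by (auto simp: independent_verts_def)
  obtain c where c: "\<forall>w\<in>V. 0 \<le> c w" "sum c V = 1" "(\<Sum>w\<in>V. c w *\<^sub>R w) = x"
    using x unfolding convex_hull_finite[OF fin] by auto
  then show "x \<in> affine hull V \<and> (\<forall>u\<in>V. 0 \<le> bary V u x)"
    using bary_combination[OF V c(2)] combination_in_affine_hull[OF V c(2)] by auto
next
  assume x: "x \<in> affine hull V \<and> (\<forall>u\<in>V. 0 \<le> bary V u x)"
  have fin: "finite V" using V by (auto simp: independent_verts_def)
  show "x \<in> convex hull V" unfolding convex_hull_finite[OF fin]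
    using bary_props[OF V conjunct1[OF x]] x by (auto intro!: exI[of _ "\<lambda>u. bary V u x"])
qed

lemma bary_le_1:
  assumes V: "independent_verts V" and x: "x \<in> convex hull V"
  shows "bary V u x \<le> 1"
proof (cases "u \<in> V")
  case True
  have "finite V" using V by (auto simp: independent_verts_def)
  then have "bary V u x \<le> (\<Sum>w\<in>V. bary V w x)"
    using x True by (intro member_le_sum) (auto simp: in_convex_hull_bary[OF V])
  then show ?thesis using sum_bary[OF V] x by (auto simp: in_convex_hull_bary[OF V])
next
  case False
  then show ?thesis using bary_outside[OF V] x by (auto simp: in_convex_hull_bary[OF V])
qed

lemma in_convex_hull_face:
  assumes V: "independent_verts V" and F: "F \<subseteq> V" "F \<noteq> {}" and x: "x \<in> convex hull V"
  shows "x \<in> convex hull F \<longleftrightarrow> (\<forall>u\<in>V - F. bary V u x = 0)"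
proof
  have F': "independent_verts F" using independent_verts_subset V F by blast
  assume "x \<in> convex hull F"
  then have "x \<in> affine hull F" using in_convex_hull_bary[OF F'] by auto
  then show "\<forall>u\<in>V - F. bary V u x = 0" using bary_face[OF V F(1)] bary_outside[OF F'] by auto
next
  assume z: "\<forall>u\<in>V - F. bary V u x = 0"
  have fin: "finite V" "finite F" using V F by (auto simp: independent_verts_def intro: finite_subset)
  have xa: "x \<in> affine hull V" "\<forall>u\<in>V. 0 \<le> bary V u x" using x in_convex_hull_bary[OF V] by auto
  have "(\<Sum>w\<in>F. bary V w x) = 1" "(\<Sum>w\<in>F. bary V w x *\<^sub>R w) = x"
    using bary_props(2,3)[OF V xa(1)] z F fin sum.mono_neutral_left[of V F "\<lambda>w. bary V w x"]
      sum.mono_neutral_left[of V F "\<lambda>w. bary V w x *\<^sub>R w"] by auto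
  then show "x \<in> convex hull F" unfolding convex_hull_finite[OF fin(2)]
    using xa F by (auto intro!: exI[of _ "\<lambda>u. bary V u x"])
qed

lemma affine_hull_triangle:
  assumes "independent_verts V" "card V = 3" shows "affine hull V = UNIV"
  using affine_independent_span_gt[of V] assms by (auto simp: independent_verts_def affine_independent_span_eq)

text \<open>An affine function is fixed by its values at 0, 1 and \<i>. The affine interpolants of
  these values satisfy the defining conditions of the coordinates at every point, and uniqueness
  does the rest.\<close>

lemma bary_poly2:
  assumes V: "independent_verts V" and c: "card V = 3"
  shows "bary V u \<in> poly2 1"
proof -
  note h = affine_hull_triangle[OF V c]
  note p = bary_props[OF V, unfolded h, OF UNIV_I]
  define b where "b x w = bary V w 0 + (bary V w 1 - bary V w 0) * Re x + (bary V w \<i> - bary V w 0) * Im x" for x w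
  have "bary V u x = b x u" for x
  proof (rule bary_unique[OF V])
    show "b x w = 0" if "w \<notin> V" for w using p(1) that by (simp add: b_def)
    have "(\<Sum>w\<in>V. b x w) = (\<Sum>w\<in>V. bary V w 0) + ((\<Sum>w\<in>V. bary V w 1) - (\<Sum>w\<in>V. bary V w 0)) * Re x +
        ((\<Sum>w\<in>V. bary V w \<i>) - (\<Sum>w\<in>V. bary V w 0)) * Im x"
      by (simp add: b_def sum.distrib sum_subtractf sum_distrib_right left_diff_distrib)
    then show "(\<Sum>w\<in>V. b x w) = 1" using p(2) by simp
    have "b x w *\<^sub>R w = bary V w 0 *\<^sub>R w + Re x *\<^sub>R (bary V w 1 *\<^sub>R w - bary V w 0 *\<^sub>R w) +
        Im x *\<^sub>R (bary V w \<i> *\<^sub>R w - bary V w 0 *\<^sub>R w)" for w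
      by (simp add: b_def algebra_simps)
    then have "(\<Sum>w\<in>V. b x w *\<^sub>R w) = (\<Sum>w\<in>V. bary V w 0 *\<^sub>R w) +
        Re x *\<^sub>R ((\<Sum>w\<in>V. bary V w 1 *\<^sub>R w) - (\<Sum>w\<in>V. bary V w 0 *\<^sub>R w)) +
        Im x *\<^sub>R ((\<Sum>w\<in>V. bary V w \<i> *\<^sub>R w) - (\<Sum>w\<in>V. bary V w 0 *\<^sub>R w))"
      by (simp only: sum.distrib sum_subtractf scaleR_sum_right[symmetric])
    also have "\<dots> = x" unfolding p(3) by (simp add: complex_eq_iff)
    finally show "(\<Sum>w\<in>V. b x w *\<^sub>R w) = x" .
  qed
  then have "bary V u = (\<lambda>x. bary V u 0 + (bary V u 1 - bary V u 0) * Re x + (bary V u \<i> - bary V u 0) * Im x)"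
    unfolding b_def by (rule ext)
  then show ?thesis using poly2_linear by metis
qed

subsection \<open>Bernstein form\<close>

lemma multi_indices_subset_exponents: "finite V \<Longrightarrow> multi_indices V k \<subseteq> exponents V k"
proof
  fix \<alpha> assume "finite V" "\<alpha> \<in> multi_indices V k"
  then have a: "\<forall>u. u \<notin> V \<longrightarrow> \<alpha> u = 0" "(\<Sum>u\<in>V. \<alpha> u) = k" by (auto simp: multi_indices_def)
  have "\<alpha> u \<le> k" for u
    using a member_le_sum[of u V \<alpha>] \<open>finite V\<close> by (cases "u \<in> V") auto
  then show "\<alpha> \<in> exponents V k" using a by (auto simp: exponents_def)
qed

lemma finite_multi_indices: "finite V \<Longrightarrow> finite (multi_indices V k)"
  by (rule finite_subset[OF multi_indices_subset_exponents finite_exponents])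

lemma multi_indices_0: "finite V \<Longrightarrow> multi_indices V 0 = {\<lambda>_. 0}"
  by (auto simp: multi_indices_def)

definition lattice_point :: "complex set \<Rightarrow> nat \<Rightarrow> (complex \<Rightarrow> nat) \<Rightarrow> complex" where
  "lattice_point V k \<alpha> = (\<Sum>u\<in>V. real (\<alpha> u) *\<^sub>R u) /\<^sub>R real k"

definition index_of :: "complex set \<Rightarrow> nat \<Rightarrow> complex \<Rightarrow> complex \<Rightarrow> nat" where
  "index_of V k \<xi> = (\<lambda>u. nat \<lfloor>real k * bary V u \<xi>\<rfloor>)"

lemma bernstein_at_eq: "bernstein_at V k \<xi> = bernstein V k (index_of V k \<xi>)"
  by (simp add: bernstein_at_def index_of_def)

lemma lattice_point_combination:
  "lattice_point V k \<alpha> = (\<Sum>u\<in>V. (real (\<alpha> u) / real k) *\<^sub>R u)"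
  by (simp add: lattice_point_def scaleR_sum_right divide_inverse_commute)

lemma lattice_point_weights:
  assumes "1 \<le> k" "\<alpha> \<in> multi_indices V k"
  shows "(\<Sum>u\<in>V. real (\<alpha> u) / real k) = 1"
proof -
  have "real (\<Sum>u\<in>V. \<alpha> u) = real k" using assms by (simp add: multi_indices_def)
  then show ?thesis using assms by (simp add: sum_divide_distrib[symmetric])
qed

lemma bary_lattice_point:
  assumes V: "independent_verts V" and k: "1 \<le> k" and a: "\<alpha> \<in> multi_indices V k"
  shows "bary V u (lattice_point V k \<alpha>) = real (\<alpha> u) / real k"
  unfolding lattice_point_combination
proof (rule bary_unique[OF V])
  show "(\<Sum>u\<in>V. real (\<alpha> u) / real k) = 1" using lattice_point_weights[OF k a] .
qed (use a in \<open>auto simp: multi_indices_def\<close>)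

lemma lattice_point_in_convex_hull:
  assumes V: "independent_verts V" and k: "1 \<le> k" and a: "\<alpha> \<in> multi_indices V k"
  shows "lattice_point V k \<alpha> \<in> convex hull V"
  unfolding in_convex_hull_bary[OF V]
proof (intro conjI ballI)
  show "lattice_point V k \<alpha> \<in> affine hull V" unfolding lattice_point_combination
    by (rule combination_in_affine_hull[OF V lattice_point_weights[OF k a]])
qed (simp add: bary_lattice_point[OF assms])

lemma index_of_lattice_point:
  assumes "independent_verts V" "1 \<le> k" "\<alpha> \<in> multi_indices V k"
  shows "index_of V k (lattice_point V k \<alpha>) = \<alpha>"
  using assms by (auto simp: index_of_def bary_lattice_point)

lemma domain_points_eq: 
  assumes "finite V" shows "domain_points V k = lattice_point V k ` multi_indices V k"
proof (intro equalityI subsetI)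
  fix x assume "x \<in> domain_points V k"
  then obtain \<alpha> :: "complex \<Rightarrow> nat" where a: "x = (\<Sum>u\<in>V. real (\<alpha> u) *\<^sub>R u) /\<^sub>R real k" "(\<Sum>u\<in>V. \<alpha> u) = k"
    by (auto simp: domain_points_def)
  show "x \<in> lattice_point V k ` multi_indices V k"
    by (rule image_eqI[of _ _ "\<lambda>u. if u \<in> V then \<alpha> u else 0"])
       (use a in \<open>auto simp: lattice_point_def multi_indices_def cong: sum.cong\<close>)
qed (auto simp: domain_points_def lattice_point_def multi_indices_def)

text \<open>In degree 0 both sides are singletons for any \<open>v\<close>; in positive degree a
  lattice point returns its multi-index because the floor acts on integers.\<close>

lemma bij_betw_index_of:
  assumes V: "independent_verts V"
  shows "bij_betw (index_of V k) (pie_points v V k) (multi_indices V k)"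
proof (cases "k = 0")
  case True
  have "finite V" using V by (auto simp: independent_verts_def)
  then show ?thesis using True
    by (auto simp: pie_points_def multi_indices_0 bij_betw_def index_of_def)
next
  case False
  have "finite V" using V by (auto simp: independent_verts_def)
  with False show ?thesis using index_of_lattice_point[OF V, of k]
    by (auto simp: pie_points_def domain_points_eq bij_betw_def inj_on_def image_def)
qed

lemma finite_pie_points: "independent_verts V \<Longrightarrow> finite (pie_points v V k)"
  using bij_betw_finite[OF bij_betw_index_of] finite_multi_indices by (metis independent_verts_def)

lemma card_pie_points_le:
  assumes "independent_verts V" shows "card (pie_points v V k) \<le> (k + 1) ^ card V"
proof -
  have "finite V" using assms by (auto simp: independent_verts_def)
  then show ?thesis
    using bij_betw_same_card[OF bij_betw_index_of[OF assms, of k v]] card_exponents[of V k]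
      card_mono[OF finite_exponents multi_indices_subset_exponents, of V k] by simp
qed

lemma pie_points_pos: "1 \<le> k \<Longrightarrow> pie_points v V k = domain_points V k"
  by (simp add: pie_points_def)

lemma pie_points_in_convex_hull:
  assumes V: "independent_verts V" and v: "v \<in> V"
  shows "pie_points v V k \<subseteq> convex hull V"
proof (cases "k = 0")
  case False
  have "finite V" using V by (auto simp: independent_verts_def)
  then show ?thesis using False lattice_point_in_convex_hull[OF V, of k]
    by (auto simp: pie_points_def domain_points_eq)
qed (use v in \<open>auto simp: pie_points_def hull_inc\<close>)

lemma bary_pie_points:
  assumes V: "independent_verts V" and k: "1 \<le> k" and x: "\<xi> \<in> pie_points v V k"
  shows "bary V u \<xi> = real (index_of V k \<xi> u) / real k"
proof -
  have "finite V" using V by (auto simp: independent_verts_def)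
  then obtain \<alpha> where "\<alpha> \<in> multi_indices V k" "\<xi> = lattice_point V k \<alpha>"
    using k x by (auto simp: pie_points_pos domain_points_eq)
  then show ?thesis using bary_lattice_point[OF V k] index_of_lattice_point[OF V k] by simp
qed

lemma vertex_in_pie_points:
  assumes V: "independent_verts V" and v: "v \<in> V"
  shows "v \<in> pie_points v V k"
proof (cases "k = 0")
  case False
  have f: "finite V" using V by (auto simp: independent_verts_def)
  have "v = lattice_point V k (\<lambda>u. if u = v then k else 0)"
    using False v f by (simp add: lattice_point_def if_distrib[of real] if_distrib[of "\<lambda>z. z *\<^sub>R _"] cong: if_cong)
  moreover have "(\<lambda>u. if u = v then k else 0) \<in> multi_indices V k"
    using v f by (auto simp: multi_indices_def)
  ultimately show ?thesis using False f by (auto simp: pie_points_def domain_points_eq)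
qed (simp add: pie_points_def)

text \<open>The point \<open>v\<close> matters only for \<open>k = 0\<close>, where it is the single
  index. Carrying it along lets pies with \<open>d = 1\<close> be treated together with everything
  else.\<close>

definition bb_sum :: "complex \<Rightarrow> complex set \<Rightarrow> nat \<Rightarrow> (complex \<Rightarrow> real) \<Rightarrow> complex \<Rightarrow> real" where
  "bb_sum v V k c x = (\<Sum>\<xi>\<in>pie_points v V k. c \<xi> * bernstein_at V k \<xi> x)"

definition multinomial_coeff :: "'a set \<Rightarrow> nat \<Rightarrow> ('a \<Rightarrow> nat) \<Rightarrow> real" where
  "multinomial_coeff V k \<alpha> = fact k / (\<Prod>u\<in>V. fact (\<alpha> u))"

lemma bernstein_eq: "bernstein V k \<alpha> x = multinomial_coeff V k \<alpha> * (\<Prod>u\<in>V. bary V u x ^ \<alpha> u)"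
  by (simp add: bernstein_def multinomial_coeff_def)

lemma multinomial_coeff_nonneg: "0 \<le> multinomial_coeff V k \<alpha>"
  unfolding multinomial_coeff_def by (intro divide_nonneg_nonneg prod_nonneg) auto

lemma multinomial_coeff_le: "multinomial_coeff V k \<alpha> \<le> fact k"
proof -
  have "1 \<le> (\<Prod>u\<in>V. fact (\<alpha> u) :: real)" by (intro prod_ge_1) auto
  then show ?thesis using mult_left_mono[of 1 "\<Prod>u\<in>V. fact (\<alpha> u)" "fact k :: real"]
    by (simp add: multinomial_coeff_def divide_le_eq)
qed

lemma multinomial_coeff_ge:
  assumes "finite V" "\<alpha> \<in> multi_indices V k"
  shows "1 / fact k ^ card V \<le> multinomial_coeff V k \<alpha>"
proof -
  have "\<alpha> \<in> exponents V k" using assms multi_indices_subset_exponents by blast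
  then have "(\<Prod>u\<in>V. fact (\<alpha> u) :: real) \<le> (\<Prod>u\<in>V. fact k)"
    by (intro prod_mono) (auto simp: exponents_def intro: fact_mono)
  then have "(1::real) / fact k ^ card V \<le> fact k / (\<Prod>u\<in>V. fact (\<alpha> u))"
    by (intro frac_le) (auto intro: prod_pos)
  then show ?thesis by (simp add: multinomial_coeff_def)
qed

lemma bb_sum_eq:
  assumes V: "independent_verts V"
  shows "bb_sum v V k c x = (\<Sum>\<alpha>\<in>multi_indices V k.
    c (inv_into (pie_points v V k) (index_of V k) \<alpha>) * bernstein V k \<alpha> x)"
proof -
  note b = bij_betw_index_of[OF V, of k v]
  have "(\<Sum>\<alpha>\<in>multi_indices V k. c (inv_into (pie_points v V k) (index_of V k) \<alpha>) * bernstein V k \<alpha> x) =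
      (\<Sum>\<xi>\<in>pie_points v V k. c (inv_into (pie_points v V k) (index_of V k) (index_of V k \<xi>)) *
         bernstein V k (index_of V k \<xi>) x)"
    by (rule sum.reindex_bij_betw[OF b, symmetric])
  also have "\<dots> = bb_sum v V k c x"
    unfolding bb_sum_def bernstein_at_eq
    by (intro sum.cong[OF refl]) (simp add: inv_into_f_f[OF bij_betw_imp_inj_on[OF b]])
  finally show ?thesis by simp
qed

lemma bb_sum_add: "bb_sum v V k (\<lambda>\<xi>. c \<xi> + c' \<xi>) x = bb_sum v V k c x + bb_sum v V k c' x"
  by (simp add: bb_sum_def sum.distrib distrib_right)

lemma bb_sum_scale: "bb_sum v V k (\<lambda>\<xi>. a * c \<xi>) x = a * bb_sum v V k c x"
  by (simp add: bb_sum_def sum_distrib_left mult.assoc)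

lemma bb_sum_diff: "bb_sum v V k (\<lambda>\<xi>. c \<xi> - c' \<xi>) x = bb_sum v V k c x - bb_sum v V k c' x"
  by (simp add: bb_sum_def sum_subtractf left_diff_distrib)

lemma bb_sum_cong: "(\<And>\<xi>. \<xi> \<in> pie_points v V k \<Longrightarrow> c \<xi> = c' \<xi>) \<Longrightarrow> bb_sum v V k c x = bb_sum v V k c' x"
  by (simp add: bb_sum_def cong: sum.cong)

lemma bb_sum_pos: "1 \<le> k \<Longrightarrow> bb_sum v V k = bb_sum w V k"
  by (auto simp: bb_sum_def pie_points_def fun_eq_iff)

text \<open>A crude count instead of the partition of unity: each Bernstein polynomial is at most
  \<open>fact k\<close>, and the points are counted in the box of exponents.\<close>

lemma abs_bb_sum_le:
  assumes V: "independent_verts V" and x: "x \<in> convex hull V"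
    and c: "\<And>\<xi>. \<xi> \<in> pie_points v V k \<Longrightarrow> \<bar>c \<xi>\<bar> \<le> M" and M: "0 \<le> M"
  shows "\<bar>bb_sum v V k c x\<bar> \<le> (k + 1) ^ card V * fact k * M"
proof -
  have xh: "0 \<le> bary V u x" "bary V u x \<le> 1" if "u \<in> V" for u
    using x bary_le_1[OF V x] that by (auto simp: in_convex_hull_bary[OF V])
  have "\<bar>c \<xi> * bernstein_at V k \<xi> x\<bar> \<le> M * fact k" if "\<xi> \<in> pie_points v V k" for \<xi>
  proof -
    have "0 \<le> (\<Prod>u\<in>V. bary V u x ^ n u)" "(\<Prod>u\<in>V. bary V u x ^ n u) \<le> 1" for n
      using xh by (auto intro!: prod_nonneg prod_le_1 power_le_one)
    moreover have "0 \<le> multinomial_coeff V k \<alpha>" for \<alpha> by (rule multinomial_coeff_nonneg)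
    ultimately have "\<bar>bernstein_at V k \<xi> x\<bar> \<le> fact k * 1"
      unfolding bernstein_at_eq bernstein_eq abs_mult
      by (intro mult_mono) (auto simp: multinomial_coeff_le)
    then show ?thesis unfolding abs_mult using c[OF that] M by (intro mult_mono) auto
  qed
  then have "\<bar>bb_sum v V k c x\<bar> \<le> (\<Sum>\<xi>\<in>pie_points v V k. M * fact k)"
    unfolding bb_sum_def by (intro order_trans[OF sum_abs] sum_mono)
  also have "\<dots> = real (card (pie_points v V k)) * (M * fact k)" by simp
  also have "\<dots> \<le> real ((k + 1) ^ card V) * (M * fact k)"
    by (intro mult_right_mono) (use card_pie_points_le[OF V, of v k] M in \<open>auto simp flip: of_nat_power simp del: of_nat_Suc of_nat_power\<close>)
  finally show ?thesis by (simp add: mult_ac add_ac)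
qed

text \<open>The factors have separate origins: \<open>m ^ k\<close> comes from homogeneity, the
  power of \<open>coeff_bound\<close> from the box, and \<open>fact k ^ m\<close> from dividing out
  the multinomial coefficient.\<close>

definition bb_bound :: "nat \<Rightarrow> nat \<Rightarrow> real" where
  "bb_bound m k = fact k ^ m * (coeff_bound k ^ m * m ^ k)"

lemma bb_bound_nonneg: "0 \<le> bb_bound m k"
  using coeff_bound_ge_1[of k] by (auto simp: bb_bound_def)

text \<open>Homogeneity: with \<open>y = (\<Sum> y) b\<close> the monomials in the barycentric coordinates \<open>b\<close> become
  those in \<open>y \<in> (0, 1]\<^sup>V\<close>, at the price of the factor \<open>(\<Sum> y) ^ k\<close>.\<close>

lemma bb_coeff_le:
  assumes V: "independent_verts V"
    and M: "\<And>x. x \<in> convex hull V \<Longrightarrow> (\<forall>u\<in>V. 0 < bary V u x) \<Longrightarrow> \<bar>bb_sum v V k c x\<bar> \<le> M"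
    and x: "\<xi> \<in> pie_points v V k"
  shows "\<bar>c \<xi>\<bar> \<le> bb_bound (card V) k * M"
proof -
  have fin: "finite V" and ne: "V \<noteq> {}" using V by (auto simp: independent_verts_def)
  define m where "m = card V"
  define d where "d \<alpha> = c (inv_into (pie_points v V k) (index_of V k) \<alpha>) * multinomial_coeff V k \<alpha>" for \<alpha>
  define a where "a \<alpha> = (if \<alpha> \<in> multi_indices V k then d \<alpha> else 0)" for \<alpha>
  define \<beta> where "\<beta> = index_of V k \<xi>"
  have \<beta>: "\<beta> \<in> multi_indices V k" "inv_into (pie_points v V k) (index_of V k) \<beta> = \<xi>"
    using bij_betw_index_of[OF V, of k v] x by (auto simp: bij_betw_def \<beta>_def)
  have "\<bar>a \<beta>\<bar> \<le> coeff_bound k ^ m * (m ^ k * M)"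
    unfolding m_def
  proof (rule abs_coeff_le_box[OF fin])
    show "\<beta> \<in> exponents V k" using \<beta> multi_indices_subset_exponents[OF fin] by blast
    fix y assume y: "\<forall>u\<in>V. (0::real) < y u \<and> y u \<le> 1"
    define S where "S = (\<Sum>u\<in>V. y u)"
    have S0: "0 < S" unfolding S_def using y ne fin by (intro sum_pos) auto
    have S1: "S \<le> real (card V)" unfolding S_def using sum_bounded_above[of V y 1] y by auto
    define x where "x = (\<Sum>u\<in>V. (y u / S) *\<^sub>R u)"
    have one: "(\<Sum>u\<in>V. y u / S) = 1" using S0 by (simp add: S_def flip: sum_divide_distrib)
    have b: "bary V u x = y u / S" if "u \<in> V" for u
      unfolding x_def by (rule bary_combination[OF V one that])
    have xh: "x \<in> convex hull V" unfolding in_convex_hull_bary[OF V]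
      using combination_in_affine_hull[OF V one] b y S0 by (auto simp: x_def less_imp_le)
    have "(\<Sum>\<alpha>\<in>exponents V k. a \<alpha> * (\<Prod>u\<in>V. y u ^ \<alpha> u)) = (\<Sum>\<alpha>\<in>multi_indices V k. d \<alpha> * (\<Prod>u\<in>V. y u ^ \<alpha> u))"
      using multi_indices_subset_exponents[OF fin] finite_exponents[OF fin]
      by (intro sum.mono_neutral_cong_right) (auto simp: a_def)
    also have "\<dots> = (\<Sum>\<alpha>\<in>multi_indices V k. S ^ k * (d \<alpha> * (\<Prod>u\<in>V. bary V u x ^ \<alpha> u)))"
    proof (rule sum.cong[OF refl])
      fix \<alpha> assume "\<alpha> \<in> multi_indices V k"
      then have "S ^ k = (\<Prod>u\<in>V. S ^ \<alpha> u)" by (simp add: multi_indices_def flip: power_sum)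
      moreover have "(\<Prod>u\<in>V. y u ^ \<alpha> u) = (\<Prod>u\<in>V. S ^ \<alpha> u * bary V u x ^ \<alpha> u)"
        using b S0 by (intro prod.cong) (auto simp flip: power_mult_distrib)
      ultimately show "d \<alpha> * (\<Prod>u\<in>V. y u ^ \<alpha> u) = S ^ k * (d \<alpha> * (\<Prod>u\<in>V. bary V u x ^ \<alpha> u))"
        by (simp add: prod.distrib)
    qed
    also have "\<dots> = S ^ k * bb_sum v V k c x"
      unfolding bb_sum_eq[OF V] bernstein_eq sum_distrib_left d_def by (simp add: mult_ac)
    finally have "\<bar>\<Sum>\<alpha>\<in>exponents V k. a \<alpha> * (\<Prod>u\<in>V. y u ^ \<alpha> u)\<bar> = S ^ k * \<bar>bb_sum v V k c x\<bar>"
      using S0 by (simp add: abs_mult)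
    also have "\<dots> \<le> real (card V) ^ k * M"
      using M[OF xh] b y S0 S1 by (intro mult_mono power_mono) auto
    finally show "\<bar>\<Sum>\<alpha>\<in>exponents V k. a \<alpha> * (\<Prod>u\<in>V. y u ^ \<alpha> u)\<bar> \<le> real (card V ^ k) * M" by simp
  qed
  moreover have "a \<beta> = c \<xi> * multinomial_coeff V k \<beta>" using \<beta> by (simp add: a_def d_def)
  ultimately have le: "\<bar>c \<xi>\<bar> * multinomial_coeff V k \<beta> \<le> coeff_bound k ^ m * (m ^ k * M)"
    by (simp add: abs_mult multinomial_coeff_def abs_divide abs_prod)
  have "\<bar>c \<xi>\<bar> * (1 / fact k ^ m) \<le> \<bar>c \<xi>\<bar> * multinomial_coeff V k \<beta>"
    using multinomial_coeff_ge[OF fin \<beta>(1)] by (intro mult_left_mono) (auto simp: m_def)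
  with le have "\<bar>c \<xi>\<bar> / fact k ^ m \<le> coeff_bound k ^ m * (m ^ k * M)" by simp
  then show ?thesis by (simp add: bb_bound_def m_def divide_le_eq mult_ac)
qed

lemma bb_coeff_zero:
  assumes V: "independent_verts V"
    and "\<And>x. x \<in> convex hull V \<Longrightarrow> (\<forall>u\<in>V. 0 < bary V u x) \<Longrightarrow> bb_sum v V k c x = 0"
    and "\<xi> \<in> pie_points v V k"
  shows "c \<xi> = 0"
  using bb_coeff_le[OF V _ assms(3), of c 0] assms(2) by auto

text \<open>A lattice point lies on a face exactly when its weights off the face vanish. In degree 0
  the single point is \<open>v\<close>, whence the condition \<open>v \<in> F\<close>.\<close>

lemma pie_points_face:
  assumes V: "independent_verts V" and F: "F \<subseteq> V" and v: "v \<in> F"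
  shows "pie_points v F k = pie_points v V k \<inter> convex hull F"
proof (cases "k = 0")
  case True
  then show ?thesis using v by (auto simp: pie_points_def hull_inc)
next
  case False
  then have k: "1 \<le> k" by simp
  have fin: "finite V" "finite F" using V F by (auto simp: independent_verts_def intro: finite_subset)
  have F': "independent_verts F" using independent_verts_subset[OF V F] v by blast
  have lp: "lattice_point F k \<alpha> = lattice_point V k \<alpha>" "\<alpha> \<in> multi_indices V k" if "\<alpha> \<in> multi_indices F k" for \<alpha>
  proof -
    have z: "\<alpha> u = 0" if "u \<in> V - F" for u using \<open>\<alpha> \<in> multi_indices F k\<close> that by (auto simp: multi_indices_def)
    have "(\<Sum>u\<in>F. real (\<alpha> u) *\<^sub>R u) = (\<Sum>u\<in>V. real (\<alpha> u) *\<^sub>R u)" "(\<Sum>u\<in>F. \<alpha> u) = (\<Sum>u\<in>V. \<alpha> u)"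
      using z fin F by (intro sum.mono_neutral_left; auto)+
    then show "lattice_point F k \<alpha> = lattice_point V k \<alpha>" "\<alpha> \<in> multi_indices V k"
      using that F by (auto simp: lattice_point_def multi_indices_def)
  qed
  show ?thesis
  proof (intro equalityI subsetI IntI)
    fix \<xi> assume "\<xi> \<in> pie_points v F k"
    then show "\<xi> \<in> pie_points v V k" using lp k fin
      by (auto simp: pie_points_pos domain_points_eq)
  next
    fix \<xi> assume "\<xi> \<in> pie_points v F k"
    then show "\<xi> \<in> convex hull F" using pie_points_in_convex_hull[OF F' v] by blast
  next
    fix \<xi> assume x: "\<xi> \<in> pie_points v V k \<inter> convex hull F"
    then obtain \<alpha> where a: "\<alpha> \<in> multi_indices V k" "\<xi> = lattice_point V k \<alpha>"
      using k fin by (auto simp: pie_points_pos domain_points_eq)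
    have "\<xi> \<in> convex hull V" using x hull_mono[OF F] by blast
    then have "\<forall>u\<in>V - F. bary V u \<xi> = 0" using x in_convex_hull_face[OF V F] v by auto
    then have z: "\<alpha> u = 0" if "u \<in> V - F" for u
      using that a bary_lattice_point[OF V k a(1)] k by auto
    have "(\<Sum>u\<in>F. real (\<alpha> u) *\<^sub>R u) = (\<Sum>u\<in>V. real (\<alpha> u) *\<^sub>R u)" "(\<Sum>u\<in>F. \<alpha> u) = (\<Sum>u\<in>V. \<alpha> u)"
      using z fin F by (intro sum.mono_neutral_left; auto)+
    then have "\<xi> = lattice_point F k \<alpha>" "\<alpha> \<in> multi_indices F k"
      using a z by (auto simp: lattice_point_def multi_indices_def)
    then show "\<xi> \<in> pie_points v F k" using k fin by (auto simp: pie_points_pos domain_points_eq)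
  qed
qed

lemma convex_hull_imp_affine_hull: "x \<in> convex hull S \<Longrightarrow> x \<in> affine hull S"
  using convex_hull_subset_affine_hull by blast

text \<open>The Bernstein polynomial of a point off the face contains a coordinate that vanishes on
  the face; the others restrict to those of the face.\<close>

lemma bb_sum_face:
  assumes V: "independent_verts V" and F: "F \<subseteq> V" and v: "v \<in> F" and x: "x \<in> convex hull F"
  shows "bb_sum v V k c x = bb_sum v F k c x"
proof -
  have fin: "finite V" "finite F" using V F by (auto simp: independent_verts_def intro: finite_subset)
  have F': "independent_verts F" using independent_verts_subset[OF V F] v by blast
  note pf = pie_points_face[OF V F v, of k]
  have bx: "bary V u x = bary F u x" for u
    by (rule bary_face[OF V F convex_hull_imp_affine_hull[OF x]])
  have b0: "bary V u x = 0" if "u \<in> V - F" for u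
    unfolding bx using that bary_outside[OF F' convex_hull_imp_affine_hull[OF x]] by auto
  have out: "bernstein_at V k \<xi> x = 0" if "\<xi> \<in> pie_points v V k - pie_points v F k" for \<xi>
  proof -
    have k: "1 \<le> k" using that by (auto simp: pie_points_def split: if_splits)
    have "\<xi> \<in> convex hull V" using that pie_points_in_convex_hull[OF V] F v by blast
    then have "\<exists>u\<in>V - F. bary V u \<xi> \<noteq> 0" using that in_convex_hull_face[OF V F, of \<xi>] v pf by auto
    then obtain u where u': "u \<in> V - F" "bary V u \<xi> \<noteq> 0" by blast
    then have u: "u \<in> V - F" "index_of V k \<xi> u \<noteq> 0"
      using bary_pie_points[OF V k, of \<xi> v u] that by auto
    then have "bary V u x ^ index_of V k \<xi> u = 0" using b0 by simp
    then have "(\<Prod>u\<in>V. bary V u x ^ index_of V k \<xi> u) = 0"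
      using u fin by (meson DiffD1 prod_zero)
    then show ?thesis by (simp add: bernstein_at_eq bernstein_eq)
  qed
  have ins: "bernstein_at V k \<xi> x = bernstein_at F k \<xi> x" if "\<xi> \<in> pie_points v F k" for \<xi>
  proof -
    have h: "\<xi> \<in> convex hull F" using that pf by blast
    have i: "index_of V k \<xi> = index_of F k \<xi>"
      using bary_face[OF V F convex_hull_imp_affine_hull[OF h]] by (simp add: index_of_def)
    have z: "index_of F k \<xi> u = 0" if "u \<in> V - F" for u
      using that bary_outside[OF F' convex_hull_imp_affine_hull[OF h]] by (simp add: index_of_def)
    have "(\<Prod>u\<in>F. fact (index_of F k \<xi> u)) = (\<Prod>u\<in>V. fact (index_of F k \<xi> u) :: real)"
      "(\<Prod>u\<in>F. bary F u x ^ index_of F k \<xi> u) = (\<Prod>u\<in>V. bary F u x ^ index_of F k \<xi> u)"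
      using z fin F by (intro prod.mono_neutral_left; auto)+
    then show ?thesis by (simp add: bernstein_at_def bernstein_def i[unfolded index_of_def] index_of_def bx)
  qed
  have "bb_sum v V k c x = (\<Sum>\<xi>\<in>pie_points v F k. c \<xi> * bernstein_at V k \<xi> x)"
    unfolding bb_sum_def using out finite_pie_points[OF V] pf
    by (intro sum.mono_neutral_right) auto
  then show ?thesis unfolding bb_sum_def using ins by (simp cong: sum.cong)
qed

lemma bb_sum_eq_on_face:
  assumes V: "independent_verts V" and V': "independent_verts V'" and F: "F \<subseteq> V" "F \<subseteq> V'" and v: "v \<in> F"
    and c: "\<And>\<xi>. \<xi> \<in> pie_points v F k \<Longrightarrow> c \<xi> = c' \<xi>" and x: "x \<in> convex hull F"
  shows "bb_sum v V k c x = bb_sum v V' k c' x"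
  unfolding bb_sum_face[OF V F(1) v x] bb_sum_face[OF V' F(2) v x]
  by (rule bb_sum_cong) (rule c)

text \<open>Equality is asked only where all coordinates of the face are positive: along an edge of
  a pie the weight vanishes at the boundary vertex and cannot be cancelled there.\<close>

lemma bb_coeff_eq_on_face:
  assumes V: "independent_verts V" and V': "independent_verts V'" and F: "F \<subseteq> V" "F \<subseteq> V'" and v: "v \<in> F"
    and eq: "\<And>x. x \<in> convex hull F \<Longrightarrow> (\<forall>u\<in>F. 0 < bary F u x) \<Longrightarrow> bb_sum v V k c x = bb_sum v V' k c' x"
    and x: "\<xi> \<in> pie_points v V k" "\<xi> \<in> convex hull F"
  shows "c \<xi> = c' \<xi>"
proof -
  have F': "independent_verts F" using independent_verts_subset[OF V F(1)] v by blast
  have xF: "\<xi> \<in> pie_points v F k" using pie_points_face[OF V F(1) v] x by blast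
  have "(\<lambda>\<xi>. c \<xi> - c' \<xi>) \<xi> = 0"
  proof (rule bb_coeff_zero[OF F' _ xF])
    fix x assume x: "x \<in> convex hull F" "\<forall>u\<in>F. 0 < bary F u x"
    show "bb_sum v F k (\<lambda>\<xi>. c \<xi> - c' \<xi>) x = 0"
      using eq[OF x] unfolding bb_sum_face[OF V F(1) v x(1)] bb_sum_face[OF V' F(2) v x(1)]
      by (simp add: bb_sum_diff)
  qed
  then show ?thesis by simp
qed

lemma bb_sum_vertex:
  assumes V: "independent_verts V" and v: "v \<in> V"
  shows "bb_sum v V k c v = c v"
proof -
  have F: "independent_verts {v}" by (simp add: independent_verts_def)
  have p: "pie_points v {v} k = {v}"
    using pie_points_face[OF V, of "{v}" v k] v vertex_in_pie_points[OF V v, of k] by auto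
  have b: "bary {v} v v = 1" using bary_vertex[OF F, of v v] by simp
  have "bb_sum v V k c v = bb_sum v {v} k c v" using bb_sum_face[OF V, of "{v}" v v] v by simp
  also have "\<dots> = c v" by (simp add: bb_sum_def p bernstein_at_def bernstein_def b)
  finally show ?thesis .
qed

lemma bb_sum_poly2:
  assumes V: "independent_verts V" and c: "card V = 3"
  shows "bb_sum v V k c \<in> poly2 k"
proof -
  have fin: "finite V" using V by (auto simp: independent_verts_def)
  have pr: "(\<lambda>x. \<Prod>u\<in>U. bary V u x ^ \<alpha> u) \<in> poly2 (\<Sum>u\<in>U. \<alpha> u)" if "finite U" for \<alpha> U
    using that
  proof (induction U rule: finite_induct)
    case empty show ?case by (simp add: poly2_const)
  next
    case (insert u U)
    then show ?case using poly2_mult[OF poly2_power[OF bary_poly2[OF V c], of u "\<alpha> u"] insert.IH] by simp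
  qed
  have "bernstein V k \<alpha> \<in> poly2 k" if "\<alpha> \<in> multi_indices V k" for \<alpha>
    using poly2_scale[OF pr[OF fin, of \<alpha>], of "multinomial_coeff V k \<alpha>"] that
    by (simp add: bernstein_eq[abs_def] multi_indices_def)
  then have "(\<lambda>x. \<Sum>\<alpha>\<in>multi_indices V k. c (inv_into (pie_points v V k) (index_of V k) \<alpha>) * bernstein V k \<alpha> x) \<in> poly2 k" for c
    by (intro poly2_sum poly2_scale)
  then show ?thesis by (simp add: bb_sum_eq[OF V, abs_def])
qed

text \<open>Homogenisation: 1, \<open>Re\<close> and \<open>Im\<close> are linear forms in the
  barycentric coordinates, and a monomial of lower degree is raised to degree exactly
  \<open>k\<close> by factors 1, written as the sum of the coordinates.\<close>

lemma poly2_bb_sum: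
  assumes V: "independent_verts V" and c: "card V = 3" and f: "f \<in> poly2 k"
  shows "\<exists>c. \<forall>x. f x = bb_sum v V k c x"
proof -
  have fin: "finite V" using V by (auto simp: independent_verts_def)
  define H where "H k = {f. \<exists>a. \<forall>x. f x = (\<Sum>\<alpha>\<in>multi_indices V k. a \<alpha> * (\<Prod>u\<in>V. bary V u x ^ \<alpha> u))}" for k
  have H_add: "(\<lambda>x. f x + g x) \<in> H k" if "f \<in> H k" "g \<in> H k" for f g k
  proof -
    obtain a b where "\<forall>x. f x = (\<Sum>\<alpha>\<in>multi_indices V k. a \<alpha> * (\<Prod>u\<in>V. bary V u x ^ \<alpha> u))"
      "\<forall>x. g x = (\<Sum>\<alpha>\<in>multi_indices V k. b \<alpha> * (\<Prod>u\<in>V. bary V u x ^ \<alpha> u))"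
      using \<open>f \<in> H k\<close> \<open>g \<in> H k\<close> by (auto simp: H_def)
    then show ?thesis unfolding H_def
      by (intro CollectI exI[of _ "\<lambda>\<alpha>. a \<alpha> + b \<alpha>"]) (simp add: sum.distrib distrib_right)
  qed
  have H_scale: "(\<lambda>x. r * f x) \<in> H k" if "f \<in> H k" for f r k
  proof -
    obtain a where "\<forall>x. f x = (\<Sum>\<alpha>\<in>multi_indices V k. a \<alpha> * (\<Prod>u\<in>V. bary V u x ^ \<alpha> u))"
      using \<open>f \<in> H k\<close> by (auto simp: H_def)
    then show ?thesis unfolding H_def
      by (intro CollectI exI[of _ "\<lambda>\<alpha>. r * a \<alpha>"]) (simp add: sum_distrib_left mult.assoc)
  qed
  have H_mono: "(\<lambda>x. \<Prod>u\<in>V. bary V u x ^ \<alpha> u) \<in> H k" if "\<alpha> \<in> multi_indices V k" for \<alpha> k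
    unfolding H_def using that finite_multi_indices[OF fin, of k]
    by (intro CollectI exI[of _ "\<lambda>\<beta>. if \<beta> = \<alpha> then 1 else 0"])
       (simp add: if_distrib[of "\<lambda>z. z * _"] cong: if_cong)
  have H_zero: "(\<lambda>x. 0) \<in> H k" for k
    unfolding H_def by (intro CollectI exI[of _ "\<lambda>\<beta>. 0"]) simp
  have H_sum: "(\<lambda>x. \<Sum>i\<in>I. f i x) \<in> H k" if "\<And>i. i \<in> I \<Longrightarrow> f i \<in> H k" for f k and I :: "'i set"
    using that by (induction I rule: infinite_finite_induct) (auto intro: H_add H_zero)
  have H_bary: "(\<lambda>x. bary V u x * f x) \<in> H (Suc k)" if "f \<in> H k" "u \<in> V" for f u k
  proof -
    obtain a where a: "\<forall>x. f x = (\<Sum>\<alpha>\<in>multi_indices V k. a \<alpha> * (\<Prod>u\<in>V. bary V u x ^ \<alpha> u))"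
      using \<open>f \<in> H k\<close> by (auto simp: H_def)
    have "bary V u x * f x = (\<Sum>\<alpha>\<in>multi_indices V k. a \<alpha> * (\<Prod>w\<in>V. bary V w x ^ (\<alpha>(u := Suc (\<alpha> u))) w))" for x
    proof -
      have "bary V u x * (\<Prod>w\<in>V. bary V w x ^ \<alpha> w) = (\<Prod>w\<in>V. bary V w x ^ (\<alpha>(u := Suc (\<alpha> u))) w)" for \<alpha>
        using fin \<open>u \<in> V\<close> by (simp add: prod.remove[of V u])
      then show ?thesis by (simp add: a sum_distrib_left mult.left_commute del: fun_upd_apply)
    qed
    moreover have "\<alpha>(u := Suc (\<alpha> u)) \<in> multi_indices V (Suc k)" if "\<alpha> \<in> multi_indices V k" for \<alpha>
      using that \<open>u \<in> V\<close> fin by (auto simp: multi_indices_def sum.remove[of V u])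
    ultimately show ?thesis by (simp only:) (intro H_sum H_scale H_mono)
  qed
  have H_lin: "(\<lambda>x. (\<Sum>u\<in>V. r u * bary V u x) * f x) \<in> H (Suc k)" if "f \<in> H k" for f r k
    unfolding sum_distrib_right mult.assoc using that by (intro H_sum H_scale H_bary)
  note h = affine_hull_triangle[OF V c]
  note p = bary_props[OF V, unfolded h, OF UNIV_I]
  have re: "Re x = (\<Sum>u\<in>V. Re u * bary V u x)" and im: "Im x = (\<Sum>u\<in>V. Im u * bary V u x)"
    and one: "1 = (\<Sum>u\<in>V. 1 * bary V u x)" for x
    using arg_cong[OF p(3)[of x], of Re] arg_cong[OF p(3)[of x], of Im] p(2)[of x] by (simp_all add: mult.commute)
  have one': "(\<lambda>x. 1) \<in> H k" for k
  proof (induction k)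
    case 0
    then show ?case unfolding H_def by (intro CollectI exI[of _ "\<lambda>_. 1"]) (simp add: multi_indices_0[OF fin])
  next
    case (Suc k)
    from H_lin[OF this, of "\<lambda>_. 1"] show ?case using p(2) by simp
  qed
  have im': "(\<lambda>x. Im x ^ j) \<in> H (j + l)" for j l
  proof (induction j)
    case (Suc j)
    from H_lin[OF this, of Im] show ?case by (simp flip: im)
  qed (simp add: one')
  have H_monomial: "(\<lambda>x. Re x ^ i * Im x ^ j) \<in> H (i + (j + l))" for i j l
  proof (induction i)
    case (Suc i)
    from H_lin[OF this, of Re] show ?case by (simp add: mult.assoc flip: re)
  qed (simp add: im')
  have "f \<in> H k" using f
  proof (induction f rule: poly2_induct)
    case (mono i j)
    then show ?case using H_monomial[of i j "k - (i + j)"] by simp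
  qed (auto intro: H_add H_scale)
  then obtain a where a: "\<forall>x. f x = (\<Sum>\<alpha>\<in>multi_indices V k. a \<alpha> * (\<Prod>u\<in>V. bary V u x ^ \<alpha> u))"
    by (auto simp: H_def)
  \<comment> \<open>Passing from monomials to Bernstein polynomials divides by the multinomial
    coefficient, which is nonzero.\<close>
  define d where "d \<xi> = a (index_of V k \<xi>) / multinomial_coeff V k (index_of V k \<xi>)" for \<xi>
  have "f x = bb_sum v V k d x" for x
  proof -
    have "multinomial_coeff V k \<alpha> \<noteq> 0" if "\<alpha> \<in> multi_indices V k" for \<alpha>
      using fin by (simp add: multinomial_coeff_def)
    then show ?thesis
      unfolding a[rule_format] bb_sum_eq[OF V]
      by (intro sum.cong[OF refl])
         (simp add: d_def bernstein_eq bij_betw_inv_into_right[OF bij_betw_index_of[OF V]])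
  qed
  then show ?thesis by blast
qed

subsection \<open>Divisibility by an irreducible conic\<close>

text \<open>Constants belong to \<open>poly2 1\<close>, so the condition also rules out polynomials
  of degree at most one.\<close>

definition irreducible_conic :: "(complex \<Rightarrow> real) \<Rightarrow> bool" where
  "irreducible_conic p \<longleftrightarrow> p \<in> poly2 2 \<and> (\<forall>l\<in>poly2 1. \<forall>m\<in>poly2 1. p \<noteq> (\<lambda>x. l x * m x))"

lemma irreducible_conicD:
  "irreducible_conic p \<Longrightarrow> l \<in> poly2 1 \<Longrightarrow> m \<in> poly2 1 \<Longrightarrow> p = (\<lambda>x. l x * m x) \<Longrightarrow> False"
  by (auto simp: irreducible_conic_def)

text \<open>Unique factorisation of real polynomials: \<open>\<alpha>\<close> divides
  \<open>w\<close>, and the quotient is the square root.\<close>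

lemma square_root_poly:
  fixes \<Delta> \<alpha> w :: "real poly"
  assumes "w ^ 2 = \<Delta> * \<alpha> ^ 2" "\<alpha> \<noteq> 0" "degree \<Delta> \<le> 2"
  shows "\<exists>r. degree r \<le> 1 \<and> \<Delta> = r ^ 2"
proof -
  have "\<alpha> ^ 2 dvd w ^ 2" using assms by simp
  then have "\<alpha> dvd w" using pow_divides_pow_iff[of 2 \<alpha> w] by (metis zero_less_numeral)
  then obtain r where r: "w = \<alpha> * r" by (elim dvdE)
  then have "\<Delta> * \<alpha> ^ 2 = r ^ 2 * \<alpha> ^ 2" using assms by (simp add: power_mult_distrib mult.commute)
  then have "\<Delta> = r ^ 2" using assms(2) by simp
  moreover have "degree r \<le> 1" using assms(3) unfolding \<open>\<Delta> = r ^ 2\<close> power2_eq_square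
    by (cases "r = 0") (auto simp: degree_mult_eq)
  ultimately show ?thesis by blast
qed

lemma degree_quadratic_le: "degree [:a, b, c:] \<le> 2"
  by (simp add: degree_pCons_le[THEN order_trans])

text \<open>Division in the variable \<open>Im\<close>, in which \<open>p\<close> is monic. As
  \<open>p\<close> has total degree 2, replacing the square of \<open>Im\<close> never raises the
  total degree, which bounds the quotient. The degree of the remainder in \<open>Re\<close> is left
  open, as the remainder will turn out to be zero.\<close>

lemma monic_conic_division:
  assumes p: "\<And>x. p x = (Im x)\<^sup>2 + (b0 + b1 * Re x) * Im x + (c0 + c1 * Re x + c2 * (Re x)\<^sup>2)"
    and f: "f \<in> poly2 m"
  shows "\<exists>g\<in>poly2 (m - 2). \<exists>(\<alpha> :: real poly) (\<beta> :: real poly).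
    \<forall>x. f x = p x * g x + poly \<alpha> (Re x) * Im x + poly \<beta> (Re x)"
proof -
  define P where "P m f \<longleftrightarrow> (\<exists>g\<in>poly2 (m - 2). \<exists>(\<alpha> :: real poly) (\<beta> :: real poly).
    \<forall>x. f x = p x * g x + poly \<alpha> (Re x) * Im x + poly \<beta> (Re x))" for m f
  have add: "P m (\<lambda>x. f x + g x)" if fg: "P m f" "P m g" for f g m
  proof -
    obtain h \<alpha> \<beta> h' \<alpha>' \<beta>' where
      "h \<in> poly2 (m - 2)" "\<forall>x. f x = p x * h x + poly \<alpha> (Re x) * Im x + poly \<beta> (Re x)"
      "h' \<in> poly2 (m - 2)" "\<forall>x. g x = p x * h' x + poly \<alpha>' (Re x) * Im x + poly \<beta>' (Re x)"
      using fg unfolding P_def by blast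
    then show ?thesis unfolding P_def
      by (intro bexI[of _ "\<lambda>x. h x + h' x"] exI[of _ "\<alpha> + \<alpha>'"] exI[of _ "\<beta> + \<beta>'"])
         (auto simp: algebra_simps intro: poly2_add)
  qed
  have scale: "P m (\<lambda>x. c * f x)" if pf: "P m f" for f c m
  proof -
    obtain h \<alpha> \<beta> where
      "h \<in> poly2 (m - 2)" "\<forall>x. f x = p x * h x + poly \<alpha> (Re x) * Im x + poly \<beta> (Re x)"
      using pf unfolding P_def by blast
    then show ?thesis unfolding P_def
      by (intro bexI[of _ "\<lambda>x. c * h x"] exI[of _ "smult c \<alpha>"] exI[of _ "smult c \<beta>"])
         (auto simp: algebra_simps intro: poly2_scale)
  qed
  have mono: "P m (\<lambda>x. Re x ^ i * Im x ^ j)" if "i + j \<le> m" for i j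
    using that
  proof (induction j arbitrary: i rule: less_induct)
    case (less j)
    consider "j = 0" | "j = 1" | l where "j = Suc (Suc l)"
      by (cases j; cases "j - 1") auto
    then show ?case
    proof cases
      case 1
      then show ?thesis unfolding P_def
        by (intro bexI[of _ "\<lambda>_. 0"] exI[of _ 0] exI[of _ "monom 1 i"]) (auto simp: poly_monom poly2_const)
    next
      case 2
      then show ?thesis unfolding P_def
        by (intro bexI[of _ "\<lambda>_. 0"] exI[of _ "monom 1 i"] exI[of _ 0]) (auto simp: poly_monom poly2_const)
    next
      case 3
      have 1: "P m (\<lambda>x. p x * (Re x ^ i * Im x ^ l))" unfolding P_def
        using less.prems 3
        by (intro bexI[of _ "\<lambda>x. Re x ^ i * Im x ^ l"] exI[of _ 0]) (auto intro: poly2_monomial)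
      have 2: "P m (\<lambda>x. Re x ^ i * Im x ^ Suc l)" "P m (\<lambda>x. Re x ^ Suc i * Im x ^ Suc l)"
        "P m (\<lambda>x. Re x ^ i * Im x ^ l)" "P m (\<lambda>x. Re x ^ Suc i * Im x ^ l)" "P m (\<lambda>x. Re x ^ Suc (Suc i) * Im x ^ l)"
        using less.prems 3 by (intro less.IH; simp)+
      \<comment> \<open>Solve \<open>p\<close> for the square of \<open>Im\<close>: the remaining
        terms have smaller powers of \<open>Im\<close> and are covered by the induction.\<close>
      have "P m (\<lambda>x. p x * (Re x ^ i * Im x ^ l) + ((- b0) * (Re x ^ i * Im x ^ Suc l) +
          ((- b1) * (Re x ^ Suc i * Im x ^ Suc l) + ((- c0) * (Re x ^ i * Im x ^ l) +
          ((- c1) * (Re x ^ Suc i * Im x ^ l) + (- c2) * (Re x ^ Suc (Suc i) * Im x ^ l))))))"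
        by (intro add scale 1 2)
      also have "(\<lambda>x. p x * (Re x ^ i * Im x ^ l) + ((- b0) * (Re x ^ i * Im x ^ Suc l) +
          ((- b1) * (Re x ^ Suc i * Im x ^ Suc l) + ((- c0) * (Re x ^ i * Im x ^ l) +
          ((- c1) * (Re x ^ Suc i * Im x ^ l) + (- c2) * (Re x ^ Suc (Suc i) * Im x ^ l))))))
          = (\<lambda>x. Re x ^ i * Im x ^ j)"
        by (rule ext) (simp add: p 3 power2_eq_square algebra_simps)
      finally show ?thesis .
    qed
  qed
  have "P m f" using f by (induction f rule: poly2_induct) (auto intro: mono add scale)
  then show ?thesis unfolding P_def .
qed

text \<open>Eliminating \<open>Im\<close> between \<open>p\<close> and the remainder gives a
  polynomial in \<open>Re\<close> with infinitely many zeros. If the remainder really contained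
  \<open>Im\<close>, the discriminant of \<open>p\<close> would be a square and \<open>p\<close>
  would split into linear factors.\<close>

lemma monic_conic_dvd:
  assumes p: "\<And>x. p x = (Im x)\<^sup>2 + (b0 + b1 * Re x) * Im x + (c0 + c1 * Re x + c2 * (Re x)\<^sup>2)"
    and irr: "irreducible_conic p" and f: "f \<in> poly2 m"
    and Z: "infinite Z" "\<And>x. x \<in> Z \<Longrightarrow> p x = 0" "\<And>x. x \<in> Z \<Longrightarrow> f x = 0"
  shows "\<exists>g\<in>poly2 (m - 2). \<forall>x. f x = p x * g x"
proof -
  obtain g and \<alpha> \<beta> :: "real poly" where g: "g \<in> poly2 (m - 2)"
    and fx: "\<And>x. f x = p x * g x + poly \<alpha> (Re x) * Im x + poly \<beta> (Re x)"
    using monic_conic_division[OF p f] by blast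
  define b c where "b = [:b0, b1:]" and "c = [:c0, c1, c2:]"
  have px: "p x = (Im x)\<^sup>2 + poly b (Re x) * Im x + poly c (Re x)" for x
    by (simp add: p b_def c_def power2_eq_square algebra_simps)
  \<comment> \<open>A vertical line meets the zero set of \<open>p\<close> in finitely many points,
    because \<open>p\<close> is monic in \<open>Im\<close>.\<close>
  have infR: "infinite (Re ` Z)"
  proof
    assume fin: "finite (Re ` Z)"
    have "finite {x. Re x = r \<and> p x = 0}" for r
    proof -
      have "finite {y. poly [:poly c r, poly b r, 1:] y = 0}" by (rule poly_roots_finite) simp
      then have "finite ((\<lambda>y. Complex r y) ` {y. poly [:poly c r, poly b r, 1:] y = 0})" by simp
      moreover have "{x. Re x = r \<and> p x = 0} \<subseteq> (\<lambda>y. Complex r y) ` {y. poly [:poly c r, poly b r, 1:] y = 0}"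
      proof
        fix x assume "x \<in> {x. Re x = r \<and> p x = 0}"
        then show "x \<in> (\<lambda>y. Complex r y) ` {y. poly [:poly c r, poly b r, 1:] y = 0}"
          by (intro image_eqI[of _ _ "Im x"]) (auto simp: px power2_eq_square algebra_simps)
      qed
      ultimately show ?thesis by (rule finite_subset[rotated])
    qed
    then have "finite (\<Union>r\<in>Re ` Z. {x. Re x = r \<and> p x = 0})" using fin by blast
    moreover have "Z \<subseteq> (\<Union>r\<in>Re ` Z. {x. Re x = r \<and> p x = 0})" using Z(2) by auto
    ultimately show False using Z(1) finite_subset by blast
  qed
  have zero: "P = 0" if "\<And>x. x \<in> Z \<Longrightarrow> poly P (Re x) = 0" for P :: "real poly"
  proof (rule ccontr)
    assume "P \<noteq> 0"
    then have "finite {r. poly P r = 0}" by (rule poly_roots_finite)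
    moreover have "Re ` Z \<subseteq> {r. poly P r = 0}" using that by auto
    ultimately show False using infR finite_subset by blast
  qed
  have lin: "poly \<alpha> (Re x) * Im x + poly \<beta> (Re x) = 0" if "x \<in> Z" for x
    using fx[of x] Z(2,3)[OF that] by simp
  \<comment> \<open>The resultant of \<open>p\<close> and the linear remainder with respect to
    \<open>Im\<close>.\<close>
  have "\<beta> ^ 2 - b * \<alpha> * \<beta> + c * \<alpha> ^ 2 = 0"
  proof (rule zero)
    fix x assume x: "x \<in> Z"
    have "poly \<beta> (Re x) = - poly \<alpha> (Re x) * Im x" using lin[OF x] by simp
    then have "poly (\<beta> ^ 2 - b * \<alpha> * \<beta> + c * \<alpha> ^ 2) (Re x) = poly \<alpha> (Re x) ^ 2 * p x"
      by (simp add: px power2_eq_square algebra_simps)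
    then show "poly (\<beta> ^ 2 - b * \<alpha> * \<beta> + c * \<alpha> ^ 2) (Re x) = 0" using Z(2)[OF x] by simp
  qed
  \<comment> \<open>Completing the square turns the vanishing resultant into a square identity for
    the discriminant.\<close>
  moreover have "(2 * \<beta> - b * \<alpha>) ^ 2 = 4 * (\<beta> ^ 2 - b * \<alpha> * \<beta> + c * \<alpha> ^ 2) + (b ^ 2 - 4 * c) * \<alpha> ^ 2"
    by (simp add: power2_eq_square algebra_simps)
  ultimately have sq: "(2 * \<beta> - b * \<alpha>) ^ 2 = (b ^ 2 - 4 * c) * \<alpha> ^ 2" by simp
  have "\<alpha> = 0"
  proof (rule ccontr)
    assume a: "\<alpha> \<noteq> 0"
    have "b ^ 2 - 4 * c = [:b0 ^ 2 - 4 * c0, 2 * b0 * b1 - 4 * c1, b1 ^ 2 - 4 * c2:]"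
      by (simp add: b_def c_def power2_eq_square numeral_poly algebra_simps)
    then have "degree (b ^ 2 - 4 * c) \<le> 2" using degree_quadratic_le by metis
    then obtain r where r: "degree r \<le> 1" "b ^ 2 - 4 * c = r ^ 2"
      using square_root_poly[OF sq a] by blast
    have r': "r = [:coeff r 0, coeff r 1:]"
      using r(1) by (auto simp: poly_eq_iff coeff_pCons coeff_eq_0 split: nat.splits)
    define r0 r1 where "r0 = coeff r 0" and "r1 = coeff r 1"
    have rx: "poly r t = r0 + r1 * t" for t by (subst r') (simp add: r0_def r1_def)
    \<comment> \<open>The quadratic formula, with \<open>r\<close> as square root of the
      discriminant.\<close>
    have "p = (\<lambda>x. ((b0 - r0) / 2 + ((b1 - r1) / 2) * Re x + 1 * Im x) *
        ((b0 + r0) / 2 + ((b1 + r1) / 2) * Re x + 1 * Im x))"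
    proof
      fix x
      have "poly (b ^ 2 - 4 * c) (Re x) = poly (r ^ 2) (Re x)" using r(2) by simp
      then have "4 * poly c (Re x) = (poly b (Re x))\<^sup>2 - (r0 + r1 * Re x)\<^sup>2" by (simp add: rx)
      moreover define u w where "u = b0 + b1 * Re x" and "w = r0 + r1 * Re x"
      ultimately have c4: "4 * poly c (Re x) = u\<^sup>2 - w\<^sup>2" by (simp add: b_def mult.commute)
      have "4 * p x = 4 * (Im x)\<^sup>2 + 4 * u * Im x + 4 * poly c (Re x)"
        by (simp add: px b_def u_def algebra_simps)
      also have "\<dots> = (u - w + 2 * Im x) * (u + w + 2 * Im x)"
        unfolding c4 by (simp add: power2_eq_square algebra_simps)
      finally have "4 * p x = (u - w + 2 * Im x) * (u + w + 2 * Im x)" .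
      moreover have "P = X / 2 * (Y / 2)" if "4 * P = X * Y" for P X Y :: real
        using that by (simp add: field_simps)
      ultimately have "p x = ((u - w + 2 * Im x) / 2) * ((u + w + 2 * Im x) / 2)" by blast
      moreover have "(u - w + 2 * Im x) / 2 = (b0 - r0) / 2 + ((b1 - r1) / 2) * Re x + 1 * Im x"
        "(u + w + 2 * Im x) / 2 = (b0 + r0) / 2 + ((b1 + r1) / 2) * Re x + 1 * Im x"
        by (simp_all add: u_def w_def field_simps)
      ultimately show "p x = ((b0 - r0) / 2 + ((b1 - r1) / 2) * Re x + 1 * Im x) *
        ((b0 + r0) / 2 + ((b1 + r1) / 2) * Re x + 1 * Im x)" by simp
    qed
    then show False by (rule irreducible_conicD[OF irr poly2_linear poly2_linear])
  qed
  moreover have "\<beta> = 0"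
    by (rule zero) (use lin \<open>\<alpha> = 0\<close> in auto)
  ultimately have "f x = p x * g x" for x by (subst fx) simp
  then show ?thesis using g by blast
qed

text \<open>A linear change of coordinates makes the coefficient of the square of \<open>Im\<close>
  nonzero; divisibility, degrees and irreducibility are invariant under it. Without a quadratic part
  \<open>p\<close> would be 1 times a linear polynomial.\<close>

lemma conic_dvd:
  assumes irr: "irreducible_conic p" and f: "f \<in> poly2 m"
    and Z: "infinite Z" "\<And>x. x \<in> Z \<Longrightarrow> p x = 0" "\<And>x. x \<in> Z \<Longrightarrow> f x = 0"
  shows "\<exists>g\<in>poly2 (m - 2). \<forall>x. f x = p x * g x"
proof -
  have subst: "\<exists>g\<in>poly2 (m - 2). \<forall>x. f x = p x * g x"
    if \<phi>: "(\<lambda>x. Re (\<phi> x)) \<in> poly2 1" "(\<lambda>x. Im (\<phi> x)) \<in> poly2 1"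
      and \<psi>: "(\<lambda>x. Re (\<psi> x)) \<in> poly2 1" "(\<lambda>x. Im (\<psi> x)) \<in> poly2 1"
      and inv: "\<And>x. \<phi> (\<psi> x) = x" "\<And>x. \<psi> (\<phi> x) = x" and h: "h \<noteq> 0"
      and p\<phi>: "\<And>x. p (\<phi> x) = a + b * Re x + c * Im x + d * (Re x)\<^sup>2 + e * Re x * Im x + h * (Im x)\<^sup>2"
    for \<phi> \<psi> a b c d e h
  proof -
    have cancel: "1 / h * P = Q" if "h * Q = P" for P Q :: real using that h by auto
    have "\<exists>r'. r = h * r'" for r using h by (intro exI[of _ "r / h"]) simp
    then obtain a' b' c' d' e' where coeffs: "a = h * a'" "b = h * b'" "c = h * c'" "d = h * d'" "e = h * e'"
      by metis
    have "\<exists>g\<in>poly2 (m - 2). \<forall>x. h * f (\<phi> x) = (1 / h * p (\<phi> x)) * g x"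
    proof (rule monic_conic_dvd[where Z = "\<psi> ` Z" and p = "\<lambda>x. 1 / h * p (\<phi> x)" and f = "\<lambda>x. h * f (\<phi> x)"])
      fix x
      have "h * ((Im x)\<^sup>2 + (c' + e' * Re x) * Im x + (a' + b' * Re x + d' * (Re x)\<^sup>2)) = p (\<phi> x)"
        unfolding p\<phi> coeffs by (simp only: distrib_left distrib_right ac_simps)
      then show "1 / h * p (\<phi> x) = (Im x)\<^sup>2 + (c' + e' * Re x) * Im x + (a' + b' * Re x + d' * (Re x)\<^sup>2)"
        by (rule cancel)
    next
      show "irreducible_conic (\<lambda>x. 1 / h * p (\<phi> x))"
        unfolding irreducible_conic_def
      proof (intro conjI ballI notI)
        show "(\<lambda>x. 1 / h * p (\<phi> x)) \<in> poly2 2"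
          by (rule poly2_scale[OF poly2_comp[OF _ \<phi>]]) (use irr in \<open>simp add: irreducible_conic_def\<close>)
        fix l k assume lk: "l \<in> poly2 1" "k \<in> poly2 1" "(\<lambda>x. 1 / h * p (\<phi> x)) = (\<lambda>x. l x * k x)"
        have pe: "p = (\<lambda>x. (h * l (\<psi> x)) * k (\<psi> x))"
        proof
          fix x show "p x = (h * l (\<psi> x)) * k (\<psi> x)"
            using fun_cong[OF lk(3), of "\<psi> x"] h unfolding inv by (simp add: divide_eq_eq)
        qed
        show False
          by (rule irreducible_conicD[OF irr poly2_scale[OF poly2_comp[OF lk(1) \<psi>]] poly2_comp[OF lk(2) \<psi>] pe])
      qed
      show "(\<lambda>x. h * f (\<phi> x)) \<in> poly2 m" by (rule poly2_scale[OF poly2_comp[OF f \<phi>]])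
      show "infinite (\<psi> ` Z)" using Z(1) inj_on_inverseI[of Z \<phi> \<psi>] inv by (simp add: finite_image_iff)
    qed (use Z inv in auto)
    then obtain g where g: "g \<in> poly2 (m - 2)" "\<And>x. h * f (\<phi> x) = (1 / h * p (\<phi> x)) * g x" by blast
    have "f x = p x * (1 / h\<^sup>2 * g (\<psi> x))" for x
    proof -
      have "F = P * (1 / h\<^sup>2 * G)" if "h * F = 1 / h * P * G" for F P G :: real
        using that h by (simp add: field_simps power2_eq_square)
      note this[OF g(2)[of "\<psi> x"]]
      then show ?thesis unfolding inv(1) .
    qed
    moreover have "(\<lambda>x. 1 / h\<^sup>2 * g (\<psi> x)) \<in> poly2 (m - 2)" by (rule poly2_scale[OF poly2_comp[OF g(1) \<psi>]])
    ultimately show ?thesis by (intro bexI[of _ "\<lambda>x. 1 / h\<^sup>2 * g (\<psi> x)"]) auto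
  qed
  have "p \<in> poly2 2" using irr by (simp add: irreducible_conic_def)
  then obtain a b c d e h where p:
    "\<And>x. p x = a + b * Re x + c * Im x + d * (Re x)\<^sup>2 + e * Re x * Im x + h * (Im x)\<^sup>2"
    by (rule poly2_2E) blast
  have lin: "(\<lambda>x. r * Re x + s * Im x) \<in> poly2 1" for r s
    using poly2_linear[of 0 r s] by simp
  have reim: "Re \<in> poly2 1" "Im \<in> poly2 1" "(\<lambda>x. Re x + Im x) \<in> poly2 1" "(\<lambda>x. Re x - Im x) \<in> poly2 1"
    using lin[of 1 0] lin[of 0 1] lin[of 1 1] lin[of 1 "-1"] by simp_all
  consider "h \<noteq> 0" | "h = 0" "d \<noteq> 0" | "h = 0" "d = 0" "e \<noteq> 0" | "h = 0" "d = 0" "e = 0" by blast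
  then show ?thesis
  proof cases
    case 1
    show ?thesis by (rule subst[of "\<lambda>x. x" "\<lambda>x. x" h a b c d e]) (use 1 p reim in auto)
  next
    case 2
    show ?thesis
      by (rule subst[of "\<lambda>x. Complex (Im x) (Re x)" "\<lambda>x. Complex (Im x) (Re x)" d a c b 0 e])
         (use 2 p reim in \<open>auto simp: complex_eq_iff\<close>)
  next
    case 3
    \<comment> \<open>A shear turns the mixed term into a mixed term plus a square of
      \<open>Im\<close>.\<close>
    show ?thesis
      by (rule subst[of "\<lambda>x. Complex (Re x + Im x) (Im x)" "\<lambda>x. Complex (Re x - Im x) (Im x)" e a b "b + c" 0 e])
         (use 3 p reim in \<open>auto simp: complex_eq_iff power2_eq_square algebra_simps\<close>)
  next
    case 4
    have "p = (\<lambda>x. 1 * (a + b * Re x + c * Im x))" using 4 by (simp add: p fun_eq_iff)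
    from irreducible_conicD[OF irr poly2_const poly2_linear this] show ?thesis by blast
  qed
qed

subsection \<open>Arcs and Jordan domains\<close>

lemma closure_open_arc:
  assumes "path g" shows "closure (open_arc g) = path_image g"
proof
  show "closure (open_arc g) \<subseteq> path_image g"
    by (rule closure_minimal) (auto simp: open_arc_def path_image_def intro: closed_path_image[OF assms, unfolded path_image_def])
  have "g ` closure {0<..<1} \<subseteq> closure (g ` {0<..<1})"
  proof (rule image_closure_subset)
    show "continuous_on (closure {0<..<1}) g" using assms by (simp add: path_def)
  qed (auto intro: closure_subset[THEN subsetD])
  then show "path_image g \<subseteq> closure (open_arc g)" by (simp add: path_image_def open_arc_def)
qed

lemma path_image_open_arc: "path_image g = open_arc g \<union> {pathstart g, pathfinish g}"
proof -
  have "{0..1::real} = {0<..<1} \<union> {0, 1}" by auto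
  then show ?thesis by (auto simp: path_image_def open_arc_def pathstart_def pathfinish_def)
qed

text \<open>Seen through the homeomorphism with [0,1], a connected set containing both ends contains
  the whole interval.\<close>

lemma connected_subset_arc_eq:
  fixes g :: "real \<Rightarrow> 'a::t2_space"
  assumes g: "arc g" and S: "connected S" "S \<subseteq> path_image g" "pathstart g \<in> S" "pathfinish g \<in> S"
  shows "S = path_image g"
proof -
  obtain h where h: "homeomorphism {0..1} (path_image g) g h" using homeomorphism_arc[OF g] by blast
  have "continuous_on S h" using h S(2) by (auto simp: homeomorphism_def intro: continuous_on_subset)
  then have "connected (h ` S)" using S(1) by (rule connected_continuous_image)
  moreover have "h (g t) = t" if "t \<in> {0..1}" for t using h that by (auto simp: homeomorphism_def)
  then have "0 \<in> h ` S" "1 \<in> h ` S"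
    using S(3,4) by (metis atLeastAtMost_iff image_eqI order_refl pathstart_def pathfinish_def zero_le_one)+
  ultimately have "{0..1} \<subseteq> h ` S" by (auto simp: connected_contains_Icc)
  then have "g ` {0..1} \<subseteq> g ` h ` S" by blast
  also have "g (h y) = y" if "y \<in> S" for y using that h S(2) by (auto simp: homeomorphism_def)
  then have "g ` h ` S = S" by (simp add: image_image cong: image_cong_simp)
  finally show ?thesis using S(2) by (auto simp: path_image_def)
qed

text \<open>If a point were missing on each of the two arcs, cutting the closed curve at these
  points would separate \<open>a\<close> from \<open>b\<close>.\<close>

lemma connected_subset_double_arc:
  fixes u d :: "real \<Rightarrow> 'a::t2_space"
  assumes u: "arc u" "pathstart u = a" "pathfinish u = b"
    and d: "arc d" "pathstart d = b" "pathfinish d = a"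
    and ud: "path_image u \<inter> path_image d = {a, b}"
    and S: "connected S" "S \<subseteq> path_image u \<union> path_image d" "a \<in> S" "b \<in> S"
  shows "path_image u \<subseteq> S \<or> path_image d \<subseteq> S"
proof (rule ccontr)
  assume "\<not> ?thesis"
  then obtain r t where r: "r \<in> {0..1}" "u r \<notin> S" and t: "t \<in> {0..1}" "d t \<notin> S"
    unfolding path_image_def by blast
  have "r \<noteq> 0" "r \<noteq> 1" "t \<noteq> 0" "t \<noteq> 1" using r t S(3,4) u d by (auto simp: pathstart_def pathfinish_def)
  then have rt: "0 < r" "r < 1" "0 < t" "t < 1" using r t by auto
  have ab: "u 0 = a" "u 1 = b" "d 0 = b" "d 1 = a" using u d by (auto simp: pathstart_def pathfinish_def)
  have inj: "inj_on u {0..1}" "inj_on d {0..1}" using u d by (auto simp: arc_def)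
  have cont: "continuous_on {0..1} u" "continuous_on {0..1} d" using u d by (auto simp: arc_def path_def)
  define A where "A = u ` {0..r} \<union> d ` {t..1}"
  define B where "B = u ` {r..1} \<union> d ` {0..t}"
  have "closed (u ` {l..m})" "closed (d ` {l..m})" if "{l..m} \<subseteq> {0..1}" for l m
    using compact_continuous_image[OF continuous_on_subset[OF cont(1) that] compact_Icc]
      compact_continuous_image[OF continuous_on_subset[OF cont(2) that] compact_Icc] by (auto intro: compact_imp_closed)
  then have cl: "closed A" "closed B" unfolding A_def B_def using rt by (simp_all add: closed_Un)
  have sub: "S \<subseteq> A \<union> B"
  proof -
    have "{0..1} = {0..r} \<union> {r..1}" "{0..1} = {0..t} \<union> {t..1}" using rt by auto
    then have "path_image u = u ` {0..r} \<union> u ` {r..1}" "path_image d = d ` {0..t} \<union> d ` {t..1}"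
      unfolding path_image_def by (metis image_Un)+
    then show ?thesis using S(2) unfolding A_def B_def by blast
  qed
  have pud: "u i \<in> path_image u" "d i \<in> path_image d" if "i \<in> {0..1}" for i
    using that by (auto simp: path_image_def)
  have "x \<notin> S" if xAB: "x \<in> A" "x \<in> B" for x
  proof -
    consider i j where "x = u i" "i \<in> {0..r}" "x = u j" "j \<in> {r..1}"
      | i j where "x = u i" "i \<in> {0..r}" "x = d j" "j \<in> {0..t}"
      | i j where "x = d i" "i \<in> {t..1}" "x = u j" "j \<in> {r..1}"
      | i j where "x = d i" "i \<in> {t..1}" "x = d j" "j \<in> {0..t}"
      using xAB unfolding A_def B_def by blast
    then show ?thesis
    proof cases
      case 1
      then have "i = j" using inj_onD[OF inj(1), of i j] rt by auto
      then have "i = r" using 1 by auto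
      then show ?thesis using 1 r by simp
    next
      case 4
      then have "i = j" using inj_onD[OF inj(2), of i j] rt by auto
      then have "i = t" using 4 by auto
      then show ?thesis using 4 t by simp
    next
      case 2
      then have "x \<in> path_image u" "x \<in> path_image d" using pud(1)[of i] pud(2)[of j] rt by auto
      then have "x \<in> {a, b}" using ud by blast
      then show ?thesis
      proof
        assume "x = a"
        then have "j = 1" using 2 ab inj_onD[OF inj(2), of j 1] rt by auto
        then show ?thesis using 2 rt by auto
      next
        assume "x \<in> {b}"
        then have "i = 1" using 2 ab inj_onD[OF inj(1), of i 1] rt by auto
        then show ?thesis using 2 rt by auto
      qed
    next
      case 3
      then have "x \<in> path_image u" "x \<in> path_image d" using pud(1)[of j] pud(2)[of i] rt by auto
      then have "x \<in> {a, b}" using ud by blast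
      then show ?thesis
      proof
        assume "x = a"
        then have "j = 0" using 3 ab inj_onD[OF inj(1), of j 0] rt by auto
        then show ?thesis using 3 rt by auto
      next
        assume "x \<in> {b}"
        then have "i = 0" using 3 ab inj_onD[OF inj(2), of i 0] rt by auto
        then show ?thesis using 3 rt by auto
      qed
    qed
  qed
  moreover have "a \<in> A" "b \<in> B" using ab rt by (force simp: A_def B_def)+
  ultimately show False using S(1,3,4) cl sub unfolding connected_closed by blast
qed

text \<open>Inside and outside are connected and miss the frontier of \<open>U\<close>, so each lies
  in \<open>U\<close> or avoids it; boundedness excludes the outside.\<close>

lemma Jordan_domain_eq_inside:
  fixes g :: "real \<Rightarrow> complex"
  assumes U: "open U" "connected U" "bounded U" "U \<noteq> {}"
    and g: "simple_path g" "pathfinish g = pathstart g" "frontier U = path_image g"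
  shows "U = inside (path_image g)"
proof -
  note J = Jordan_inside_outside[OF g(1,2)]
  have dis: "U \<inter> path_image g = {}" using U(1) g(3) frontier_disjoint_eq by blast
  have "inside (path_image g) \<subseteq> U" if "inside (path_image g) \<inter> U \<noteq> {}"
    using connected_Int_frontier[of "inside (path_image g)" U] that J g(3) inside_no_overlap by blast
  moreover have "outside (path_image g) \<inter> U = {}"
  proof (rule ccontr)
    assume "outside (path_image g) \<inter> U \<noteq> {}"
    then have "outside (path_image g) \<subseteq> U"
      using connected_Int_frontier[of "outside (path_image g)" U] J g(3) outside_no_overlap by blast
    then show False using J U(3) bounded_subset by blast
  qed
  moreover have "U \<subseteq> inside (path_image g) \<union> outside (path_image g)" using dis J by blast
  ultimately show ?thesis using U(4) by blast
qed

text \<open>A point of the curve is a limit of outside points, hence not interior.\<close>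

lemma interior_Un_inside:
  fixes g :: "real \<Rightarrow> complex"
  assumes "simple_path g" "pathfinish g = pathstart g"
  shows "interior (path_image g \<union> inside (path_image g)) = inside (path_image g)"
    and "closed (path_image g \<union> inside (path_image g))"
    and "frontier (path_image g \<union> inside (path_image g)) = path_image g"
    and "closure (inside (path_image g)) = path_image g \<union> inside (path_image g)"
proof -
  note J = Jordan_inside_outside[OF assms]
  show cl: "closed (path_image g \<union> inside (path_image g))"
    by (rule closed_path_image_Un_inside[OF simple_path_imp_path[OF assms(1)]])
  have "x \<notin> interior (path_image g \<union> inside (path_image g))" if x: "x \<in> path_image g" for x
  proof
    assume "x \<in> interior (path_image g \<union> inside (path_image g))"
    moreover have "x \<in> closure (outside (path_image g))" using J x by (auto simp: frontier_def)
    ultimately have "interior (path_image g \<union> inside (path_image g)) \<inter> outside (path_image g) \<noteq> {}"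
      using open_Int_closure_eq_empty[OF open_interior] by blast
    then show False using interior_subset J outside_no_overlap by blast
  qed
  moreover have "inside (path_image g) \<subseteq> interior (path_image g \<union> inside (path_image g))"
    using J by (intro interior_maximal) auto
  moreover have "inside (path_image g) \<inter> path_image g = {}" by (rule inside_no_overlap)
  ultimately show i: "interior (path_image g \<union> inside (path_image g)) = inside (path_image g)"
    using interior_subset by blast
  show "frontier (path_image g \<union> inside (path_image g)) = path_image g"
    unfolding frontier_def i closure_closed[OF cl] using inside_no_overlap by blast
  have "frontier (inside (path_image g)) = path_image g" using J by blast
  then show "closure (inside (path_image g)) = path_image g \<union> inside (path_image g)"
    using closure_Un_frontier by blast
qed

text \<open>False for general open sets, for instance a slit disc. It is what puts the interiors of
  the closed cells, which only cover \<open>closure \<Omega>\<close>, inside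
  \<open>\<Omega>\<close>.\<close>

lemma interior_closure_Jordan_domain:
  fixes g :: "real \<Rightarrow> complex"
  assumes U: "open U" "connected U" "bounded U" "U \<noteq> {}"
    and g: "simple_path g" "pathfinish g = pathstart g" "frontier U = path_image g"
  shows "interior (closure U) = U"
  using interior_Un_inside(1,4)[OF g(1,2)] Jordan_domain_eq_inside[OF assms] by simp

subsection \<open>Half-discs along an edge\<close>

text \<open>Signed distance of \<open>y\<close> from the line through \<open>x\<close> parallel to
  \<open>w - u\<close>, in units of the length of \<open>w - u\<close>.\<close>

definition side :: "complex \<Rightarrow> complex \<Rightarrow> complex \<Rightarrow> complex \<Rightarrow> real" where
  "side u w x y = Im ((y - x) / (w - u))"

lemma side_segment:
  assumes "x \<in> closed_segment u w" "y \<in> closed_segment u w" "u \<noteq> w"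
  shows "side u w x y = 0"
proof -
  obtain s t where st: "x = (1 - s) *\<^sub>R u + s *\<^sub>R w" "y = (1 - t) *\<^sub>R u + t *\<^sub>R w"
    using assms by (auto simp: closed_segment_def)
  have "y - x = of_real (t - s) * (w - u)" unfolding st by (simp add: scaleR_conv_of_real algebra_simps)
  then have "(y - x) / (w - u) = of_real (t - s)" using assms(3) by simp
  then show ?thesis unfolding side_def by (simp only: Im_complex_of_real)
qed

lemma side_shift: "u \<noteq> w \<Longrightarrow> side u w x (y + \<i> * of_real t * (w - u)) = side u w x y + t"
  by (simp add: side_def add_divide_distrib diff_divide_distrib)

lemma convex_side: "convex {y. 0 < \<sigma> * side u w x y}"
proof (rule convexI)
  fix y z a b assume *: "y \<in> {y. 0 < \<sigma> * side u w x y}" "z \<in> {y. 0 < \<sigma> * side u w x y}" "0 \<le> a" "0 \<le> b" "a + b = (1::real)"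
  have b: "b = 1 - a" using *(5) by simp
  have d: "(r *\<^sub>R c) / k = r *\<^sub>R (c / k)" for r :: real and c k :: complex by (simp add: scaleR_conv_of_real)
  have "(a *\<^sub>R y + b *\<^sub>R z - x) = a *\<^sub>R (y - x) + b *\<^sub>R (z - x)"
    unfolding b by (simp add: algebra_simps)
  then have "(a *\<^sub>R y + b *\<^sub>R z - x) / (w - u) = a *\<^sub>R ((y - x) / (w - u)) + b *\<^sub>R ((z - x) / (w - u))"
    by (simp only: add_divide_distrib d)
  then have "side u w x (a *\<^sub>R y + b *\<^sub>R z) = a * side u w x y + b * side u w x z"
    unfolding side_def by (simp only: plus_complex.sel scaleR_complex.sel)
  then have e: "\<sigma> * side u w x (a *\<^sub>R y + b *\<^sub>R z) = a * (\<sigma> * side u w x y) + b * (\<sigma> * side u w x z)"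
    by (simp add: algebra_simps)
  have P: "0 < \<sigma> * side u w x y" "0 < \<sigma> * side u w x z" using * by auto
  have "0 < a * (\<sigma> * side u w x y) + b * (\<sigma> * side u w x z)"
  proof (cases "a > 0")
    case True
    then show ?thesis
      by (intro add_pos_nonneg mult_pos_pos[OF _ P(1)] mult_nonneg_nonneg[OF *(4) less_imp_le[OF P(2)]])
  next
    case False
    then have "a = 0" "b = 1" using * by auto
    then show ?thesis using P by simp
  qed
  then show "a *\<^sub>R y + b *\<^sub>R z \<in> {y. 0 < \<sigma> * side u w x y}" by (simp add: e)
qed

lemma shift_in_open:
  assumes "open S" "y \<in> S" "u \<noteq> w"
  shows "\<exists>\<delta>>0. \<forall>t. \<bar>t\<bar> < \<delta> \<longrightarrow> y + \<i> * of_real t * (w - u) \<in> S"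
proof -
  obtain e where e: "0 < e" "ball y e \<subseteq> S" using assms by (auto simp: open_contains_ball)
  have "y + \<i> * of_real t * (w - u) \<in> S" if "\<bar>t\<bar> < e / norm (w - u)" for t
    using that e assms(3) by (auto simp: dist_norm norm_mult less_divide_eq intro!: subsetD[OF e(2)])
  then show ?thesis using e assms(3) by (intro exI[of _ "e / norm (w - u)"]) auto
qed

text \<open>Near \<open>x\<close> the frontier is contained in the edge, so an open half-disc is
  connected and misses the frontier; it lies inside as soon as one of its points does.\<close>

lemma half_disc:
  assumes X: "X \<subseteq> closure (interior X)" "x \<in> X" and uw: "u \<noteq> w" "x \<in> closed_segment u w"
    and e: "0 < e" "ball x e \<inter> frontier X \<subseteq> closed_segment u w"
  shows "\<exists>\<sigma>\<in>{1, -1}. \<forall>y\<in>ball x e. 0 < \<sigma> * side u w x y \<longrightarrow> y \<in> interior X"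
proof -
  have "interior X \<inter> ball x e \<noteq> {}"
    using X e(1) by (metis centre_in_ball disjoint_iff open_Int_closure_eq_empty open_ball open_interior subsetD inf_commute)
  then obtain y where y: "y \<in> interior X \<inter> ball x e" by blast
  \<comment> \<open>An interior point found on the line itself is pushed off it within the
    interior.\<close>
  obtain z where z: "z \<in> interior X \<inter> ball x e" "side u w x z \<noteq> 0"
  proof (cases "side u w x y = 0")
    case True
    obtain \<delta> where d: "\<delta> > 0" "\<forall>t. \<bar>t\<bar> < \<delta> \<longrightarrow> y + \<i> * of_real t * (w - u) \<in> interior X \<inter> ball x e"
      using shift_in_open[OF open_Int[OF open_interior open_ball] y uw(1)] by blast
    show ?thesis
    proof (rule that)
      show "y + \<i> * of_real (\<delta>/2) * (w - u) \<in> interior X \<inter> ball x e"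
        by (rule d(2)[rule_format]) (use d(1) in simp)
      show "side u w x (y + \<i> * of_real (\<delta>/2) * (w - u)) \<noteq> 0"
        unfolding side_shift[OF uw(1)] using True d(1) by simp
    qed
  qed (use y that in blast)
  define \<sigma> where "\<sigma> = sgn (side u w x z)"
  have s: "\<sigma> \<in> {1, -1}" "0 < \<sigma> * side u w x z" using z(2) by (auto simp: \<sigma>_def sgn_if)
  define H where "H = ball x e \<inter> {y. 0 < \<sigma> * side u w x y}"
  have "connected H" unfolding H_def by (intro convex_connected convex_Int convex_side convex_ball)
  moreover have "H \<inter> frontier X = {}"
  proof -
    have "side u w x y = 0" if "y \<in> H" "y \<in> frontier X" for y
      using e(2) side_segment[OF uw(2) _ uw(1), of y] that by (auto simp: H_def)
    moreover have "side u w x y \<noteq> 0" if "y \<in> H" for y using that by (auto simp: H_def)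
    ultimately show ?thesis by blast
  qed
  moreover have "z \<in> H \<inter> X" using z s(2) interior_subset unfolding H_def by blast
  ultimately have "H \<subseteq> X" using connected_Int_frontier by blast
  then have "H \<subseteq> interior X" using \<open>H \<inter> frontier X = {}\<close> closure_subset[of X] unfolding frontier_def by blast
  then show ?thesis using s by (auto simp: H_def)
qed

text \<open>Each set contains one half-disc. Disjointness of the interiors off the edge forces
  opposite sides, and closedness adds the diameter.\<close>

lemma edge_interior_Un:
  fixes u w x :: complex
  assumes X: "closed X" "X \<subseteq> closure (interior X)" and Y: "closed Y" "Y \<subseteq> closure (interior Y)"
    and uw: "u \<noteq> w" "x \<in> closed_segment u w" "x \<in> X" "x \<in> Y"
    and XY: "interior X \<inter> interior Y \<subseteq> closed_segment u w"
    and e: "0 < e" "ball x e \<inter> frontier X \<subseteq> closed_segment u w"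
    and e': "0 < e'" "ball x e' \<inter> frontier Y \<subseteq> closed_segment u w"
  shows "x \<in> interior (X \<union> Y)"
proof -
  obtain \<sigma> where s: "\<sigma> \<in> {1, -1}" "\<forall>y\<in>ball x e. 0 < \<sigma> * side u w x y \<longrightarrow> y \<in> interior X"
    using half_disc[OF X(2) uw(3,1,2) e] by blast
  obtain \<tau> where t: "\<tau> \<in> {1, -1}" "\<forall>y\<in>ball x e'. 0 < \<tau> * side u w x y \<longrightarrow> y \<in> interior Y"
    using half_disc[OF Y(2) uw(4,1,2) e'] by blast
  define m where "m = min e e'"
  have m: "0 < m" "ball x m \<subseteq> ball x e" "ball x m \<subseteq> ball x e'" using e e' by (auto simp: m_def)
  have sx: "side u w x x = 0" by (simp add: side_def)
  have "\<sigma> \<noteq> \<tau>"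
  proof
    assume "\<sigma> = \<tau>"
    obtain \<delta> where d: "\<delta> > 0" "\<forall>t. \<bar>t\<bar> < \<delta> \<longrightarrow> x + \<i> * of_real t * (w - u) \<in> ball x m"
      using shift_in_open[OF open_ball, of x x m, OF _ uw(1)] m by auto
    define y where "y = x + \<i> * of_real (\<sigma> * (\<delta> / 2)) * (w - u)"
    have "y \<in> ball x m" unfolding y_def by (rule d(2)[rule_format]) (use d s(1) in auto)
    have sy: "side u w x y = \<sigma> * (\<delta> / 2)" unfolding y_def side_shift[OF uw(1)] sx by simp
    moreover have "0 < \<sigma> * side u w x y" unfolding sy using s(1) d(1) by auto
    ultimately have "y \<in> interior X \<inter> interior Y" using s t m \<open>y \<in> ball x m\<close> \<open>\<sigma> = \<tau>\<close> by blast
    then have "side u w x y = 0" using XY side_segment[OF uw(2) _ uw(1)] by blast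
    then show False using sy s(1) d(1) by auto
  qed
  then have ts: "\<tau> = - \<sigma>" using s(1) t(1) by auto
  have off: "y \<in> X \<union> Y" if "y \<in> ball x m" "side u w x y \<noteq> 0" for y
  proof -
    have "0 < \<sigma> * side u w x y \<or> 0 < \<tau> * side u w x y" using that(2) s(1) ts by auto
    then show ?thesis using s t m that interior_subset by blast
  qed
  have "y \<in> X \<union> Y" if y: "y \<in> ball x m" for y
  proof -
    have "y \<in> closure (X \<union> Y)"
    proof (rule ccontr)
      assume "y \<notin> closure (X \<union> Y)"
      then have mem: "y \<in> ball x m - closure (X \<union> Y)" using y by blast
      have op: "open (ball x m - closure (X \<union> Y))" by (intro open_Diff open_ball closed_closure)
      obtain \<delta> where d: "\<delta> > 0" "\<forall>t. \<bar>t\<bar> < \<delta> \<longrightarrow> y + \<i> * of_real t * (w - u) \<in> ball x m - closure (X \<union> Y)"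
        using shift_in_open[OF op mem uw(1)] by blast
      define z where "z t = y + \<i> * of_real t * (w - u)" for t
      \<comment> \<open>Two different shifts, since one of them could land on the line.\<close>
      have "side u w x (z (\<delta>/2)) \<noteq> 0 \<or> side u w x (z (\<delta>/3)) \<noteq> 0"
        unfolding z_def side_shift[OF uw(1)] using d(1) by auto
      moreover have "z (\<delta>/2) \<in> ball x m - closure (X \<union> Y)" "z (\<delta>/3) \<in> ball x m - closure (X \<union> Y)"
        unfolding z_def by (rule d(2)[rule_format], use d(1) in simp)+
      ultimately show False using off[of "z (\<delta>/2)"] off[of "z (\<delta>/3)"] closure_subset[of "X \<union> Y"] by blast
    qed
    then show ?thesis using X(1) Y(1) by (simp add: closed_Un)
  qed
  then have "ball x m \<subseteq> X \<union> Y" by blast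
  then show ?thesis using m(1) by (meson centre_in_ball interior_maximal open_ball subsetD)
qed

lemma segments_meet:
  assumes V: "independent_verts {u, w, z}" and "card {u, w, z} = 3"
  shows "closed_segment u w \<inter> closed_segment u z = {u}"
proof
  have ne: "u \<noteq> w" "u \<noteq> z" "w \<noteq> z" using assms(2) by (auto simp: card_insert_if split: if_splits)
  show "closed_segment u w \<inter> closed_segment u z \<subseteq> {u}"
  proof
    fix x assume "x \<in> closed_segment u w \<inter> closed_segment u z"
    then have x: "x \<in> convex hull {u, w}" "x \<in> convex hull {u, z}" by (auto simp: segment_convex_hull)
    have h: "x \<in> convex hull {u, w, z}" using x(1) hull_mono[of "{u, w}" "{u, w, z}"] by blast
    have "bary {u, w, z} z x = 0" "bary {u, w, z} w x = 0"
      using x in_convex_hull_face[OF V, of "{u, w}" x] in_convex_hull_face[OF V, of "{u, z}" x] h ne by auto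
    then have "x \<in> convex hull {u}" using in_convex_hull_face[OF V, of "{u}" x] h by auto
    then show "x \<in> {u}" by simp
  qed
qed auto

text \<open>\<open>F\<close> spans the smallest face containing \<open>x\<close>. Through it,
  statements about boundary points reduce to vertices and edges.\<close>

lemma positive_face:
  assumes V: "independent_verts V" and x: "x \<in> convex hull V"
  defines "F \<equiv> {u\<in>V. 0 < bary V u x}"
  shows "F \<noteq> {}" "x \<in> convex hull F" "\<And>u. u \<in> F \<Longrightarrow> 0 < bary F u x"
proof -
  have xa: "x \<in> affine hull V" "\<forall>u\<in>V. 0 \<le> bary V u x" using x in_convex_hull_bary[OF V] by auto
  show ne: "F \<noteq> {}"
  proof
    assume "F = {}"
    then have "(\<Sum>u\<in>V. bary V u x) \<le> 0" by (intro sum_nonpos) (force simp: F_def)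
    then show False using sum_bary[OF V xa(1)] by simp
  qed
  have sub: "F \<subseteq> V" by (auto simp: F_def)
  show xF: "x \<in> convex hull F" unfolding in_convex_hull_face[OF V sub ne x]
    using xa(2) by (force simp: F_def)
  show "0 < bary F u x" if "u \<in> F" for u
    using bary_face[OF V sub convex_hull_imp_affine_hull[OF xF], of u] that by (simp add: F_def)
qed

lemma interior_triangle:
  assumes V: "independent_verts V" and c: "card V = 3"
    and x: "x \<in> convex hull V" "\<And>u. u \<in> V \<Longrightarrow> 0 < bary V u x"
  shows "x \<in> interior (convex hull V)"
proof (rule ccontr)
  obtain a b d where abd: "V = {a, b, d}" "a \<noteq> b" "b \<noteq> d" "a \<noteq> d" using c by (auto simp: card_3_iff)
  assume "x \<notin> interior (convex hull V)"
  then have "x \<in> frontier (convex hull V)" using x(1) closure_subset by (fastforce simp: frontier_def)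
  then consider "x \<in> convex hull {a, b}" | "x \<in> convex hull {b, d}" | "x \<in> convex hull {d, a}"
    unfolding abd(1) frontier_of_triangle[OF DIM_complex] by (auto simp: segment_convex_hull)
  then show False
  proof cases
    case 1
    then show False using in_convex_hull_face[OF V, of "{a, b}" x] x abd by force
  next
    case 2
    then show False using in_convex_hull_face[OF V, of "{b, d}" x] x abd by force
  next
    case 3
    then show False using in_convex_hull_face[OF V, of "{d, a}" x] x abd by force
  qed
qed

subsection \<open>The domain\<close>

locale conic_domain =
  fixes \<Omega> :: "complex set" and n :: nat and \<gamma> :: "nat \<Rightarrow> real \<Rightarrow> complex" and q :: "nat \<Rightarrow> complex \<Rightarrow> real"
  assumes domain: "piecewise_conic_domain \<Omega> n \<gamma> q"
begin

abbreviation corner :: "nat \<Rightarrow> complex" where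
  "corner j \<equiv> pathstart (\<gamma> j)"

lemma open_domain: "open \<Omega>" and domain_nonempty: "\<Omega> \<noteq> {}" and bounded_domain: "bounded \<Omega>"
  and connected_domain: "connected \<Omega>" and n_pos: "1 \<le> n"
  using domain by (auto simp: piecewise_conic_domain_def intro: simply_connected_imp_connected)

lemma simple_arc: "j < n \<Longrightarrow> simple_path (\<gamma> j)"
  using domain by (auto simp: piecewise_conic_domain_def regular_arc_def)

lemma pathfinish_arc: "j < n \<Longrightarrow> pathfinish (\<gamma> j) = corner (Suc j mod n)"
  using domain by (auto simp: piecewise_conic_domain_def)

lemma corner_inj: "i < n \<Longrightarrow> j < n \<Longrightarrow> corner i = corner j \<longleftrightarrow> i = j"
  using domain by (auto simp: piecewise_conic_domain_def dest: inj_onD)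

lemma corner_not_open_arc: "i < n \<Longrightarrow> j < n \<Longrightarrow> corner i \<notin> open_arc (\<gamma> j)"
  using domain by (auto simp: piecewise_conic_domain_def)

lemma open_arcs_disjoint: "i < n \<Longrightarrow> j < n \<Longrightarrow> x \<in> open_arc (\<gamma> i) \<Longrightarrow> x \<in> open_arc (\<gamma> j) \<Longrightarrow> i = j"
  using domain unfolding piecewise_conic_domain_def by blast

lemma frontier_domain: "frontier \<Omega> = (\<Union>j<n. path_image (\<gamma> j))"
proof -
  have "frontier \<Omega> = (\<Union>j<n. closure (open_arc (\<gamma> j)))"
    using domain by (simp add: piecewise_conic_domain_def)
  then show ?thesis using simple_arc by (simp add: closure_open_arc simple_path_imp_path)
qed

lemma arc_subset_frontier: "j < n \<Longrightarrow> path_image (\<gamma> j) \<subseteq> frontier \<Omega>"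
  using frontier_domain by blast

lemma frontier_disjoint: "x \<in> frontier \<Omega> \<Longrightarrow> x \<notin> \<Omega>"
  using open_domain frontier_disjoint_eq by blast

lemma q_zero: "j < n \<Longrightarrow> x \<in> path_image (\<gamma> j) \<Longrightarrow> q j \<in> poly2 k \<Longrightarrow> q j x = 0"
proof -
  assume a: "j < n" "x \<in> path_image (\<gamma> j)" "q j \<in> poly2 k"
  have "open_arc (\<gamma> j) \<subseteq> {x. q j x = 0}" using domain a(1) by (auto simp: piecewise_conic_domain_def)
  moreover have "closed {x. q j x = 0}"
    using continuous_on_poly2[OF a(3), of UNIV] by (intro closed_Collect_eq) auto
  ultimately have "closure (open_arc (\<gamma> j)) \<subseteq> {x. q j x = 0}" by (rule closure_minimal)
  then show ?thesis using a simple_arc closure_open_arc simple_path_imp_path by blast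
qed

lemma q_conic: "j < n \<Longrightarrow> conic_arc (\<gamma> j) \<Longrightarrow> q j \<in> poly2 2 - poly2 1"
  using domain by (auto simp: piecewise_conic_domain_def)

lemma arcs_meet:
  assumes "i < n" "j < n" "i \<noteq> j" "x \<in> path_image (\<gamma> i)" "x \<in> path_image (\<gamma> j)"
  shows "x \<in> {corner i, corner (Suc i mod n)} \<inter> {corner j, corner (Suc j mod n)}"
proof -
  have "Suc k mod n < n" for k using n_pos by simp
  then show ?thesis
    using assms open_arcs_disjoint[OF assms(1,2)] corner_not_open_arc
    unfolding path_image_open_arc by (auto simp: pathfinish_arc)
qed

lemma Suc_mod_inj: "i < n \<Longrightarrow> j < n \<Longrightarrow> Suc i mod n = Suc j mod n \<Longrightarrow> i = j"
  by (cases "Suc i = n"; cases "Suc j = n") auto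

lemma pred_Suc_mod: "j < n \<Longrightarrow> (Suc j mod n + n - 1) mod n = j"
  by (cases "Suc j = n") auto

text \<open>Since corners are distinct, the two arcs must be consecutive; the form with the
  predecessor of \<open>k\<close> matches the corner condition of the mesh.\<close>

lemma arcs_meet_at_corner:
  assumes "i < n" "j < n" "i \<noteq> j" "x \<in> path_image (\<gamma> i)" "x \<in> path_image (\<gamma> j)"
  shows "\<exists>k<n. x = corner k \<and> {i, j} = {k, (k + n - 1) mod n}"
proof -
  have m: "Suc k mod n < n" for k using n_pos by simp
  consider "corner i = corner j" | "x = corner i" "corner i = corner (Suc j mod n)"
    | "x = corner j" "corner (Suc i mod n) = corner j" | "corner (Suc i mod n) = corner (Suc j mod n)"
    using arcs_meet[OF assms] by auto
  then show ?thesis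
  proof cases
    case 1 then show ?thesis using corner_inj assms by blast
  next
    case 2
    then have i: "i = Suc j mod n" using corner_inj[OF assms(1) m] by blast
    have "(i + n - 1) mod n = j" unfolding i by (rule pred_Suc_mod[OF assms(2)])
    then show ?thesis using 2 assms(1) by (intro exI[of _ i]) auto
  next
    case 3
    then have j: "j = Suc i mod n" using corner_inj[OF m assms(2)] by metis
    have "(j + n - 1) mod n = i" unfolding j by (rule pred_Suc_mod[OF assms(1)])
    then show ?thesis using 3 assms(2) by (intro exI[of _ j]) auto
  next
    case 4 then show ?thesis using corner_inj[OF m m] Suc_mod_inj[OF assms(1,2)] assms(3) by blast
  qed
qed

text \<open>The arcs are joined one by one: each meets the preceding ones in a single corner, except
  the last, which also closes the loop. For \<open>n = 1\<close> the arc is itself closed.\<close>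

lemma frontier_loop:
  obtains g where "simple_path g" "pathfinish g = pathstart g" "path_image g = frontier \<Omega>"
proof (cases "n = 1")
  case True
  then show ?thesis
    using that[of "\<gamma> 0"] simple_arc[of 0] pathfinish_arc[of 0] frontier_domain by auto
next
  case False
  then have n2: "2 \<le> n" using n_pos by simp
  have arc: "arc (\<gamma> j)" if "j < n" for j
  proof -
    have "corner (Suc j mod n) \<noteq> corner j"
      using that n2 corner_inj[of "Suc j mod n" j] by (cases "Suc j = n") auto
    then show ?thesis using simple_path_imp_arc[OF simple_arc[OF that]] pathfinish_arc[OF that] by simp
  qed
  have "\<exists>g. arc g \<and> pathstart g = corner 0 \<and> pathfinish g = corner (Suc m) \<and>
      path_image g = (\<Union>j\<le>m. path_image (\<gamma> j))" if "Suc m < n" for m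
    using that
  proof (induction m)
    case 0
    then show ?case using arc[of 0] pathfinish_arc[of 0] by (intro exI[of _ "\<gamma> 0"]) auto
  next
    case (Suc m)
    then obtain g where g: "arc g" "pathstart g = corner 0" "pathfinish g = corner (Suc m)"
      "path_image g = (\<Union>j\<le>m. path_image (\<gamma> j))" by auto
    have "x = corner (Suc m)" if x: "x \<in> path_image g" "x \<in> path_image (\<gamma> (Suc m))" for x
    proof -
      obtain j where j: "j \<le> m" "x \<in> path_image (\<gamma> j)" using x(1) g(4) by auto
      then show ?thesis
        using arcs_meet[of j "Suc m" x] x(2) Suc.prems corner_inj[of j "Suc (Suc m)"] corner_inj[of "Suc j" "Suc (Suc m)"]
        by auto
    qed
    then have a: "arc (g +++ \<gamma> (Suc m))" using g arc Suc.prems by (intro arc_join) auto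
    have "path_image (g +++ \<gamma> (Suc m)) = (\<Union>j\<le>Suc m. path_image (\<gamma> j))"
      using g Suc.prems by (subst path_image_join) (auto simp: atMost_Suc)
    then show ?case using a g pathfinish_arc[of "Suc m"] Suc.prems by (intro exI[of _ "g +++ \<gamma> (Suc m)"]) auto
  qed
  from this[of "n - 2"] n2 obtain g where g: "arc g" "pathstart g = corner 0" "pathfinish g = corner (n - 1)"
    "path_image g = (\<Union>j\<le>n - 2. path_image (\<gamma> j))"
    by (metis (no_types, lifting) One_nat_def Suc_1 Suc_diff_Suc diff_Suc_1 diff_less less_le_trans numeral_2_eq_2 zero_less_Suc Suc_le_lessD)
  have "x = corner 0 \<or> x = corner (n - 1)" if x: "x \<in> path_image g" "x \<in> path_image (\<gamma> (n - 1))" for x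
  proof -
    obtain j where j: "j \<le> n - 2" "x \<in> path_image (\<gamma> j)" using x(1) g(4) by auto
    then show ?thesis using arcs_meet[of j "n - 1" x] x(2) n2 by auto
  qed
  then have "simple_path (g +++ \<gamma> (n - 1))"
    using g arc[of "n - 1"] pathfinish_arc[of "n - 1"] n2 by (intro simple_path_join_loop) auto
  moreover have "path_image (g +++ \<gamma> (n - 1)) = frontier \<Omega>"
  proof -
    have "{..<n} = insert (n - 1) {..n - 2}" using n2 by auto
    then show ?thesis using g unfolding frontier_domain by (subst path_image_join) auto
  qed
  ultimately show ?thesis using that[of "g +++ \<gamma> (n - 1)"] g pathfinish_arc[of "n - 1"] n2 by auto
qed

lemma interior_closure_domain: "interior (closure \<Omega>) = \<Omega>"
proof -
  obtain g where "simple_path g" "pathfinish g = pathstart g" "path_image g = frontier \<Omega>" by (rule frontier_loop)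
  then show ?thesis
    by (intro interior_closure_Jordan_domain[OF open_domain connected_domain bounded_domain domain_nonempty, of g]) auto
qed

end

subsection \<open>The cells of a triangulation\<close>

lemma frontier_triangle_edges:
  assumes "V = {u, w, z :: complex}"
  shows "frontier (convex hull V) = closed_segment u w \<union> (closed_segment w z \<union> closed_segment z u)"
  unfolding assms frontier_of_triangle[OF DIM_complex] by (rule Un_assoc)

definition enclosed_by :: "complex set \<Rightarrow> (real \<Rightarrow> complex) \<Rightarrow> bool" where
  "enclosed_by X g \<longleftrightarrow> simple_path g \<and> pathfinish g = pathstart g \<and> X = path_image g \<union> inside (path_image g)"

locale conic_mesh = conic_domain +
  fixes \<T> :: "cell set"
  assumes mesh: "conic_triangulation \<Omega> n \<gamma> q \<T>"
begin

abbreviation edges :: "cell \<Rightarrow> complex set set" where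
  "edges \<equiv> straight_edges n \<gamma>"

abbreviation pie :: "nat \<Rightarrow> complex \<Rightarrow> cell \<Rightarrow> bool" where
  "pie \<equiv> pie_cell n \<gamma>"

lemma finite_mesh: "finite \<T>"
  using mesh by (simp add: conic_triangulation_def)

lemma mesh_cover: "(\<Union>T\<in>\<T>. region T) = closure \<Omega>"
  using mesh by (simp add: conic_triangulation_def)

lemma mesh_nonempty: "\<T> \<noteq> {}"
  using mesh_cover domain_nonempty closure_subset by fastforce

lemma pies_iff: "T \<in> pies n \<gamma> \<T> \<longleftrightarrow> T \<in> \<T> \<and> (\<exists>j v. pie j v T)"
  by (auto simp: pies_def)

lemma not_pie_straight: "T \<in> \<T> \<Longrightarrow> T \<notin> pies n \<gamma> \<T> \<Longrightarrow> straight_cell T"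
  using mesh by (auto simp: conic_triangulation_def pies_def)

lemma mesh_cases:
  assumes "T \<in> \<T>"
  obtains "T \<in> ordinaries n \<gamma> \<T>" | "T \<in> pies n \<gamma> \<T>" | "T \<in> buffers n \<gamma> \<T>"
  using assms by (auto simp: ordinaries_def)

lemma independent_cell:
  assumes "T \<in> \<T>" shows "independent_verts (verts T)" "card (verts T) = 3"
proof -
  have "card (verts T) = 3 \<and> \<not> affine_dependent (verts T)"
    using assms mesh by (auto simp: conic_triangulation_def straight_cell_def pie_cell_def)
  moreover from this have "finite (verts T)" "verts T \<noteq> {}" by (auto intro: card_ge_0_finite)
  ultimately show "independent_verts (verts T)" "card (verts T) = 3" by (auto simp: independent_verts_def)
qed

lemma pie_interior_vertex: "T \<in> \<T> \<Longrightarrow> pie j v T \<Longrightarrow> v \<in> \<Omega>"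
  using mesh unfolding conic_triangulation_def by blast

lemma pie_star_shaped: "T \<in> \<T> \<Longrightarrow> pie j v T \<Longrightarrow> x \<in> region T \<Longrightarrow> closed_segment v x \<subseteq> region T"
  using mesh unfolding conic_triangulation_def by blast

lemma pie_positive: "T \<in> \<T> \<Longrightarrow> pie j v T \<Longrightarrow> x \<in> region T \<Longrightarrow> x \<notin> closure (open_arc (\<gamma> j)) \<Longrightarrow> 0 < q j x"
  using mesh unfolding conic_triangulation_def by blast

lemma pie_index: "pie j v T \<Longrightarrow> j < n" and pie_conic: "pie j v T \<Longrightarrow> conic_arc (\<gamma> j)"
  by (auto simp: pie_cell_def)

text \<open>The curved side \<open>c\<close> is a subpath of \<open>\<gamma> j\<close> with distinct
  ends, thus an arc even where \<open>\<gamma> j\<close> is closed. The parametrisation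
  \<open>g\<close> of the whole boundary gives access to the Jordan curve theorem.\<close>

definition pie_boundary :: "nat \<Rightarrow> complex \<Rightarrow> cell \<Rightarrow> complex \<Rightarrow> complex \<Rightarrow> (real \<Rightarrow> complex) \<Rightarrow> bool" where
  "pie_boundary j v T a b c \<longleftrightarrow> verts T = {v, a, b} \<and> arc c \<and> pathstart c = a \<and> pathfinish c = b \<and>
     path_image c \<subseteq> path_image (\<gamma> j) \<and> path_image c - {a, b} \<subseteq> open_arc (\<gamma> j) \<and> path_image c - {a, b} \<noteq> {} \<and>
     closed_segment v a \<inter> path_image c = {a} \<and> closed_segment v b \<inter> path_image c = {b} \<and>
     closed_segment v a \<inter> closed_segment v b = {v} \<and>
     (\<exists>g. enclosed_by (region T) g \<and> path_image g = closed_segment v a \<union> closed_segment v b \<union> path_image c)"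

lemma pie_boundary_exists:
  assumes T: "T \<in> \<T>" and p: "pie j v T"
  shows "\<exists>a b c. pie_boundary j v T a b c"
proof -
  obtain s t a b C J where st: "0 \<le> s" "s < t" "t \<le> 1" "a = \<gamma> j s" "b = \<gamma> j t" "C = \<gamma> j ` {s..t}"
    and V: "verts T = {v, a, b}" and C: "closed_segment v a \<inter> C = {a}" "closed_segment v b \<inter> C = {b}"
    and J: "J = closed_segment v a \<union> closed_segment v b \<union> C" "region T = J \<union> inside J"
    using p unfolding pie_cell_def by blast
  have j: "j < n" using p by (rule pie_index)
  note I = independent_cell[OF T, unfolded V]
  have ne: "v \<noteq> a" "v \<noteq> b" "a \<noteq> b" using I(2) by (auto simp: card_insert_if split: if_splits)
  define c where "c = subpath s t (\<gamma> j)"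
  have c: "arc c" "pathstart c = a" "pathfinish c = b"
    using arc_simple_path_subpath[OF simple_arc[OF j], of s t] st ne by (auto simp: c_def)
  have pc: "path_image c = C" using st by (simp add: c_def path_image_subpath)
  have vab: "closed_segment v a \<inter> closed_segment v b = {v}" by (rule segments_meet[OF I])
  have sub: "C \<subseteq> path_image (\<gamma> j)" using st by (auto simp: path_image_def)
  have op: "C - {a, b} \<subseteq> open_arc (\<gamma> j)"
  proof
    fix x assume "x \<in> C - {a, b}"
    then obtain r where r: "r \<in> {s..t}" "x = \<gamma> j r" "x \<noteq> a" "x \<noteq> b" unfolding st(6) by blast
    then have "r \<noteq> s" "r \<noteq> t" using st by auto
    then have "r \<in> {0<..<1}" using st r(1) by auto
    then show "x \<in> open_arc (\<gamma> j)" using r by (auto simp: open_arc_def)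
  qed
  have nonempty: "C - {a, b} \<noteq> {}"
  proof
    assume "C - {a, b} = {}"
    then have "finite C" using finite_subset[of C "{a, b}"] by auto
    moreover have "infinite (path_image c)"
    proof
      assume "finite (path_image c)"
      then have "path_image c = {} \<or> (\<exists>x. path_image c = {x})"
        using connected_finite_iff_sing[OF connected_path_image[OF arc_imp_path[OF c(1)]]] by blast
      moreover have "a \<in> path_image c" "b \<in> path_image c"
        using c pathstart_in_path_image[of c] pathfinish_in_path_image[of c] by auto
      ultimately show False using ne(3) by auto
    qed
    ultimately show False by (simp add: pc)
  qed
  define g where "g = (linepath b v +++ linepath v a) +++ c"
  have "closed_segment b v \<inter> closed_segment v a \<subseteq> {v}" using vab by (auto simp: closed_segment_commute)
  then have arc1: "arc (linepath b v +++ linepath v a)" using ne by (intro arc_join) auto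
  have im: "path_image (linepath b v +++ linepath v a) = closed_segment v a \<union> closed_segment v b"
    by (subst path_image_join) (auto simp: closed_segment_commute)
  have "simple_path g" unfolding g_def
  proof (rule simple_path_join_loop[OF arc1 c(1)])
    have "(closed_segment v a \<union> closed_segment v b) \<inter> C \<subseteq> {b, a}" using C by blast
    then show "path_image (linepath b v +++ linepath v a) \<inter> path_image c
        \<subseteq> {pathstart (linepath b v +++ linepath v a), pathstart c}"
      unfolding im pc by (simp add: c)
  qed (simp_all add: c)
  moreover have "pathfinish g = pathstart g" by (simp add: g_def c)
  moreover have gJ: "path_image g = J" unfolding g_def J(1) by (subst path_image_join) (simp_all add: c im pc)
  ultimately have "enclosed_by (region T) g" using J(2) by (simp add: enclosed_by_def)
  then have "\<exists>g. enclosed_by (region T) g \<and> path_image g = closed_segment v a \<union> closed_segment v b \<union> path_image c"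
    using gJ J(1) pc by blast
  then have "pie_boundary j v T a b c"
    unfolding pie_boundary_def pc by (intro conjI V c sub op nonempty C vab)
  then show ?thesis by blast
qed

lemma pie_boundary_frontier:
  assumes "T \<in> \<T>" "pie j v T" "pie_boundary j v T a b c"
  shows "path_image c \<subseteq> frontier \<Omega>" "a \<in> frontier \<Omega>" "b \<in> frontier \<Omega>" "distinct [v, a, b]"
proof -
  show c: "path_image c \<subseteq> frontier \<Omega>"
    using assms arc_subset_frontier[OF pie_index[OF assms(2)]] by (auto simp: pie_boundary_def)
  then show "a \<in> frontier \<Omega>" "b \<in> frontier \<Omega>"
    using assms(3) pathstart_in_path_image[of c] pathfinish_in_path_image[of c] by (auto simp: pie_boundary_def)
  show "distinct [v, a, b]" using independent_cell(2)[OF assms(1)] assms(3)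
    by (auto simp: pie_boundary_def card_insert_if split: if_splits)
qed

lemma straight_boundary:
  assumes "T \<in> \<T>" "T \<notin> pies n \<gamma> \<T>"
  shows "region T = convex hull (verts T)"
  using not_pie_straight[OF assms] by (simp add: straight_cell_def)

text \<open>The ends of the curved side lie on the frontier and the apex in the open domain, so the
  apex can be recognised without naming the conic.\<close>

lemma pie_vertex_unique:
  assumes "T \<in> \<T>" "pie j v T" "u \<in> verts T"
  shows "u \<in> \<Omega> \<longleftrightarrow> u = v" "u \<in> frontier \<Omega> \<longleftrightarrow> u \<noteq> v"
proof -
  obtain a b c where *: "pie_boundary j v T a b c" using pie_boundary_exists[OF assms(1,2)] by blast
  have "u \<in> {v, a, b}" using assms(3) * by (simp add: pie_boundary_def)
  moreover note pie_boundary_frontier[OF assms(1,2) *] pie_interior_vertex[OF assms(1,2)]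
  ultimately show "u \<in> \<Omega> \<longleftrightarrow> u = v" "u \<in> frontier \<Omega> \<longleftrightarrow> u \<noteq> v" using frontier_disjoint by auto
qed

lemma edgesE:
  assumes T: "T \<in> \<T>" and e: "e \<in> edges T"
  obtains u w where "u \<in> verts T" "w \<in> verts T" "u \<noteq> w" "e = closed_segment u w" "e = convex hull {u, w}"
    "\<And>j v. pie j v T \<Longrightarrow> u = v \<or> w = v"
  using e unfolding straight_edges_def by (auto simp: segment_convex_hull)

lemma edge_verts:
  assumes "T \<in> \<T>" "closed_segment u w \<in> edges T"
  shows "u \<in> verts T" "w \<in> verts T" "u \<noteq> w" "pie j v T \<Longrightarrow> u = v \<or> w = v"
proof -
  obtain u' w' where *: "u' \<in> verts T" "w' \<in> verts T" "u' \<noteq> w'" "closed_segment u w = closed_segment u' w'"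
    "\<And>j v. pie j v T \<Longrightarrow> u' = v \<or> w' = v" using edgesE[OF assms] by metis
  then have "{u, w} = {u', w'}" by simp
  then show "u \<in> verts T" "w \<in> verts T" "u \<noteq> w" "pie j v T \<Longrightarrow> u = v \<or> w = v"
    using * by (auto simp: doubleton_eq_iff)
qed

text \<open>\<open>K\<close> is the rest of the frontier. Its closedness gives every inner point of
  the edge a ball that meets the frontier in the edge alone.\<close>

lemma region_frontier:
  assumes T: "T \<in> \<T>" and e: "closed_segment u w \<in> edges T"
  shows "\<exists>K. closed K \<and> frontier (region T) = closed_segment u w \<union> K \<and> open_segment u w \<inter> K = {}"
proof (cases "T \<in> pies n \<gamma> \<T>")
  case True
  then obtain j v where p: "pie j v T" by (auto simp: pies_iff)
  obtain a b c where B: "pie_boundary j v T a b c" using pie_boundary_exists[OF T p] by blast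
  then obtain g where g: "enclosed_by (region T) g" "path_image g = closed_segment v a \<union> closed_segment v b \<union> path_image c"
    by (auto simp: pie_boundary_def)
  have fr: "frontier (region T) = closed_segment v a \<union> closed_segment v b \<union> path_image c"
    using interior_Un_inside(3)[of g] g by (simp add: enclosed_by_def)
  have cl: "closed (path_image c)" using B by (auto simp: pie_boundary_def intro: closed_arc_image)
  have vs: "verts T = {v, a, b}" using B by (simp add: pie_boundary_def)
  note ev = edge_verts[OF T e]
  have "{u, w} = {v, a} \<or> {u, w} = {v, b}" using ev(1-3) ev(4)[OF p] vs by auto
  then have disj: "closed_segment u w = closed_segment v a \<or> closed_segment u w = closed_segment v b" by auto
  have Bm: "closed_segment v a \<inter> path_image c = {a}" "closed_segment v b \<inter> path_image c = {b}"
    "closed_segment v a \<inter> closed_segment v b = {v}" using B by (auto simp: pie_boundary_def)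
  from disj show ?thesis
  proof
    assume s: "closed_segment u w = closed_segment v a"
    then have "{u, w} = {v, a}" by simp
    then have "open_segment u w = closed_segment v a - {v, a}" by (simp only: open_segment_def s)
    then have "open_segment u w \<inter> (closed_segment v b \<union> path_image c) = {}" using Bm by blast
    moreover have "closed (closed_segment v b \<union> path_image c)" using cl by (intro closed_Un closed_segment)
    moreover have "frontier (region T) = closed_segment u w \<union> (closed_segment v b \<union> path_image c)"
      unfolding fr s by blast
    ultimately show ?thesis by blast
  next
    assume s: "closed_segment u w = closed_segment v b"
    then have "{u, w} = {v, b}" by simp
    then have "open_segment u w = closed_segment v b - {v, b}" by (simp only: open_segment_def s)
    then have "open_segment u w \<inter> (closed_segment v a \<union> path_image c) = {}" using Bm by blast
    moreover have "closed (closed_segment v a \<union> path_image c)" using cl by (intro closed_Un closed_segment)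
    moreover have "frontier (region T) = closed_segment u w \<union> (closed_segment v a \<union> path_image c)"
      unfolding fr s by blast
    ultimately show ?thesis by blast
  qed
next
  case False
  have r: "region T = convex hull (verts T)" by (rule straight_boundary[OF T False])
  note ev = edge_verts[OF T e]
  obtain z where V: "verts T = {u, w, z}"
  proof -
    have "card (verts T - {u, w}) = 1" using independent_cell[OF T] ev by (simp add: card_Diff_subset)
    then obtain z where "verts T - {u, w} = {z}" by (auto simp: card_1_singleton_iff)
    then have "verts T = {u, w, z}" using ev by auto
    then show ?thesis by (rule that)
  qed
  note I = independent_cell[OF T, unfolded V]
  have I': "independent_verts {w, u, z}" "card {w, u, z} = 3" using I by (simp_all add: insert_commute)
  have "closed_segment u w \<inter> closed_segment u z = {u}" "closed_segment w u \<inter> closed_segment w z = {w}"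
    by (rule segments_meet[OF I] segments_meet[OF I'])+
  then have "open_segment u w \<inter> (closed_segment w z \<union> closed_segment z u) = {}"
    unfolding open_segment_def closed_segment_commute[of z u] closed_segment_commute[of w u] by blast
  then show ?thesis unfolding r frontier_triangle_edges[OF V]
    by (intro exI[of _ "closed_segment w z \<union> closed_segment z u"]) auto
qed

lemma region_regular:
  assumes T: "T \<in> \<T>"
  shows "closed (region T)" "closure (interior (region T)) = region T" "interior (region T) \<noteq> {}"
    "verts T \<subseteq> region T" "compact (region T)" "region T \<subseteq> closure \<Omega>" "interior (region T) \<subseteq> \<Omega>"
proof -
  have "closed (region T) \<and> closure (interior (region T)) = region T \<and> verts T \<subseteq> region T"
  proof (cases "T \<in> pies n \<gamma> \<T>")
    case True
    then obtain j v where p: "pie j v T" by (auto simp: pies_iff)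
    obtain a b c where B: "pie_boundary j v T a b c" using pie_boundary_exists[OF T p] by blast
    then obtain g where g: "enclosed_by (region T) g" "path_image g = closed_segment v a \<union> closed_segment v b \<union> path_image c"
      by (auto simp: pie_boundary_def)
    have "verts T \<subseteq> path_image g" using B g(2) by (auto simp: pie_boundary_def)
    then show ?thesis using interior_Un_inside[of g] g(1) by (auto simp: enclosed_by_def)
  next
    case False
    have r: "region T = convex hull (verts T)" by (rule straight_boundary[OF T False])
    have fin: "finite (verts T)" using independent_cell[OF T] by (simp add: independent_verts_def)
    have cl: "closed (convex hull (verts T))"
      using fin by (simp add: compact_imp_closed finite_imp_compact_convex_hull)
    have "interior (convex hull (verts T)) \<noteq> {}"
      using independent_cell[OF T] interior_convex_hull_eq_empty[of "verts T"] by (simp add: independent_verts_def)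
    then have "closure (interior (convex hull (verts T))) = convex hull (verts T)"
      using cl by (simp add: convex_closure_interior)
    then show ?thesis using cl by (simp add: r hull_subset)
  qed
  then show *: "closed (region T)" "closure (interior (region T)) = region T" "verts T \<subseteq> region T" by auto
  show "interior (region T) \<noteq> {}" using * independent_cell[OF T] by (auto simp: independent_verts_def)
  show sub: "region T \<subseteq> closure \<Omega>" using mesh_cover T by blast
  then show "compact (region T)"
    using *(1) bounded_domain bounded_closure bounded_subset compact_eq_bounded_closed by metis
  show "interior (region T) \<subseteq> \<Omega>"
    using interior_mono[OF sub] interior_closure_domain by simp
qed

lemma edge_subset_region: "T \<in> \<T> \<Longrightarrow> e \<in> edges T \<Longrightarrow> e \<subseteq> frontier (region T)"
  and edge_subset_region': "T \<in> \<T> \<Longrightarrow> e \<in> edges T \<Longrightarrow> e \<subseteq> region T"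
proof -
  assume T: "T \<in> \<T>" "e \<in> edges T"
  then obtain u w where "e = closed_segment u w" by (rule edgesE)
  then show "e \<subseteq> frontier (region T)" using region_frontier[OF T(1), of u w] T(2) by auto
  then show "e \<subseteq> region T" using region_regular(1)[OF T(1)] frontier_subset_closed by blast
qed

lemma edge_ball:
  assumes T: "T \<in> \<T>" and e: "closed_segment u w \<in> edges T" and x: "x \<in> open_segment u w"
  shows "\<exists>\<epsilon>>0. ball x \<epsilon> \<inter> frontier (region T) \<subseteq> closed_segment u w"
proof -
  obtain K where K: "closed K" "frontier (region T) = closed_segment u w \<union> K" "open_segment u w \<inter> K = {}"
    using region_frontier[OF T e] by blast
  then have "x \<in> - K" "open (- K)" using x by auto
  then obtain \<epsilon> where "0 < \<epsilon>" "ball x \<epsilon> \<subseteq> - K" by (auto simp: open_contains_ball)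
  then show ?thesis using K(2) by blast
qed

text \<open>The vertex and edge cases in one form, as the hull of a common face \<open>F\<close>, to
  which the facts on restrictions to faces apply.\<close>

lemma mesh_Int:
  assumes "T \<in> \<T>" "T' \<in> \<T>" "T \<noteq> T'" "region T \<inter> region T' \<noteq> {}"
  shows "\<exists>F. F \<subseteq> verts T \<inter> verts T' \<and> F \<noteq> {} \<and> region T \<inter> region T' = convex hull F \<and>
    (card F = 1 \<or> card F = 2 \<and> convex hull F \<in> edges T \<inter> edges T')"
proof -
  have "(\<exists>u \<in> verts T \<inter> verts T'. region T \<inter> region T' = {u}) \<or>
        region T \<inter> region T' \<in> edges T \<inter> edges T'"
    using mesh assms unfolding conic_triangulation_def by blast
  then show ?thesis
  proof
    assume "\<exists>u \<in> verts T \<inter> verts T'. region T \<inter> region T' = {u}"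
    then obtain u where "u \<in> verts T \<inter> verts T'" "region T \<inter> region T' = {u}" by blast
    then show ?thesis by (intro exI[of _ "{u}"]) auto
  next
    assume e: "region T \<inter> region T' \<in> edges T \<inter> edges T'"
    then obtain u w where *: "u \<in> verts T" "w \<in> verts T" "u \<noteq> w" "region T \<inter> region T' = closed_segment u w"
      "region T \<inter> region T' = convex hull {u, w}" using edgesE[OF assms(1)] by (metis IntD1)
    have "closed_segment u w \<in> edges T'" using e *(4) by auto
    then have "u \<in> verts T'" "w \<in> verts T'" using edge_verts[OF assms(2)] by auto
    then show ?thesis using * e by (intro exI[of _ "{u, w}"]) auto
  qed
qed

lemma mesh_Int_empty_interior:
  assumes "T \<in> \<T>" "T' \<in> \<T>" "T \<noteq> T'"
  shows "interior (region T \<inter> region T') = {}"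
proof (cases "region T \<inter> region T' = {}")
  case False
  then obtain F where F: "region T \<inter> region T' = convex hull F" "card F = 1 \<or> card F = 2"
    using mesh_Int[OF assms] by blast
  then have "finite F" "card F \<le> DIM(complex)" by (auto intro: card_ge_0_finite)
  then show ?thesis unfolding F(1) by (rule empty_interior_convex_hull)
qed simp

text \<open>A second cell meeting the open edge would share all of it, and the two cells would fill
  a neighbourhood of \<open>x\<close>, against \<open>x \<in> frontier \<Omega>\<close>. So the edge
  belongs to one cell only, and no inner point of it can lie in the open domain.\<close>

lemma edge_frontier:
  assumes T: "T \<in> \<T>" and e: "closed_segment u w \<in> edges T" and x: "x \<in> open_segment u w" "x \<in> frontier \<Omega>"
  shows "closed_segment u w \<subseteq> frontier \<Omega>"
proof -
  have uw: "u \<noteq> w" using edge_verts[OF T e] by blast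
  have os: "open_segment u w \<subseteq> region T" using edge_subset_region'[OF T e] by (auto simp: open_segment_def)
  have sole: "y \<notin> region T'" if T': "T' \<in> \<T>" "T' \<noteq> T" and y: "y \<in> open_segment u w" for T' y
  proof
    assume "y \<in> region T'"
    then have ne: "region T \<inter> region T' \<noteq> {}" using os y by blast
    obtain F where F: "F \<subseteq> verts T \<inter> verts T'" "region T \<inter> region T' = convex hull F"
      "card F = 1 \<or> card F = 2 \<and> convex hull F \<in> edges T \<inter> edges T'"
      using mesh_Int[OF T T'(1) _ ne] T'(2) by metis
    have yF: "y \<in> convex hull F" using F(2) os y \<open>y \<in> region T'\<close> by blast
    \<comment> \<open>The common face contains the inner point \<open>y\<close> of the edge, so both
      ends of the edge belong to it.\<close>
    have cF: "closed_segment u w = convex hull F"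
    proof -
      note V = independent_cell[OF T]
      have uwV: "{u, w} \<subseteq> verts T" using edge_verts[OF T e] by auto
      have F0: "F \<noteq> {}" "F \<subseteq> verts T" using F by auto
      have yc: "y \<in> closed_segment u w" "y \<noteq> u" "y \<noteq> w" using y by (auto simp: open_segment_def)
      have yuw: "y \<in> convex hull {u, w}" using yc by (simp add: segment_convex_hull)
      have yV: "y \<in> convex hull (verts T)" using yuw hull_mono[OF uwV] by blast
      have "u \<in> F"
      proof (rule ccontr)
        assume "u \<notin> F"
        then have "bary (verts T) u y = 0" using yF in_convex_hull_face[OF V(1) F0(2,1) yV] uwV by auto
        then have "y \<in> convex hull {w}" using in_convex_hull_face[OF V(1) _ _ yV, of "{w}"]
          in_convex_hull_face[OF V(1) uwV _ yV] yuw uwV by auto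
        then show False using yc by simp
      qed
      moreover have "w \<in> F"
      proof (rule ccontr)
        assume "w \<notin> F"
        then have "bary (verts T) w y = 0" using yF in_convex_hull_face[OF V(1) F0(2,1) yV] uwV by auto
        then have "y \<in> convex hull {u}" using in_convex_hull_face[OF V(1) _ _ yV, of "{u}"]
          in_convex_hull_face[OF V(1) uwV _ yV] yuw uwV by auto
        then show False using yc by simp
      qed
      ultimately have "{u, w} \<subseteq> F" by simp
      moreover have "card F \<le> card {u, w}" using F(3) uw by auto
      moreover have "finite F" using F(3) by (auto intro: card_ge_0_finite)
      ultimately have "F = {u, w}" using card_seteq[of F "{u, w}"] by simp
      then show ?thesis by (simp add: segment_convex_hull)
    qed
    then have e': "closed_segment u w \<in> edges T'"
    proof -
      have "card F \<noteq> 1"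
      proof
        assume "card F = 1"
        then obtain z where "F = {z}" by (auto simp: card_1_singleton_iff)
        then have "closed_segment u w = {z}" using cF by simp
        then show False using uw by (metis ends_in_segment singletonD)
      qed
      then show ?thesis using F(3) cF by auto
    qed
    obtain r where r: "0 < r" "ball x r \<inter> frontier (region T) \<subseteq> closed_segment u w"
      using edge_ball[OF T e x(1)] by blast
    obtain r' where r': "0 < r'" "ball x r' \<inter> frontier (region T') \<subseteq> closed_segment u w"
      using edge_ball[OF T'(1) e' x(1)] by blast
    have xc: "x \<in> closed_segment u w" using x(1) by (simp add: open_segment_def)
    have "x \<in> interior (region T \<union> region T')"
    proof (rule edge_interior_Un[OF _ _ _ _ uw xc _ _ _ r r'])
      show "interior (region T) \<inter> interior (region T') \<subseteq> closed_segment u w"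
        using F(2) cF interior_subset by blast
      show "x \<in> region T" "x \<in> region T'" using xc F(2) cF by auto
    qed (use region_regular[OF T] region_regular[OF T'(1)] in auto)
    also have "\<dots> \<subseteq> interior (closure \<Omega>)"
      using region_regular(6)[OF T] region_regular(6)[OF T'(1)] by (intro interior_mono) auto
    finally show False using x(2) interior_closure_domain frontier_disjoint by auto
  qed
  have "y \<in> frontier \<Omega>" if y: "y \<in> open_segment u w" for y
  proof (rule ccontr)
    assume yn: "y \<notin> frontier \<Omega>"
    have "y \<in> closure \<Omega>" using os y region_regular(6)[OF T] by blast
    then have "y \<in> \<Omega>" using yn open_domain by (auto simp: frontier_def interior_open)
    \<comment> \<open>Away from the finitely many other cells, the domain near \<open>y\<close> is
      covered by \<open>T\<close> alone, which would make \<open>y\<close> interior to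
      \<open>T\<close>.\<close>
    define N where "N = \<Omega> - (\<Union>T'\<in>\<T> - {T}. region T')"
    have "closed (\<Union>T'\<in>\<T> - {T}. region T')" using finite_mesh region_regular(1) by (intro closed_UN) auto
    then have "open N" unfolding N_def using open_domain by (intro open_Diff)
    moreover have "y \<in> N" using sole y \<open>y \<in> \<Omega>\<close> by (auto simp: N_def)
    moreover have "N \<subseteq> region T" using mesh_cover closure_subset by (fastforce simp: N_def)
    ultimately have "y \<in> interior (region T)" by (meson interior_maximal subsetD)
    moreover have "y \<in> frontier (region T)" using edge_subset_region[OF T e] y by (auto simp: open_segment_def)
    ultimately show False by (simp add: frontier_def)
  qed
  then have "closure (open_segment u w) \<subseteq> frontier \<Omega>" by (intro closure_minimal) auto
  then show ?thesis using uw by simp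
qed

end

section \<open>Pie-shaped cells at the boundary and pairs of them with a common edge\<close>

context conic_mesh
begin

lemma pie_boundaryD:
  assumes "pie_boundary j v T a b c"
  shows "verts T = {v, a, b}" "arc c" "pathstart c = a" "pathfinish c = b"
    "path_image c \<subseteq> path_image (\<gamma> j)" "path_image c - {a, b} \<subseteq> open_arc (\<gamma> j)" "path_image c - {a, b} \<noteq> {}"
    "closed_segment v a \<inter> path_image c = {a}" "closed_segment v b \<inter> path_image c = {b}"
    "closed_segment v a \<inter> closed_segment v b = {v}"
    "\<exists>g. enclosed_by (region T) g \<and> path_image g = closed_segment v a \<union> closed_segment v b \<union> path_image c"
  using assms unfolding pie_boundary_def by - (elim conjE, assumption)+

lemma pie_vertex_in_verts: "pie j v T \<Longrightarrow> v \<in> verts T"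
  by (auto simp: pie_cell_def)

lemma pie_apex_unique: "T \<in> \<T> \<Longrightarrow> pie j v T \<Longrightarrow> pie j' v' T \<Longrightarrow> v = v'"
  using pie_vertex_unique(1)[of T j v v'] pie_vertex_in_verts[of j' v' T] pie_interior_vertex[of T j' v'] by auto

lemma pie_edge:
  assumes "T \<in> \<T>" "pie j v T" "a \<in> verts T" "a \<noteq> v"
  shows "closed_segment v a \<in> edges T"
  unfolding straight_edges_def
  using assms pie_vertex_in_verts[OF assms(2)] pie_apex_unique[OF assms(1,2)] by blast

text \<open>An inner point of the edge on the frontier would put the whole edge there, including the
  apex.\<close>

lemma pie_edge_frontier:
  assumes T: "T \<in> \<T>" and p: "pie j v T" and a: "a \<in> verts T" "a \<noteq> v"
  shows "closed_segment v a \<inter> frontier \<Omega> = {a}"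
proof -
  have e: "closed_segment v a \<in> edges T" by (rule pie_edge[OF assms])
  have "v \<in> \<Omega>" by (rule pie_interior_vertex[OF T p])
  then have v: "v \<notin> frontier \<Omega>" using frontier_disjoint by blast
  have "x \<notin> frontier \<Omega>" if "x \<in> open_segment v a" for x
  proof
    assume "x \<in> frontier \<Omega>"
    then have "closed_segment v a \<subseteq> frontier \<Omega>" using edge_frontier[OF T e that] by blast
    then show False using v by auto
  qed
  moreover have "a \<in> frontier \<Omega>" using pie_vertex_unique(2)[OF T p a(1)] a(2) by blast
  ultimately show ?thesis using v by (auto simp: open_segment_def)
qed

text \<open>Interior points of the cell lie in the open domain, and the straight sides touch the
  frontier only at the ends of the curved side.\<close>

lemma pie_region_frontier:
  assumes T: "T \<in> \<T>" and p: "pie j v T" and B: "pie_boundary j v T a b c"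
  shows "region T \<inter> frontier \<Omega> = path_image c"
proof -
  obtain g where g: "enclosed_by (region T) g" "path_image g = closed_segment v a \<union> closed_segment v b \<union> path_image c"
    using B by (auto simp: pie_boundary_def)
  have V: "verts T = {v, a, b}" using B by (simp add: pie_boundary_def)
  note d = pie_boundary_frontier[OF T p B]
  define I where "I = interior (region T)"
  have reg: "region T = (closed_segment v a \<union> closed_segment v b \<union> path_image c) \<union> I"
    using g interior_Un_inside(1)[of g] by (simp add: enclosed_by_def I_def)
  have "I \<inter> frontier \<Omega> = {}" using region_regular(7)[OF T] frontier_disjoint unfolding I_def by blast
  moreover have "closed_segment v a \<inter> frontier \<Omega> = {a}" "closed_segment v b \<inter> frontier \<Omega> = {b}"
    using pie_edge_frontier[OF T p] V d(4) by auto
  moreover have "a \<in> path_image c" "b \<in> path_image c" using B by (auto simp: pie_boundary_def)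
  moreover have "path_image c \<inter> frontier \<Omega> = path_image c" using d(1) by blast
  ultimately have "region T \<inter> frontier \<Omega> = {a} \<union> {b} \<union> path_image c \<union> {}"
    unfolding reg Int_Un_distrib2 by (simp only:)
  then show ?thesis using \<open>a \<in> path_image c\<close> \<open>b \<in> path_image c\<close> by auto
qed

text \<open>A cell stores neither apex nor conic. Its curved side is
  \<open>region T \<inter> frontier \<Omega>\<close> whatever witnesses are chosen, and an inner
  point of it lies on only one open arc. This justifies the descriptions in
  \<open>conic_index\<close> and \<open>apex\<close>.\<close>

lemma pie_unique:
  assumes T: "T \<in> \<T>" and p: "pie j v T" and p': "pie j' v' T"
  shows "j = j'" "v = v'"
proof -
  show v: "v = v'" by (rule pie_apex_unique[OF assms])
  obtain a b c where B: "pie_boundary j v T a b c" using pie_boundary_exists[OF T p] by blast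
  obtain a' b' c' where B': "pie_boundary j' v' T a' b' c'" using pie_boundary_exists[OF T p'] by blast
  obtain z where z: "z \<in> path_image c" "z \<notin> {a, b}" "z \<in> open_arc (\<gamma> j)"
    using pie_boundaryD(6,7)[OF B] by blast
  note V = pie_boundaryD(1)[OF B] pie_boundaryD(1)[OF B']
  have nv: "v \<notin> {a, b}" "v' \<notin> {a', b'}"
    using pie_boundary_frontier(4)[OF T p B] pie_boundary_frontier(4)[OF T p' B'] by simp_all
  have "{a, b} = verts T - {v}" using nv(1) by (subst V(1)) blast
  moreover have "{a', b'} = verts T - {v'}" using nv(2) by (subst V(2)) blast
  ultimately have "{a, b} = {a', b'}" using v by simp
  moreover have "z \<in> path_image c'"
    using z(1) pie_region_frontier[OF T p B] pie_region_frontier[OF T p' B'] by blast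
  ultimately have "z \<in> open_arc (\<gamma> j')" using z(2) pie_boundaryD(6)[OF B'] by blast
  then show "j = j'" using open_arcs_disjoint[OF pie_index[OF p] pie_index[OF p']] z(3) by blast
qed

lemma pie_boundary_sym: "pie_boundary j v T a b c \<Longrightarrow> pie_boundary j v T b a (reversepath c)"
  unfolding pie_boundary_def
  by (simp add: arc_reversepath insert_commute Int_commute Un_commute Un_left_commute Un_assoc)

lemma pie_boundary_from:
  assumes T: "T \<in> \<T>" and p: "pie j v T" and a: "a \<in> verts T" "a \<noteq> v"
  shows "\<exists>b c. pie_boundary j v T a b c"
proof -
  obtain a' b c where B: "pie_boundary j v T a' b c" using pie_boundary_exists[OF T p] by blast
  have "a = a' \<or> a = b" using a pie_boundaryD(1)[OF B] by auto
  then show ?thesis using B pie_boundary_sym[OF B] by auto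
qed

lemma straight_edge:
  assumes "T \<in> \<T>" "T \<notin> pies n \<gamma> \<T>" "u \<in> verts T" "w \<in> verts T" "u \<noteq> w"
  shows "closed_segment u w \<in> edges T"
  using assms unfolding straight_edges_def pies_iff by blast

text \<open>Not being interior to the cell, \<open>x\<close> has a vertex or an edge as smallest
  face; for an edge \<open>edge_frontier\<close> applies. Boundary conditions thus become conditions
  on whole faces.\<close>

lemma straight_region_frontier:
  assumes T: "T \<in> \<T>" "T \<notin> pies n \<gamma> \<T>" and x: "x \<in> region T" "x \<in> frontier \<Omega>"
  shows "convex hull {u\<in>verts T. 0 < bary (verts T) u x} \<subseteq> frontier \<Omega>"
proof -
  note V = independent_cell[OF T(1)]
  have fin: "finite (verts T)" using V by (simp add: independent_verts_def)
  have r: "region T = convex hull (verts T)" by (rule straight_boundary[OF T])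
  have xV: "x \<in> convex hull (verts T)" using x(1) r by simp
  define F where "F = {u\<in>verts T. 0 < bary (verts T) u x}"
  note pf = positive_face[OF V(1) xV, folded F_def]
  have sub: "F \<subseteq> verts T" by (auto simp: F_def)
  have "F \<noteq> verts T"
  proof
    assume "F = verts T"
    then have "x \<in> interior (region T)" unfolding r
      by (intro interior_triangle[OF V xV]) (auto simp: F_def)
    then show False using region_regular(7)[OF T(1)] x(2) frontier_disjoint by blast
  qed
  then have "card F < 3" using psubset_card_mono[OF fin, of F] sub V(2) by auto
  moreover have "card F \<noteq> 0" using pf(1) finite_subset[OF sub fin] by auto
  ultimately consider "card F = 1" | "card F = 2" by linarith
  then have "convex hull F \<subseteq> frontier \<Omega>"
  proof cases
    case 1
    then obtain u where "F = {u}" by (auto simp: card_1_singleton_iff)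
    then show ?thesis using pf(2) x(2) by simp
  next
    case 2
    then obtain u w where uw: "F = {u, w}" "u \<noteq> w" by (auto simp: card_2_iff)
    have uwV: "u \<in> verts T" "w \<in> verts T" using sub uw by auto
    have "0 < bary (verts T) u x" "0 < bary (verts T) w x" using uw by (auto simp: F_def)
    then have "x \<noteq> u" "x \<noteq> w" using bary_vertex[OF V(1) uwV(1), of w] bary_vertex[OF V(1) uwV(2), of u] uw(2) by auto
    then have "x \<in> open_segment u w" using pf(2) uw by (auto simp: open_segment_def segment_convex_hull)
    from edge_frontier[OF T(1) straight_edge[OF T uwV uw(2)] this x(2)]
    show ?thesis by (simp add: uw(1) segment_convex_hull)
  qed
  then show ?thesis by (simp add: F_def)
qed

text \<open>The arcs of two pies sharing the edge \<open>[v, a]\<close> form one boundary arc from \<open>b1\<close> to \<open>b2\<close>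
  through \<open>a\<close>. The crosscut through \<open>v\<close> splits the domain, and by the theta curve theorem the part
  near \<open>a\<close> is filled by the two pies, which leaves no room for a third cell at \<open>a\<close>.\<close>

lemma no_third_cell_at_corner:
  assumes T1: "T1 \<in> \<T>" and p1: "pie j1 v T1" and B1: "pie_boundary j1 v T1 a b1 c1"
    and T2: "T2 \<in> \<T>" and p2: "pie j2 v T2" and B2: "pie_boundary j2 v T2 a b2 c2"
    and X: "region T1 \<inter> region T2 = closed_segment v a"
    and T3: "T3 \<in> \<T>" "T3 \<noteq> T1" "T3 \<noteq> T2" "a \<in> verts T3"
  shows False
proof -
  obtain g where g: "simple_path g" "pathfinish g = pathstart g" "path_image g = frontier \<Omega>"
    by (rule frontier_loop)
  have ins: "inside (frontier \<Omega>) = \<Omega>"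
    using Jordan_domain_eq_inside[OF open_domain connected_domain bounded_domain domain_nonempty g(1,2)] g(3) by simp
  have v: "v \<in> \<Omega>" by (rule pie_interior_vertex[OF T1 p1])
  note V1 = pie_boundaryD(1)[OF B1] and V2 = pie_boundaryD(1)[OF B2]
  note f1 = pie_boundary_frontier[OF T1 p1 B1] and f2 = pie_boundary_frontier[OF T2 p2 B2]
  note arcs = pie_boundaryD(2-4)[OF B1] pie_boundaryD(2-4)[OF B2]
  define C1 C2 where "C1 = path_image c1" and "C2 = path_image c2"
  have aC: "a \<in> C1" "b1 \<in> C1" "a \<in> C2" "b2 \<in> C2"
    using arcs pathstart_in_path_image[of c1] pathfinish_in_path_image[of c1]
      pathstart_in_path_image[of c2] pathfinish_in_path_image[of c2] by (auto simp: C1_def C2_def)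
  have m: "closed_segment v a \<inter> C1 = {a}" "closed_segment v b1 \<inter> C1 = {b1}" "closed_segment v a \<inter> closed_segment v b1 = {v}"
    "closed_segment v a \<inter> C2 = {a}" "closed_segment v b2 \<inter> C2 = {b2}" "closed_segment v a \<inter> closed_segment v b2 = {v}"
    unfolding C1_def C2_def by (fact pie_boundaryD(8-10)[OF B1] pie_boundaryD(8-10)[OF B2])+
  have sf: "closed_segment v a \<inter> frontier \<Omega> = {a}" "closed_segment v b1 \<inter> frontier \<Omega> = {b1}" "closed_segment v b2 \<inter> frontier \<Omega> = {b2}"
    using pie_edge_frontier[OF T1 p1] pie_edge_frontier[OF T2 p2] V1 V2 f1(4) f2(4) by auto
  obtain g1 where g1: "enclosed_by (region T1) g1" "path_image g1 = closed_segment v a \<union> closed_segment v b1 \<union> C1"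
    using pie_boundaryD(11)[OF B1] unfolding C1_def by blast
  obtain g2 where g2: "enclosed_by (region T2) g2" "path_image g2 = closed_segment v a \<union> closed_segment v b2 \<union> C2"
    using pie_boundaryD(11)[OF B2] unfolding C2_def by blast
  have r1: "region T1 = path_image g1 \<union> inside (path_image g1)" and r2: "region T2 = path_image g2 \<union> inside (path_image g2)"
    using g1 g2 by (auto simp: enclosed_by_def)
  have sub1: "closed_segment v b1 \<union> C1 \<subseteq> region T1" and sub2: "closed_segment v b2 \<union> C2 \<subseteq> region T2"
    using r1 r2 g1(2) g2(2) by auto
  have Cfr: "C1 \<subseteq> frontier \<Omega>" "C2 \<subseteq> frontier \<Omega>" using f1(1) f2(1) by (auto simp: C1_def C2_def)
  have C12: "C1 \<inter> C2 = {a}"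
  proof
    have "C1 \<inter> C2 \<subseteq> region T1 \<inter> region T2" using sub1 sub2 by blast
    then have "C1 \<inter> C2 \<subseteq> closed_segment v a \<inter> C1" unfolding X by blast
    then show "C1 \<inter> C2 \<subseteq> {a}" unfolding m(1) .
  qed (use aC in blast)
  have nd: "b1 \<noteq> a" "b2 \<noteq> a" "v \<noteq> a" "v \<noteq> b1" "v \<noteq> b2" using f1(4) f2(4) by auto
  have b12: "b1 \<noteq> b2"
  proof
    assume "b1 = b2"
    then have "b1 \<in> C1 \<inter> C2" using aC by simp
    then show False unfolding C12 using nd(1) by simp
  qed
  have vb: "closed_segment v b1 \<inter> closed_segment v b2 = {v}"
  proof
    have "closed_segment v b1 \<inter> closed_segment v b2 \<subseteq> region T1 \<inter> region T2" using sub1 sub2 by blast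
    then have "closed_segment v b1 \<inter> closed_segment v b2 \<subseteq> closed_segment v a \<inter> closed_segment v b1" unfolding X by blast
    then show "closed_segment v b1 \<inter> closed_segment v b2 \<subseteq> {v}" unfolding m(3) .
  qed simp
  \<comment> \<open>The crosscut from \<open>b1\<close> through the apex to
    \<open>b2\<close>.\<close>
  define x where "x = linepath b1 v +++ linepath v b2"
  have x: "arc x" "pathstart x = b1" "pathfinish x = b2"
    unfolding x_def using nd vb by (simp_all add: closed_segment_commute[of b1 v] arc_join)
  have xi: "path_image x = closed_segment v b1 \<union> closed_segment v b2"
    unfolding x_def by (subst path_image_join) (auto simp: closed_segment_commute)
  have xfr: "path_image x \<inter> frontier \<Omega> = {b1, b2}" unfolding xi Int_Un_distrib2 sf(2,3) by blast
  \<comment> \<open>The two curved sides joined at \<open>a\<close>; they turn out to be one of the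
    two boundary arcs between \<open>b1\<close> and \<open>b2\<close>.\<close>
  define D where "D = reversepath c1 +++ c2"
  have D: "arc D" "pathstart D = b1" "pathfinish D = b2"
    unfolding D_def using arcs C12 by (simp_all add: C1_def C2_def arc_reversepath arc_join)
  have Di: "path_image D = C1 \<union> C2"
    unfolding D_def by (subst path_image_join) (auto simp: arcs C1_def C2_def)
  have "\<exists>u d. arc u \<and> arc d \<and> pathstart u = b1 \<and> pathfinish u = b2 \<and> pathstart d = b1 \<and> pathfinish d = b2 \<and>
      path_image u \<inter> path_image d = {b1, b2} \<and> path_image u \<union> path_image d = frontier \<Omega> \<and> path_image u \<subseteq> path_image D"
  proof -
    have mem: "b1 \<in> path_image g" "b2 \<in> path_image g" using f1(3) f2(3) g(3) by simp_all
    obtain u d where ud: "arc u" "arc d" "pathstart u = b1" "pathfinish u = b2" "pathstart d = b2" "pathfinish d = b1"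
      "path_image u \<inter> path_image d = {b1, b2}" "path_image u \<union> path_image d = frontier \<Omega>"
      by (rule exists_double_arc[OF g(1,2) mem b12, unfolded g(3)])
    \<comment> \<open>The connected set \<open>D\<close> contains both \<open>b1\<close> and
      \<open>b2\<close> and lies in the closed curve, so it covers one of the two arcs; that arc is
      called \<open>u\<close> from here on.\<close>
    have "path_image u \<subseteq> path_image D \<or> path_image d \<subseteq> path_image D"
    proof (rule connected_subset_double_arc[OF ud(1,3,4) ud(2,5,6,7)])
      show "connected (path_image D)" using D(1) by (simp add: arc_imp_path connected_path_image)
      show "path_image D \<subseteq> path_image u \<union> path_image d" using Di Cfr ud(8) by simp
      show "b1 \<in> path_image D" "b2 \<in> path_image D" using Di aC by auto
    qed
    then show ?thesis
    proof
      assume "path_image u \<subseteq> path_image D"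
      then show ?thesis using ud
        by (intro exI[of _ u] exI[of _ "reversepath d"]) (simp add: arc_reversepath)
    next
      assume "path_image d \<subseteq> path_image D"
      then show ?thesis using ud
        by (intro exI[of _ "reversepath d"] exI[of _ u]) (simp add: arc_reversepath Int_commute Un_commute)
    qed
  qed
  then obtain u d where ud: "arc u" "arc d" "pathstart u = b1" "pathfinish u = b2" "pathstart d = b1" "pathfinish d = b2"
      "path_image u \<inter> path_image d = {b1, b2}" "path_image u \<union> path_image d = frontier \<Omega>" "path_image u \<subseteq> path_image D"
    by blast
  have "path_image u = path_image D"
  proof (rule connected_subset_arc_eq[OF D(1) _ ud(9)])
    show "connected (path_image u)" using ud(1) by (simp add: arc_imp_path connected_path_image)
    show "pathstart D \<in> path_image u" "pathfinish D \<in> path_image u"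
      using D ud pathstart_in_path_image[of u] pathfinish_in_path_image[of u] by auto
  qed
  then have ui: "path_image u = C1 \<union> C2" using Di by simp
  have bx: "b1 \<in> path_image x" "b2 \<in> path_image x" by (auto simp: xi)
  have bu: "b1 \<in> path_image u" "b2 \<in> path_image u" "b1 \<in> path_image d" "b2 \<in> path_image d"
    using ud(3-6) pathstart_in_path_image[of u] pathfinish_in_path_image[of u]
      pathstart_in_path_image[of d] pathfinish_in_path_image[of d] by simp_all
  \<comment> \<open>First theta curve: the domain is cut by the crosscut.\<close>
  have split1: "inside (path_image u \<union> path_image x) \<union> inside (path_image d \<union> path_image x) \<union> (path_image x - {b1, b2}) = \<Omega>"
  proof -
    have "path_image u \<inter> path_image x \<subseteq> path_image x \<inter> frontier \<Omega>" "path_image d \<inter> path_image x \<subseteq> path_image x \<inter> frontier \<Omega>"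
      unfolding ud(8)[symmetric] by blast+
    then have ux: "path_image u \<inter> path_image x = {b1, b2}" "path_image d \<inter> path_image x = {b1, b2}"
      unfolding xfr using bx bu by blast+
    have "v \<in> path_image x \<inter> inside (path_image u \<union> path_image d)"
      using v ins ud(8) by (simp add: xi)
    then have ne: "path_image x \<inter> inside (path_image u \<union> path_image d) \<noteq> {}" by blast
    show ?thesis
      by (rule split_inside_simple_closed_curve[OF arc_imp_simple_path[OF ud(1)] ud(3,4)
          arc_imp_simple_path[OF ud(2)] ud(5,6) arc_imp_simple_path[OF x(1)] x(2,3) b12 ud(7) ux ne])
        (simp only: ud(8) ins)
  qed
  \<comment> \<open>The point \<open>a\<close> has positive distance from the crosscut and from the
    part beyond it, so near \<open>a\<close> the domain is the part bounded by \<open>u\<close> and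
    the crosscut.\<close>
  have a_out: "a \<notin> closure (inside (path_image d \<union> path_image x)) \<union> path_image x"
  proof -
    have cl: "closed (path_image d \<union> path_image x)" using ud(2) x(1) by (simp add: closed_Un closed_arc_image)
    have afr: "a \<in> frontier \<Omega>" by (rule f1(2))
    have "a \<notin> path_image x"
    proof
      assume "a \<in> path_image x"
      then have "a \<in> path_image x \<inter> frontier \<Omega>" using afr by blast
      then show False unfolding xfr using nd by simp
    qed
    moreover have "a \<notin> path_image d"
    proof
      assume "a \<in> path_image d"
      then have "a \<in> path_image u \<inter> path_image d" using ui aC by blast
      then show False unfolding ud(7) using nd by simp
    qed
    moreover have "a \<notin> inside (path_image d \<union> path_image x)" using split1 frontier_disjoint[OF afr] by blast
    ultimately show ?thesis
      using frontier_inside_subset[OF cl] closure_Un_frontier[of "inside (path_image d \<union> path_image x)"] by blast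
  qed
  have "open (- (closure (inside (path_image d \<union> path_image x)) \<union> path_image x))"
    using x(1) by (intro open_Compl closed_Un closed_closure closed_arc_image)
  then obtain \<epsilon> where e: "0 < \<epsilon>" "ball a \<epsilon> \<subseteq> - (closure (inside (path_image d \<union> path_image x)) \<union> path_image x)"
    by (rule openE) (use a_out in blast)
  have near: "y \<in> inside (path_image u \<union> path_image x)" if "y \<in> ball a \<epsilon>" "y \<in> \<Omega>" for y
    using that e(2) split1 closure_subset[of "inside (path_image d \<union> path_image x)"] by blast
  define y1 where "y1 = linepath v b1 +++ reversepath c1"
  define y2 where "y2 = linepath v b2 +++ reversepath c2"
  have y1: "arc y1" "pathstart y1 = v" "pathfinish y1 = a"
    unfolding y1_def using arcs m(2) nd by (simp_all add: C1_def arc_reversepath arc_join)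
  have y2: "arc y2" "pathstart y2 = v" "pathfinish y2 = a"
    unfolding y2_def using arcs m(5) nd by (simp_all add: C2_def arc_reversepath arc_join)
  have yi: "path_image y1 = closed_segment v b1 \<union> C1" "path_image y2 = closed_segment v b2 \<union> C2"
    unfolding y1_def y2_def by (subst path_image_join; simp add: arcs C1_def C2_def)+
  note va = nd(3)
  have yU: "path_image y1 \<union> path_image y2 = path_image u \<union> path_image x" unfolding yi ui xi by blast
  have ys: "path_image y1 \<inter> path_image (linepath v a) = {v, a}" "path_image y2 \<inter> path_image (linepath v a) = {v, a}"
    unfolding yi path_image_linepath Int_Un_distrib2 using m by (simp_all add: Int_commute insert_commute)
  have "path_image y1 \<inter> path_image y2 \<subseteq> region T1 \<inter> region T2" unfolding yi using sub1 sub2 by blast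
  then have "path_image y1 \<inter> path_image y2 \<subseteq> path_image y1 \<inter> path_image (linepath v a)"
    unfolding X path_image_linepath by blast
  then have "path_image y1 \<inter> path_image y2 \<subseteq> {v, a}" unfolding ys(1) .
  moreover have "{v, a} \<subseteq> path_image y1 \<inter> path_image y2" unfolding yi using aC by simp
  ultimately have y12: "path_image y1 \<inter> path_image y2 = {v, a}" by blast
  \<comment> \<open>Points of the shared edge close to \<open>a\<close> lie in the domain, hence in
    the part near \<open>a\<close>; so the shared edge does run through that part.\<close>
  have ne: "path_image (linepath v a) \<inter> inside (path_image y1 \<union> path_image y2) \<noteq> {}"
  proof -
    have "a \<in> closure (open_segment v a)" using va by simp
    then obtain y where y: "y \<in> open_segment v a" "dist y a < \<epsilon>" using e(1) unfolding closure_approachable by blast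
    then have yc: "y \<in> closed_segment v a" "y \<noteq> a" by (auto simp: open_segment_def)
    then have "y \<notin> frontier \<Omega>" using sf(1) by blast
    moreover have "y \<in> closure \<Omega>" using yc(1) X region_regular(6)[OF T1] by blast
    ultimately have "y \<in> \<Omega>" using open_domain by (auto simp: frontier_def interior_open)
    then have "y \<in> inside (path_image u \<union> path_image x)" using near y(2) by (simp add: dist_commute)
    then show ?thesis using yc(1) unfolding yU by auto
  qed
  \<comment> \<open>Second theta curve: the shared edge cuts that part into the insides of the two
    pies.\<close>
  have split2: "inside (path_image y1 \<union> path_image y2) =
      inside (path_image y1 \<union> closed_segment v a) \<union> inside (path_image y2 \<union> closed_segment v a) \<union> (closed_segment v a - {v, a})"
    by (rule split_inside_simple_closed_curve[OF arc_imp_simple_path[OF y1(1)] y1(2,3)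
          arc_imp_simple_path[OF y2(1)] y2(2,3) arc_imp_simple_path[OF arc_linepath[OF va]]
          pathstart_linepath pathfinish_linepath va y12 ys ne]) (simp only: path_image_linepath)
  have "path_image y1 \<union> closed_segment v a = path_image g1" "path_image y2 \<union> closed_segment v a = path_image g2"
    unfolding yi g1(2) g2(2) by blast+
  then have cover: "inside (path_image u \<union> path_image x) \<subseteq> region T1 \<union> region T2"
    using split2 r1 r2 g1(2) unfolding yU by (simp only:) blast
  \<comment> \<open>A third cell at \<open>a\<close> would have a nonempty open piece covered by its
    intersections with the two pies, which have empty interior.\<close>
  define O3 where "O3 = interior (region T3) \<inter> ball a \<epsilon>"
  have "a \<in> closure (interior (region T3))" using region_regular(2,4)[OF T3(1)] T3(4) by blast
  then have "ball a \<epsilon> \<inter> closure (interior (region T3)) \<noteq> {}" using e(1) centre_in_ball by blast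
  then have "O3 \<noteq> {}" unfolding open_Int_closure_eq_empty[OF open_ball] O3_def by (simp add: Int_commute)
  moreover have "open O3" by (simp add: O3_def open_Int)
  moreover have "O3 \<subseteq> (region T3 \<inter> region T1) \<union> (region T3 \<inter> region T2)"
  proof
    fix y assume "y \<in> O3"
    then have y: "y \<in> interior (region T3)" "y \<in> ball a \<epsilon>" by (simp_all add: O3_def)
    then have "y \<in> \<Omega>" using region_regular(7)[OF T3(1)] by blast
    then have "y \<in> region T1 \<union> region T2" using near[OF y(2)] cover by blast
    moreover have "y \<in> region T3" using y(1) interior_subset by blast
    ultimately show "y \<in> (region T3 \<inter> region T1) \<union> (region T3 \<inter> region T2)" by blast
  qed
  ultimately have "interior ((region T3 \<inter> region T1) \<union> (region T3 \<inter> region T2)) \<noteq> {}"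
    using interior_maximal[of O3] by blast
  then show False
    using interior_closed_Un_empty_interior[of "region T3 \<inter> region T1" "region T3 \<inter> region T2"]
      mesh_Int_empty_interior[OF T3(1) T1 T3(2)] mesh_Int_empty_interior[OF T3(1) T2 T3(3)]
      region_regular(1)[OF T1] region_regular(1)[OF T3(1)] by auto
qed

text \<open>Different arcs can meet only at a corner \<open>a\<close>. There the two pies leave no
  room for a buffer, so the corner condition makes the conics proportional, and normalisation at the
  common apex removes the factor.\<close>

lemma pies_share_edge:
  assumes T1: "T1 \<in> \<T>" and p1: "pie j1 v1 T1" and T2: "T2 \<in> \<T>" and p2: "pie j2 v2 T2"
    and X: "region T1 \<inter> region T2 = closed_segment u w"
    and e: "closed_segment u w \<in> edges T1" "closed_segment u w \<in> edges T2"
  shows "v1 = v2" "q j1 x / q j1 v1 = q j2 x / q j2 v2"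
proof -
  note e1 = edge_verts[OF T1 e(1)] and e2 = edge_verts[OF T2 e(2)]
  have v2: "v2 \<in> {u, w}" using e2(4)[OF p2] by auto
  then show v: "v1 = v2"
    using e1(1,2) pie_vertex_unique(1)[OF T1 p1] pie_interior_vertex[OF T2 p2] by blast
  obtain a where a: "closed_segment u w = closed_segment v1 a" "a \<in> {u, w}" "a \<noteq> v1"
    using v v2 e1(3) by (auto simp: closed_segment_commute)
  have aV: "a \<in> verts T1" "a \<in> verts T2" using a(2) e1 e2 by auto
  show "q j1 x / q j1 v1 = q j2 x / q j2 v2"
  proof (cases "j1 = j2")
    case False
    obtain b1 c1 where B1: "pie_boundary j1 v1 T1 a b1 c1" using pie_boundary_from[OF T1 p1 aV(1) a(3)] by blast
    obtain b2 c2 where B2: "pie_boundary j2 v1 T2 a b2 c2" using pie_boundary_from[OF T2 p2 aV(2)] a(3) v by blast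
    have "a \<in> path_image (\<gamma> j1)" "a \<in> path_image (\<gamma> j2)"
      using pie_boundaryD(3,5)[OF B1] pie_boundaryD(3,5)[OF B2]
        pathstart_in_path_image[of c1] pathstart_in_path_image[of c2] by auto
    then obtain k where k: "k < n" "a = corner k" "{j1, j2} = {k, (k + n - 1) mod n}"
      using arcs_meet_at_corner[OF pie_index[OF p1] pie_index[OF p2] False] by blast
    have "q k \<in> poly2 2 - poly2 1"
      using k(3) q_conic[OF pie_index[OF p1] pie_conic[OF p1]] q_conic[OF pie_index[OF p2] pie_conic[OF p2]]
      by (metis insertCI doubleton_eq_iff)
    moreover have "\<not> (\<exists>T\<in>buffers n \<gamma> \<T>. corner k \<in> verts T)"
    proof
      assume "\<exists>T\<in>buffers n \<gamma> \<T>. corner k \<in> verts T"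
      then obtain T3 where T3: "T3 \<in> buffers n \<gamma> \<T>" "a \<in> verts T3" using k(2) by auto
      then have "T3 \<in> \<T>" "T3 \<noteq> T1" "T3 \<noteq> T2" using T1 T2 p1 p2 by (auto simp: buffers_def pies_iff)
      then show False
        using no_third_cell_at_corner[OF T1 p1 B1 T2 p2[folded v] B2] X a(1) T3(2) by simp
    qed
    ultimately have "\<exists>c. \<forall>x. q k x = c * q ((k + n - 1) mod n) x"
      using mesh k(1) unfolding conic_triangulation_def Let_def by blast
    then obtain c where c: "\<And>x. q k x = c * q ((k + n - 1) mod n) x" by blast
    have "0 < q j v1" if "j \<in> {j1, j2}" for j
    proof -
      have "v1 \<notin> closure (open_arc (\<gamma> i))" if "i < n" for i
        using arc_subset_frontier[OF that] closure_open_arc[OF simple_path_imp_path[OF simple_arc[OF that]]]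
          frontier_disjoint pie_interior_vertex[OF T1 p1] by blast
      then show ?thesis
        using that pie_positive[OF T1 p1, of v1] pie_positive[OF T2 p2, of v1] v pie_index[OF p1] pie_index[OF p2]
          region_regular(4)[OF T1] region_regular(4)[OF T2] pie_vertex_in_verts[OF p1] pie_vertex_in_verts[OF p2] by blast
    qed
    then have pos: "0 < q k v1" "0 < q ((k + n - 1) mod n) v1" using k(3) by blast+
    then have "c \<noteq> 0" using c[of v1] by auto
    then have "q k x / q k v1 = q ((k + n - 1) mod n) x / q ((k + n - 1) mod n) v1"
      unfolding c[of x] c[of v1] by simp
    then show ?thesis using k(3) v by (auto simp: doubleton_eq_iff)
  qed (simp add: v)
qed

end

subsection \<open>Local representation of splines\<close>

locale conic_spline = conic_mesh +
  fixes d :: nat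
  assumes degree_pos: "1 \<le> d"
begin

definition conic_index :: "cell \<Rightarrow> nat" where
  "conic_index T = (THE j. \<exists>v. pie j v T)"

text \<open>On a straight cell any vertex will do: the degree there is positive, and then the choice
  does not affect \<open>pie_points\<close>.\<close>

definition apex :: "cell \<Rightarrow> complex" where
  "apex T = (if T \<in> pies n \<gamma> \<T> then THE v. \<exists>j. pie j v T else SOME u. u \<in> verts T)"

text \<open>Normalised to 1 at the apex, so that there the coefficient is the value of the
  spline.\<close>

definition weight :: "cell \<Rightarrow> complex \<Rightarrow> real" where
  "weight T = (if T \<in> pies n \<gamma> \<T> then (\<lambda>x. q (conic_index T) x / q (conic_index T) (apex T)) else (\<lambda>x. 1))"

text \<open>Degree of the cofactor of \<open>weight\<close>. As \<open>1 \<le> d\<close>, the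
  subtraction is not truncated, and 2 + (d - 1) = d + 1 is the degree of a spline on a pie.\<close>

definition cell_degree :: "cell \<Rightarrow> nat" where
  "cell_degree T = (if T \<in> pies n \<gamma> \<T> then d - 1 else if T \<in> buffers n \<gamma> \<T> then d + 1 else d)"

abbreviation points :: "cell \<Rightarrow> complex set" where
  "points T \<equiv> pie_points (apex T) (verts T) (cell_degree T)"

definition cell_sum :: "cell \<Rightarrow> (complex \<Rightarrow> real) \<Rightarrow> complex \<Rightarrow> real" where
  "cell_sum T c x = weight T x * bb_sum (apex T) (verts T) (cell_degree T) c x"

abbreviation splines :: "(complex \<Rightarrow> real) set" where
  "splines \<equiv> spline_space \<Omega> n \<gamma> \<T> d"

definition coeff_at :: "cell \<Rightarrow> (complex \<Rightarrow> real) \<Rightarrow> complex \<Rightarrow> real" where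
  "coeff_at T = bb_coeffs (weight T) (region T) (verts T) (cell_degree T) (points T)"

lemma pie_eq:
  assumes "T \<in> \<T>" "pie j v T"
  shows "conic_index T = j" "apex T = v" "weight T = (\<lambda>x. q j x / q j v)" "cell_degree T = d - 1"
proof -
  have T: "T \<in> pies n \<gamma> \<T>" using assms by (auto simp: pies_iff)
  show j: "conic_index T = j" unfolding conic_index_def using pie_unique(1)[OF assms(1)] assms(2) by blast
  show v: "apex T = v" unfolding apex_def if_P[OF T] using pie_unique(2)[OF assms(1)] assms(2) by blast
  show "weight T = (\<lambda>x. q j x / q j v)" unfolding weight_def if_P[OF T] j v ..
  show "cell_degree T = d - 1" by (simp add: cell_degree_def T)
qed

lemma pieE:
  assumes "T \<in> pies n \<gamma> \<T>"
  obtains j v where "T \<in> \<T>" "pie j v T"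
  using assms by (auto simp: pies_iff)

lemma buffer_not_pie: "T \<in> buffers n \<gamma> \<T> \<Longrightarrow> T \<notin> pies n \<gamma> \<T>" and buffer_in_mesh: "T \<in> buffers n \<gamma> \<T> \<Longrightarrow> T \<in> \<T>"
  by (auto simp: buffers_def)

lemma ordinary_iff: "T \<in> ordinaries n \<gamma> \<T> \<longleftrightarrow> T \<in> \<T> \<and> T \<notin> pies n \<gamma> \<T> \<and> T \<notin> buffers n \<gamma> \<T>"
  by (auto simp: ordinaries_def)

lemma weight_straight: "T \<notin> pies n \<gamma> \<T> \<Longrightarrow> weight T x = 1"
  by (simp add: weight_def)

lemma cell_degree_straight: "T \<notin> pies n \<gamma> \<T> \<Longrightarrow> 1 \<le> cell_degree T"
  using degree_pos by (simp add: cell_degree_def)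

lemma q_apex_pos:
  assumes T: "T \<in> \<T>" and p: "pie j v T"
  shows "0 < q j v"
proof -
  have "v \<in> region T" using region_regular(4)[OF T] pie_vertex_in_verts[OF p] by blast
  moreover have "v \<notin> closure (open_arc (\<gamma> j))"
    using arc_subset_frontier[OF pie_index[OF p]] closure_open_arc[OF simple_path_imp_path[OF simple_arc[OF pie_index[OF p]]]]
      frontier_disjoint pie_interior_vertex[OF T p] by blast
  ultimately show ?thesis using pie_positive[OF T p] by blast
qed

lemma weight_pos:
  assumes T: "T \<in> \<T>" and x: "x \<in> region T" "x \<notin> frontier \<Omega>"
  shows "0 < weight T x"
proof (cases "T \<in> pies n \<gamma> \<T>")
  case True
  then obtain j v where p: "pie j v T" by (rule pieE)
  have "x \<notin> closure (open_arc (\<gamma> j))"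
    using arc_subset_frontier[OF pie_index[OF p]] closure_open_arc[OF simple_path_imp_path[OF simple_arc[OF pie_index[OF p]]]]
      x(2) by blast
  then have "0 < q j x" using pie_positive[OF T p x(1)] by blast
  then show ?thesis using q_apex_pos[OF T p] by (simp add: pie_eq(3)[OF T p])
qed (simp add: weight_straight)

lemma weight_frontier:
  assumes T: "T \<in> pies n \<gamma> \<T>" and x: "x \<in> region T" "x \<in> frontier \<Omega>"
  shows "weight T x = 0"
proof -
  obtain j v where p: "T \<in> \<T>" "pie j v T" using T by (rule pieE)
  obtain a b c where B: "pie_boundary j v T a b c" using pie_boundary_exists[OF p] by blast
  have "x \<in> path_image (\<gamma> j)" using pie_region_frontier[OF p B] pie_boundaryD(5)[OF B] x by blast
  moreover have "q j \<in> poly2 2" using q_conic[OF pie_index[OF p(2)] pie_conic[OF p(2)]] by simp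
  ultimately have "q j x = 0" using q_zero[OF pie_index[OF p(2)]] by blast
  then show ?thesis by (simp add: pie_eq(3)[OF p])
qed

lemma weight_apex: "T \<in> \<T> \<Longrightarrow> weight T (apex T) = 1"
proof (cases "T \<in> pies n \<gamma> \<T>")
  case True
  then obtain j v where p: "T \<in> \<T>" "pie j v T" by (rule pieE)
  then show ?thesis using q_apex_pos[OF p] by (simp add: pie_eq[OF p])
qed (simp add: weight_straight)

lemma apex_in_verts: "T \<in> \<T> \<Longrightarrow> apex T \<in> verts T"
proof (cases "T \<in> pies n \<gamma> \<T>")
  case True
  then obtain j v where p: "T \<in> \<T>" "pie j v T" by (rule pieE)
  then show ?thesis using pie_vertex_in_verts[OF p(2)] by (simp add: pie_eq[OF p])
next
  case False
  assume "T \<in> \<T>"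
  then have "\<exists>u. u \<in> verts T" using independent_cell(1) by (auto simp: independent_verts_def)
  then show ?thesis using False someI_ex[of "\<lambda>u. u \<in> verts T"] by (simp add: apex_def)
qed

lemma weight_poly2:
  assumes T: "T \<in> \<T>" shows "weight T \<in> poly2 (if T \<in> pies n \<gamma> \<T> then 2 else 0)"
proof (cases "T \<in> pies n \<gamma> \<T>")
  case True
  then obtain j v where p: "T \<in> \<T>" "pie j v T" by (rule pieE)
  have "q j \<in> poly2 2" using q_conic[OF pie_index[OF p(2)] pie_conic[OF p(2)]] by simp
  then have "(\<lambda>x. 1 / q j v * q j x) \<in> poly2 2" by (rule poly2_scale)
  then show ?thesis using True by (simp add: pie_eq(3)[OF p])
next
  case False
  then have "weight T = (\<lambda>x. 1)" by (simp add: weight_def)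
  then show ?thesis using poly2_const[of 1 0] False by simp
qed

lemma cell_sum_poly2:
  assumes T: "T \<in> \<T>"
  shows "cell_sum T c \<in> poly2 (if T \<in> pies n \<gamma> \<T> \<union> buffers n \<gamma> \<T> then d + 1 else d)"
proof -
  have "(\<lambda>x. weight T x * bb_sum (apex T) (verts T) (cell_degree T) c x)
      \<in> poly2 ((if T \<in> pies n \<gamma> \<T> then 2 else 0) + cell_degree T)"
    by (rule poly2_mult[OF weight_poly2[OF T] bb_sum_poly2[OF independent_cell[OF T]]])
  moreover have "(if T \<in> pies n \<gamma> \<T> then 2 else 0) + cell_degree T = (if T \<in> pies n \<gamma> \<T> \<union> buffers n \<gamma> \<T> then d + 1 else d)"
    using degree_pos by (auto simp: cell_degree_def)
  ultimately show ?thesis by (simp add: cell_sum_def[abs_def])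
qed

text \<open>The weight is positive inside the cell, so the cofactor vanishes on an open set and
  hence everywhere, in particular on the straight triangle that carries its coefficients.\<close>

lemma cell_sum_zero:
  assumes T: "T \<in> \<T>" and z: "\<And>x. x \<in> region T \<Longrightarrow> cell_sum T c x = 0" and x: "\<xi> \<in> points T"
  shows "c \<xi> = 0"
proof -
  note V = independent_cell[OF T]
  have "bb_sum (apex T) (verts T) (cell_degree T) c y = 0" for y
  proof (rule poly2_zero_open[OF bb_sum_poly2[OF V] open_interior region_regular(3)[OF T]])
    fix y assume y: "y \<in> interior (region T)"
    then have "y \<in> region T" "y \<notin> frontier \<Omega>" using interior_subset region_regular(7)[OF T] frontier_disjoint by blast+
    then show "bb_sum (apex T) (verts T) (cell_degree T) c y = 0"
      using z[of y] weight_pos[OF T, of y] by (simp add: cell_sum_def)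
  qed
  then show ?thesis using bb_coeff_zero[OF V(1) _ x] by blast
qed

lemma cell_sum_unique:
  assumes T: "T \<in> \<T>" and z: "\<And>x. x \<in> region T \<Longrightarrow> cell_sum T c x = cell_sum T c' x" and x: "\<xi> \<in> points T"
  shows "c \<xi> = c' \<xi>"
proof -
  have "(\<lambda>\<xi>. c \<xi> - c' \<xi>) \<xi> = 0"
    by (rule cell_sum_zero[OF T _ x]) (use z in \<open>simp add: cell_sum_def bb_sum_diff right_diff_distrib\<close>)
  then show ?thesis by simp
qed

lemma infinite_arc: "infinite (open_arc g)" if "simple_path g"
proof
  assume "finite (open_arc g)"
  moreover have "inj_on g {0<..<1}"
  proof (rule inj_onI)
    fix x y :: real assume xy: "x \<in> {0<..<1}" "y \<in> {0<..<1}" "g x = g y"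
    have "\<forall>x\<in>{0..1}. \<forall>y\<in>{0..1}. g x = g y \<longrightarrow> x = y \<or> x = 0 \<and> y = 1 \<or> x = 1 \<and> y = 0"
      using that by (simp add: simple_path_def loop_free_def)
    from bspec[OF bspec[OF this, of x], of y] show "x = y" using xy by auto
  qed
  ultimately have "finite {0<..<1::real}" by (simp add: open_arc_def finite_image_iff)
  then show False by (simp add: infinite_Ioo)
qed

text \<open>\<open>conic_arc\<close> only provides some irreducible \<open>P\<close>. Divisibility
  applied to \<open>q j\<close> shows that it is a nonzero multiple of \<open>P\<close>; applied to
  \<open>f\<close>, with the curved side as infinite zero set, it gives the quotient.\<close>

lemma pie_quotient:
  assumes T: "T \<in> \<T>" and p: "pie j v T" and f: "f \<in> poly2 (d + 1)"
    and z: "\<And>x. x \<in> region T \<Longrightarrow> x \<in> frontier \<Omega> \<Longrightarrow> f x = 0"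
  shows "\<exists>h\<in>poly2 (d - 1). \<forall>x. f x = q j x / q j v * h x"
proof -
  have j: "j < n" by (rule pie_index[OF p])
  obtain P where P: "irreducible_conic P" "open_arc (\<gamma> j) \<subseteq> {x. P x = 0}"
    using pie_conic[OF p] by (auto simp: conic_arc_def irreducible_conic_def)
  have q2: "q j \<in> poly2 2" using q_conic[OF j pie_conic[OF p]] by simp
  have "\<exists>g\<in>poly2 (2 - 2). \<forall>x. q j x = P x * g x"
  proof (rule conic_dvd[OF P(1) q2 infinite_arc[OF simple_arc[OF j]]])
    show "q j x = 0" if "x \<in> open_arc (\<gamma> j)" for x using q_zero[OF j _ q2] that path_image_open_arc by blast
  qed (use P(2) in auto)
  then obtain g where g: "g \<in> poly2 0" "\<And>x. q j x = P x * g x" by auto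
  obtain k where k: "\<And>x. g x = k" using g(1) by (auto simp: poly2_def)
  have k0: "k \<noteq> 0" using q_apex_pos[OF T p] g(2)[of v] k by auto
  obtain a b c where B: "pie_boundary j v T a b c" using pie_boundary_exists[OF T p] by blast
  have inf: "infinite (path_image c)"
    using infinite_arc[OF arc_imp_simple_path[OF pie_boundaryD(2)[OF B]]] path_image_open_arc[of c] by simp
  have "\<exists>h\<in>poly2 (d + 1 - 2). \<forall>x. f x = P x * h x"
  proof (rule conic_dvd[OF P(1) f inf])
    fix x assume x: "x \<in> path_image c"
    then have "x \<in> region T \<inter> frontier \<Omega>" using pie_region_frontier[OF T p B] by simp
    then show "f x = 0" using z by blast
    have "q j x = 0" using q_zero[OF j _ q2] pie_boundaryD(5)[OF B] x by blast
    then show "P x = 0" using g(2)[of x] k k0 by simp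
  qed
  then obtain h where h: "h \<in> poly2 (d - 1)" "\<And>x. f x = P x * h x" using degree_pos by auto
  have "f x = q j x / q j v * (q j v / k * h x)" for x
    using g(2)[of x] h(2)[of x] k[of x] k0 q_apex_pos[OF T p] by simp
  then show ?thesis by (intro bexI[OF _ poly2_scale[OF h(1), of "q j v / k"]]) blast
qed

lemma spline_local_form:
  assumes s: "s \<in> splines" and T: "T \<in> \<T>"
  shows "\<exists>c. \<forall>x\<in>region T. s x = cell_sum T c x"
proof (cases "T \<in> pies n \<gamma> \<T>")
  case True
  then obtain j v where p: "pie j v T" by (rule pieE)
  have "\<exists>f\<in>poly2 (d + 1). \<forall>x\<in>region T. s x = f x" using s True by (simp add: spline_space_def)
  then obtain f where f: "f \<in> poly2 (d + 1)" "\<And>x. x \<in> region T \<Longrightarrow> s x = f x" by blast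
  have "f x = 0" if "x \<in> region T" "x \<in> frontier \<Omega>" for x using f(2)[OF that(1)] s that(2) by (simp add: spline_space_def)
  then obtain h where h: "h \<in> poly2 (d - 1)" "\<And>x. f x = q j x / q j v * h x" using pie_quotient[OF T p f(1)] by blast
  obtain c where c: "\<And>x. h x = bb_sum v (verts T) (d - 1) c x"
    using poly2_bb_sum[OF independent_cell[OF T] h(1)] by blast
  then show ?thesis using f(2) h(2) by (intro exI[of _ c]) (simp add: cell_sum_def pie_eq[OF T p])
next
  case False
  have "\<exists>f\<in>poly2 (cell_degree T). \<forall>x\<in>region T. s x = f x"
  proof (cases "T \<in> buffers n \<gamma> \<T>")
    case True
    then have "\<exists>f\<in>poly2 (d + 1). \<forall>x\<in>region T. s x = f x" using s by (simp add: spline_space_def)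
    then show ?thesis using False True by (simp add: cell_degree_def)
  next
    case B: False
    then have "T \<in> ordinaries n \<gamma> \<T>" using T False by (simp add: ordinary_iff)
    then have "\<exists>f\<in>poly2 d. \<forall>x\<in>region T. s x = f x" using s by (simp add: spline_space_def)
    then show ?thesis using False B by (simp add: cell_degree_def)
  qed
  then obtain f where f: "f \<in> poly2 (cell_degree T)" "\<And>x. x \<in> region T \<Longrightarrow> s x = f x" by blast
  obtain c where "\<And>x. f x = bb_sum (apex T) (verts T) (cell_degree T) c x"
    using poly2_bb_sum[OF independent_cell[OF T] f(1)] by blast
  then show ?thesis using f(2) False by (intro exI[of _ c]) (simp add: cell_sum_def weight_straight)
qed

lemma coeff_at_eq:
  assumes T: "T \<in> \<T>" and s: "\<And>x. x \<in> region T \<Longrightarrow> s x = cell_sum T c x"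
  shows "coeff_at T s \<xi> = (if \<xi> \<in> points T then c \<xi> else 0)"
proof -
  \<comment> \<open>\<open>bb_coeffs\<close> requires its coefficients to be zero outside the index
    set.\<close>
  define c' where "c' \<xi> = (if \<xi> \<in> points T then c \<xi> else 0)" for \<xi>
  have cs: "cell_sum T e x = weight T x * (\<Sum>\<xi>\<in>points T. e \<xi> * bernstein_at (verts T) (cell_degree T) \<xi> x)" for e x
    by (simp add: cell_sum_def bb_sum_def)
  have "coeff_at T s = c'"
    unfolding coeff_at_def bb_coeffs_def cs[symmetric]
  proof (rule the_equality)
    have "cell_sum T c' x = cell_sum T c x" for x
      unfolding cell_sum_def by (subst bb_sum_cong[of _ _ _ c' c]) (simp_all add: c'_def)
    then show "(\<forall>\<xi>. \<xi> \<notin> points T \<longrightarrow> c' \<xi> = 0) \<and> (\<forall>x\<in>region T. s x = cell_sum T c' x)"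
      using s by (simp add: c'_def)
  next
    fix e assume e: "(\<forall>\<xi>. \<xi> \<notin> points T \<longrightarrow> e \<xi> = 0) \<and> (\<forall>x\<in>region T. s x = cell_sum T e x)"
    show "e = c'"
    proof
      fix \<xi>
      show "e \<xi> = c' \<xi>"
      proof (cases "\<xi> \<in> points T")
        case True
        have "e \<xi> = c \<xi>" by (rule cell_sum_unique[OF T _ True]) (use e s in simp)
        then show ?thesis using True by (simp add: c'_def)
      qed (use e in \<open>simp add: c'_def\<close>)
    qed
  qed
  then show ?thesis by (simp add: c'_def)
qed

lemma spline_eq_cell_sum:
  assumes s: "s \<in> splines" and T: "T \<in> \<T>" and x: "x \<in> region T"
  shows "s x = cell_sum T (coeff_at T s) x"
proof -
  obtain c where c: "\<And>x. x \<in> region T \<Longrightarrow> s x = cell_sum T c x" using spline_local_form[OF s T] by blast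
  have "cell_sum T (coeff_at T s) x = cell_sum T c x"
    unfolding cell_sum_def by (subst bb_sum_cong[of _ _ _ "coeff_at T s" c]) (simp_all add: coeff_at_eq[OF T c])
  then show ?thesis using c[OF x] by simp
qed

lemma splines_add: "s \<in> splines \<Longrightarrow> t \<in> splines \<Longrightarrow> (\<lambda>x. s x + t x) \<in> splines"
proof -
  assume s: "s \<in> splines" and t: "t \<in> splines"
  have pp: "\<exists>p\<in>poly2 k. \<forall>x\<in>region T. s x + t x = p x"
    if "\<exists>p\<in>poly2 k. \<forall>x\<in>region T. s x = p x" "\<exists>p\<in>poly2 k. \<forall>x\<in>region T. t x = p x" for k T
    using that poly2_add by fastforce
  show ?thesis unfolding spline_space_def
  proof (intro CollectI conjI ballI)
    show "continuous_on (closure \<Omega>) (\<lambda>x. s x + t x)"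
      using s t by (intro continuous_on_add) (simp_all add: spline_space_def)
  qed ((rule pp)?; use s t in \<open>simp add: spline_space_def\<close>)+
qed

lemma splines_scale: "s \<in> splines \<Longrightarrow> (\<lambda>x. a * s x) \<in> splines"
proof -
  assume s: "s \<in> splines"
  have pp: "\<exists>p\<in>poly2 k. \<forall>x\<in>region T. a * s x = p x"
    if "\<exists>p\<in>poly2 k. \<forall>x\<in>region T. s x = p x" for k T
    using that poly2_scale[of _ k a] by fastforce
  show ?thesis unfolding spline_space_def
  proof (intro CollectI conjI ballI)
    show "continuous_on (closure \<Omega>) (\<lambda>x. a * s x)"
      using s by (intro continuous_on_mult_left) (simp add: spline_space_def)
  qed ((rule pp)?; use s in \<open>simp add: spline_space_def\<close>)+
qed

lemma splines_zero: "(\<lambda>x. 0) \<in> splines"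
  using poly2_const[of 0] by (auto simp: spline_space_def)

lemma coeff_at_add:
  assumes "s \<in> splines" "t \<in> splines" "T \<in> \<T>"
  shows "coeff_at T (\<lambda>x. s x + t x) \<xi> = coeff_at T s \<xi> + coeff_at T t \<xi>"
proof -
  have "coeff_at T (\<lambda>x. s x + t x) \<xi> = (if \<xi> \<in> points T then coeff_at T s \<xi> + coeff_at T t \<xi> else 0)"
    by (rule coeff_at_eq[OF assms(3)])
       (simp add: spline_eq_cell_sum[OF assms(1,3)] spline_eq_cell_sum[OF assms(2,3)] cell_sum_def bb_sum_add distrib_left)
  moreover have "coeff_at T s \<xi> = 0" "coeff_at T t \<xi> = 0" if "\<xi> \<notin> points T"
    using coeff_at_eq[OF assms(3) spline_eq_cell_sum[OF assms(1,3)], of \<xi>]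
      coeff_at_eq[OF assms(3) spline_eq_cell_sum[OF assms(2,3)], of \<xi>] that by simp_all
  ultimately show ?thesis by simp
qed

lemma coeff_at_scale:
  assumes "s \<in> splines" "T \<in> \<T>"
  shows "coeff_at T (\<lambda>x. a * s x) \<xi> = a * coeff_at T s \<xi>"
proof -
  have "coeff_at T (\<lambda>x. a * s x) \<xi> = (if \<xi> \<in> points T then a * coeff_at T s \<xi> else 0)"
    by (rule coeff_at_eq[OF assms(2)])
       (simp add: spline_eq_cell_sum[OF assms] cell_sum_def bb_sum_scale)
  moreover have "coeff_at T s \<xi> = 0" if "\<xi> \<notin> points T"
    using coeff_at_eq[OF assms(2) spline_eq_cell_sum[OF assms], of \<xi>] that by simp
  ultimately show ?thesis by simp
qed

end

section \<open>Free coefficients and gluing along common faces\<close>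

text \<open>The restriction to the smallest face through \<open>\<xi>\<close> already determines the
  coefficient at \<open>\<xi>\<close>.\<close>

lemma bb_coeff_zero_on_support:
  assumes V: "independent_verts V" and k: "1 \<le> k" and x: "\<xi> \<in> pie_points w V k" "\<xi> \<in> convex hull V"
    and z: "\<And>x. x \<in> convex hull {u\<in>V. 0 < bary V u \<xi>} \<Longrightarrow> bb_sum w V k c x = 0"
  shows "c \<xi> = 0"
proof -
  define F where "F = {u\<in>V. 0 < bary V u \<xi>}"
  note pf = positive_face[OF V x(2), folded F_def]
  have F: "F \<subseteq> V" by (auto simp: F_def)
  obtain v where v: "v \<in> F" using pf(1) by blast
  have "c \<xi> = (\<lambda>_. 0) \<xi>"
  proof (rule bb_coeff_eq_on_face[OF V V F F v])
    fix x assume "x \<in> convex hull F"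
    then have "bb_sum w V k c x = 0" using z by (simp add: F_def)
    then show "bb_sum v V k c x = bb_sum v V k (\<lambda>_. 0) x"
      using bb_sum_pos[OF k, of w V v] by (simp add: bb_sum_def)
  qed (use x(1) pf(2) k in \<open>auto simp: pie_points_pos\<close>)
  then show ?thesis by simp
qed

text \<open>The smallest face of \<open>x\<close> is contained in both faces.\<close>

lemma convex_hull_Int_face:
  assumes V: "independent_verts V" and F: "F \<subseteq> V" "G \<subseteq> V" and x: "x \<in> convex hull F" "x \<in> convex hull G"
  shows "F \<inter> G \<noteq> {}" "x \<in> convex hull (F \<inter> G)"
proof -
  have ne: "F \<noteq> {}" "G \<noteq> {}" using x by auto
  have xV: "x \<in> convex hull V" using x(1) hull_mono[OF F(1)] by blast
  have z: "\<forall>u\<in>V - F. bary V u x = 0" "\<forall>u\<in>V - G. bary V u x = 0"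
    using in_convex_hull_face[OF V F(1) ne(1) xV] in_convex_hull_face[OF V F(2) ne(2) xV] x by auto
  define P where "P = {u\<in>V. 0 < bary V u x}"
  note pf = positive_face[OF V xV, folded P_def]
  have P: "P \<subseteq> F \<inter> G" using z by (force simp: P_def)
  then show "F \<inter> G \<noteq> {}" using pf(1) by blast
  show "x \<in> convex hull (F \<inter> G)" using pf(2) hull_mono[OF P] by blast
qed

context conic_spline
begin

definition free :: "cell \<Rightarrow> complex set" where
  "free T = (if T \<in> pies n \<gamma> \<T> then points T
     else if T \<in> buffers n \<gamma> \<T> then buffer_points \<Omega> n \<gamma> \<T> (d + 1) T else points T - frontier \<Omega>)"

lemma points_straight: "T \<notin> pies n \<gamma> \<T> \<Longrightarrow> points T = domain_points (verts T) (cell_degree T)"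
  using cell_degree_straight by (simp add: pie_points_pos)

lemma free_subset: "T \<in> \<T> \<Longrightarrow> free T \<subseteq> points T"
  by (auto simp: free_def buffer_points_def cell_degree_def buffer_not_pie pie_points_pos split: if_splits)

lemma points_in_star_triangle: "T \<in> \<T> \<Longrightarrow> points T \<subseteq> convex hull (verts T)"
  by (rule pie_points_in_convex_hull[OF independent_cell(1) apex_in_verts])

lemma free_not_frontier: "T \<in> \<T> \<Longrightarrow> T \<notin> pies n \<gamma> \<T> \<Longrightarrow> \<xi> \<in> free T \<Longrightarrow> \<xi> \<notin> frontier \<Omega>"
  by (auto simp: free_def buffer_points_def split: if_splits)

lemma straight_bb_sum:
  assumes "T \<notin> pies n \<gamma> \<T>"
  shows "cell_sum T c x = bb_sum w (verts T) (cell_degree T) c x"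
    and "points T = pie_points w (verts T) (cell_degree T)"
  using bb_sum_pos[OF cell_degree_straight[OF assms], of "apex T" "verts T" w] cell_degree_straight[OF assms]
  by (simp_all add: cell_sum_def weight_straight[OF assms] pie_points_pos)

text \<open>The smallest face of a boundary point \<open>x\<close> lies in the boundary, and only
  coefficients at points of that face enter the value at \<open>x\<close>.\<close>

lemma cell_sum_frontier:
  assumes T: "T \<in> \<T>" "T \<notin> pies n \<gamma> \<T>"
    and c: "\<And>\<xi>. \<xi> \<in> points T \<Longrightarrow> \<xi> \<in> frontier \<Omega> \<Longrightarrow> c \<xi> = 0"
    and x: "x \<in> region T" "x \<in> frontier \<Omega>"
  shows "cell_sum T c x = 0"
proof -
  note V = independent_cell(1)[OF T(1)]
  have xV: "x \<in> convex hull (verts T)" using x(1) straight_boundary[OF T] by simp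
  define F where "F = {u\<in>verts T. 0 < bary (verts T) u x}"
  note pf = positive_face[OF V xV, folded F_def]
  have F: "F \<subseteq> verts T" by (auto simp: F_def)
  have Ffr: "convex hull F \<subseteq> frontier \<Omega>" using straight_region_frontier[OF T x] by (simp add: F_def)
  obtain w where w: "w \<in> F" using pf(1) by blast
  have "cell_sum T c x = bb_sum w (verts T) (cell_degree T) c x" by (rule straight_bb_sum[OF T(2)])
  also have "\<dots> = bb_sum w F (cell_degree T) c x" by (rule bb_sum_face[OF V F w pf(2)])
  also have "\<dots> = bb_sum w F (cell_degree T) (\<lambda>_. 0) x"
  proof (rule bb_sum_cong)
    fix \<xi> assume "\<xi> \<in> pie_points w F (cell_degree T)"
    then have "\<xi> \<in> points T" "\<xi> \<in> convex hull F"
      unfolding pie_points_face[OF V F w] straight_bb_sum(2)[OF T(2), of w] by auto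
    then show "c \<xi> = 0" using c Ffr by blast
  qed
  finally show ?thesis by (simp add: bb_sum_def)
qed

lemma coeff_at_frontier:
  assumes T: "T \<in> \<T>" "T \<notin> pies n \<gamma> \<T>" and s: "s \<in> splines" and x: "\<xi> \<in> points T" "\<xi> \<in> frontier \<Omega>"
  shows "coeff_at T s \<xi> = 0"
proof (rule bb_coeff_zero_on_support[OF independent_cell(1)[OF T(1)] cell_degree_straight[OF T(2)] x(1)])
  note r = straight_boundary[OF T]
  show xh: "\<xi> \<in> convex hull (verts T)" using points_in_star_triangle[OF T(1)] x(1) by blast
  fix y assume y: "y \<in> convex hull {u\<in>verts T. 0 < bary (verts T) u \<xi>}"
  then have "y \<in> frontier \<Omega>" using straight_region_frontier[OF T, of \<xi>] x(2) xh r by auto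
  then have "s y = 0" using s by (simp add: spline_space_def)
  moreover have "y \<in> region T"
    using y hull_mono[of "{u\<in>verts T. 0 < bary (verts T) u \<xi>}" "verts T"] r by auto
  ultimately show "bb_sum (apex T) (verts T) (cell_degree T) (coeff_at T s) y = 0"
    using spline_eq_cell_sum[OF s T(1), of y] straight_bb_sum(1)[OF T(2), of _ _ "apex T"] by simp
qed

lemma apex_eq_interior_vertex:
  assumes "T \<in> pies n \<gamma> \<T>" "u \<in> verts T" "u \<notin> frontier \<Omega>"
  shows "u = apex T"
proof -
  obtain j v where p: "T \<in> \<T>" "pie j v T" using assms(1) by (rule pieE)
  then show ?thesis using pie_vertex_unique(2)[OF p assms(2)] assms(3) by (simp add: pie_eq[OF p])
qed

text \<open>At an interior vertex every expansion has the value as coefficient, whatever its degree,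
  because the weight is 1 at the apex. This links cells of different kinds that meet in a vertex
  only.\<close>

lemma cell_sum_vertex:
  assumes T: "T \<in> \<T>" and u: "u \<in> verts T" "u \<notin> frontier \<Omega>"
  shows "cell_sum T c u = c u" "u \<in> points T"
proof -
  note V = independent_cell(1)[OF T]
  have "cell_sum T c u = c u \<and> u \<in> points T"
  proof (cases "T \<in> pies n \<gamma> \<T>")
    case True
    then have "u = apex T" by (rule apex_eq_interior_vertex[OF _ u])
    then show ?thesis using bb_sum_vertex[OF V, of u] vertex_in_pie_points[OF V, of u] u(1)
      by (simp add: cell_sum_def weight_apex[OF T])
  next
    case False
    then show ?thesis using bb_sum_vertex[OF V u(1)] vertex_in_pie_points[OF V u(1)]
      by (simp add: straight_bb_sum[OF False, where w = u])
  qed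
  then show "cell_sum T c u = c u" "u \<in> points T" by auto
qed

lemma coeff_at_vertex:
  assumes T: "T \<in> \<T>" and u: "u \<in> verts T" "u \<notin> frontier \<Omega>" and s: "s \<in> splines"
  shows "coeff_at T s u = s u"
  using cell_sum_vertex[OF T u] spline_eq_cell_sum[OF s T, of u] region_regular(4)[OF T] u(1) by auto

text \<open>Expansions that can be compared coefficient by coefficient along the face
  \<open>F\<close>. The vertex \<open>w\<close> serves as the index in degree 0 on both sides, and
  the weight, nonzero inside \<open>F\<close>, can be cancelled there.\<close>

definition same_form :: "cell \<Rightarrow> cell \<Rightarrow> complex set \<Rightarrow> bool" where
  "same_form T T' F \<longleftrightarrow> T \<in> \<T> \<and> T' \<in> \<T> \<and> F \<subseteq> verts T \<and> F \<subseteq> verts T' \<and>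
     cell_degree T = cell_degree T' \<and> weight T = weight T' \<and>
     (\<forall>x\<in>convex hull F. (\<forall>u\<in>F. 0 < bary F u x) \<longrightarrow> weight T x \<noteq> 0) \<and>
     (\<exists>w\<in>F. points T = pie_points w (verts T) (cell_degree T) \<and> points T' = pie_points w (verts T') (cell_degree T) \<and>
        bb_sum (apex T) (verts T) (cell_degree T) = bb_sum w (verts T) (cell_degree T) \<and>
        bb_sum (apex T') (verts T') (cell_degree T) = bb_sum w (verts T') (cell_degree T))"

lemma same_form_straight:
  assumes "T \<in> \<T>" "T' \<in> \<T>" "T \<notin> pies n \<gamma> \<T>" "T' \<notin> pies n \<gamma> \<T>" "cell_degree T = cell_degree T'"
    "F \<subseteq> verts T" "F \<subseteq> verts T'" "F \<noteq> {}"
  shows "same_form T T' F"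
proof -
  obtain w where w: "w \<in> F" using assms by blast
  have k: "1 \<le> cell_degree T" using cell_degree_straight[OF assms(3)] .
  have "weight T = weight T'" using weight_straight[OF assms(3)] weight_straight[OF assms(4)] by auto
  then show ?thesis unfolding same_form_def
    using assms w k bb_sum_pos[OF k] weight_straight[OF assms(3)]
    by (auto simp: pie_points_pos intro!: bexI[OF _ w])
qed

text \<open>The normalised conics agree by \<open>pies_share_edge\<close>, and the weight vanishes
  only at the boundary end of the edge.\<close>

lemma same_form_pies:
  assumes T: "T \<in> pies n \<gamma> \<T>" "T' \<in> pies n \<gamma> \<T>"
    and F: "region T \<inter> region T' = convex hull F" "card F = 2" "convex hull F \<in> edges T" "convex hull F \<in> edges T'"
  shows "same_form T T' F"
proof -
  obtain j v where p: "T \<in> \<T>" "pie j v T" using T(1) by (rule pieE)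
  obtain j' v' where p': "T' \<in> \<T>" "pie j' v' T'" using T(2) by (rule pieE)
  obtain u w where uw: "F = {u, w}" "u \<noteq> w" using F(2) by (auto simp: card_2_iff)
  have h: "convex hull F = closed_segment u w" by (simp add: uw segment_convex_hull)
  note e = edge_verts[OF p(1) F(3)[unfolded h]] and e' = edge_verts[OF p'(1) F(4)[unfolded h]]
  note sh = pies_share_edge[OF p p' F(1)[unfolded h] F(3)[unfolded h] F(4)[unfolded h]]
  have vF: "v \<in> F" using e(4)[OF p(2)] uw by auto
  have "weight T x \<noteq> 0" if x: "x \<in> convex hull F" "\<forall>u\<in>F. 0 < bary F u x" for x
  proof -
    obtain a where a: "F = {v, a}" "a \<noteq> v" using vF uw by (auto simp: insert_commute)
    have aV: "a \<in> verts T" using a e uw by auto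
    have I: "independent_verts F" using independent_verts_subset[OF independent_cell(1)[OF p(1)], of F] e uw by auto
    have "x \<noteq> a" using x(2) a bary_vertex[OF I, of a v] by auto
    then have "x \<notin> frontier \<Omega>"
      using pie_edge_frontier[OF p aV a(2)] x(1) a(1) by (auto simp: segment_convex_hull)
    moreover have "x \<in> region T" using x(1) F(1) by blast
    ultimately show ?thesis using weight_pos[OF p(1), of x] by (metis less_irrefl)
  qed
  moreover have "weight T = weight T'" using sh by (simp add: pie_eq[OF p] pie_eq[OF p'])
  moreover have "F \<subseteq> verts T" "F \<subseteq> verts T'" using e e' uw by auto
  ultimately show ?thesis unfolding same_form_def using sh(1) vF p p'
    by (intro conjI bexI[OF _ vF]) (auto simp: pie_eq(2,4)[OF p] pie_eq(2,4)[OF p'])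
qed

lemma same_form_agree:
  assumes "same_form T T' F" and c: "\<And>\<xi>. \<xi> \<in> points T \<Longrightarrow> \<xi> \<in> points T' \<Longrightarrow> \<xi> \<in> convex hull F \<Longrightarrow> c \<xi> = c' \<xi>"
    and x: "x \<in> convex hull F"
  shows "cell_sum T c x = cell_sum T' c' x"
proof -
  obtain w where *: "w \<in> F" "F \<subseteq> verts T" "F \<subseteq> verts T'" "T \<in> \<T>" "T' \<in> \<T>"
    "points T = pie_points w (verts T) (cell_degree T)" "points T' = pie_points w (verts T') (cell_degree T)"
    "bb_sum (apex T) (verts T) (cell_degree T) = bb_sum w (verts T) (cell_degree T)"
    "bb_sum (apex T') (verts T') (cell_degree T) = bb_sum w (verts T') (cell_degree T)"
    "cell_degree T = cell_degree T'" "weight T = weight T'"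
    using assms(1) unfolding same_form_def by blast
  note V = independent_cell(1)[OF *(4)] and V' = independent_cell(1)[OF *(5)]
  have "bb_sum w (verts T) (cell_degree T) c x = bb_sum w (verts T') (cell_degree T) c' x"
  proof (rule bb_sum_eq_on_face[OF V V' *(2,3,1) _ x])
    fix \<xi> assume "\<xi> \<in> pie_points w F (cell_degree T)"
    then show "c \<xi> = c' \<xi>"
      using c pie_points_face[OF V *(2,1), of "cell_degree T"] pie_points_face[OF V' *(3,1), of "cell_degree T"]
      unfolding *(6,7) by blast
  qed
  then show ?thesis unfolding cell_sum_def *(8) *(9)[unfolded *(10)] *(11) by (simp add: *(10))
qed

lemma same_form_coeff_eq:
  assumes "same_form T T' F" and c: "\<And>x. x \<in> convex hull F \<Longrightarrow> cell_sum T c x = cell_sum T' c' x"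
    and x: "\<xi> \<in> points T" "\<xi> \<in> convex hull F"
  shows "c \<xi> = c' \<xi>"
proof -
  obtain w where *: "w \<in> F" "F \<subseteq> verts T" "F \<subseteq> verts T'" "T \<in> \<T>" "T' \<in> \<T>"
    "points T = pie_points w (verts T) (cell_degree T)" "points T' = pie_points w (verts T') (cell_degree T)"
    "bb_sum (apex T) (verts T) (cell_degree T) = bb_sum w (verts T) (cell_degree T)"
    "bb_sum (apex T') (verts T') (cell_degree T) = bb_sum w (verts T') (cell_degree T)"
    "cell_degree T = cell_degree T'" "weight T = weight T'"
    using assms(1) unfolding same_form_def by blast
  have pos: "weight T x \<noteq> 0" if "x \<in> convex hull F" "\<forall>u\<in>F. 0 < bary F u x" for x
    using assms(1) that unfolding same_form_def by blast
  note V = independent_cell(1)[OF *(4)] and V' = independent_cell(1)[OF *(5)]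
  show ?thesis
  proof (rule bb_coeff_eq_on_face[OF V V' *(2,3,1) _ x(1)[unfolded *(6)] x(2)])
    fix x assume x: "x \<in> convex hull F" "\<forall>u\<in>F. 0 < bary F u x"
    have "weight T x * bb_sum w (verts T) (cell_degree T) c x = weight T x * bb_sum w (verts T') (cell_degree T) c' x"
      using c[OF x(1)] unfolding cell_sum_def *(8) *(11)[symmetric] *(10)[symmetric] *(9) .
    then show "bb_sum w (verts T) (cell_degree T) c x = bb_sum w (verts T') (cell_degree T) c' x"
      using pos[OF x] by simp
  qed
qed

lemma same_form_coeff_at:
  assumes "same_form T T' F" "convex hull F \<subseteq> region T" "convex hull F \<subseteq> region T'" "s \<in> splines"
    "\<xi> \<in> points T" "\<xi> \<in> convex hull F"
  shows "coeff_at T s \<xi> = coeff_at T' s \<xi>"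
proof (rule same_form_coeff_eq[OF assms(1) _ assms(5,6)])
  fix x assume x: "x \<in> convex hull F"
  have T: "T \<in> \<T>" "T' \<in> \<T>" using assms(1) by (auto simp: same_form_def)
  show "cell_sum T (coeff_at T s) x = cell_sum T' (coeff_at T' s) x"
    using spline_eq_cell_sum[OF assms(4) T(1) subsetD[OF assms(2) x]]
      spline_eq_cell_sum[OF assms(4) T(2) subsetD[OF assms(3) x]] by simp
qed

end

context conic_spline
begin

text \<open>An edge between a pie and a straight cell makes the latter a buffer. With equal buffer
  status, cells sharing an edge are therefore of the same kind.\<close>

lemma mesh_Int_same_form:
  assumes "T \<in> \<T>" "T' \<in> \<T>" "T \<noteq> T'" "x \<in> region T" "x \<in> region T'"
    "T \<in> buffers n \<gamma> \<T> \<longleftrightarrow> T' \<in> buffers n \<gamma> \<T>"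
  obtains F where "F \<subseteq> verts T" "F \<subseteq> verts T'" "region T \<inter> region T' = convex hull F" "same_form T T' F"
    | "x \<in> verts T" "x \<in> verts T'" "region T \<inter> region T' = {x}"
proof -
  obtain F where F: "F \<subseteq> verts T \<inter> verts T'" "F \<noteq> {}" "region T \<inter> region T' = convex hull F"
    "card F = 1 \<or> card F = 2 \<and> convex hull F \<in> edges T \<inter> edges T'"
    using mesh_Int[OF assms(1-3)] assms(4,5) by blast
  from F(4) show thesis
  proof
    assume "card F = 1"
    then obtain u where u: "F = {u}" by (auto simp: card_1_singleton_iff)
    then have "region T \<inter> region T' = {u}" using F(3) by simp
    moreover from this have "x = u" using assms(4,5) by blast
    ultimately show thesis using that(2) F(1) u by blast
  next
    assume e: "card F = 2 \<and> convex hull F \<in> edges T \<inter> edges T'"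
    have iff: "T \<in> pies n \<gamma> \<T> \<longleftrightarrow> T' \<in> pies n \<gamma> \<T>"
    proof (rule ccontr)
      assume ni: "\<not> (T \<in> pies n \<gamma> \<T> \<longleftrightarrow> T' \<in> pies n \<gamma> \<T>)"
      have "T \<in> buffers n \<gamma> \<T> \<or> T' \<in> buffers n \<gamma> \<T>"
      proof (cases "T \<in> pies n \<gamma> \<T>")
        case True
        then have "T' \<in> buffers n \<gamma> \<T>" using ni assms(2) e unfolding buffers_def by blast
        then show ?thesis ..
      next
        case False
        then have "T \<in> buffers n \<gamma> \<T>" using ni assms(1) e unfolding buffers_def by blast
        then show ?thesis ..
      qed
      then show False using ni assms(6) buffer_not_pie by blast
    qed
    have "same_form T T' F"
    proof (cases "T \<in> pies n \<gamma> \<T>")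
      case True
      then show ?thesis using iff same_form_pies F(3) e by blast
    next
      case False
      then have "cell_degree T = cell_degree T'" using iff assms(6) by (simp add: cell_degree_def)
      then show ?thesis using False iff same_form_straight[OF assms(1,2)] F(1,2) by blast
    qed
    then show thesis using that(1) F(1,3) by blast
  qed
qed

text \<open>The coefficients on ordinary and pie-shaped cells fit together along common edges, and the
  remaining coefficients of a buffer cell are read off the adjacent cells after raising the degree.\<close>

lemma spline_interpolation:
  fixes c :: "cell \<Rightarrow> complex \<Rightarrow> real"
  assumes comp: "\<And>T T' \<xi>. T \<in> \<T> \<Longrightarrow> T' \<in> \<T> \<Longrightarrow> \<xi> \<in> free T \<Longrightarrow> \<xi> \<in> free T' \<Longrightarrow> \<xi> \<in> region T \<Longrightarrow> \<xi> \<in> region T' \<Longrightarrow>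
      (\<And>s. s \<in> splines \<Longrightarrow> coeff_at T s \<xi> = coeff_at T' s \<xi>) \<Longrightarrow> c T \<xi> = c T' \<xi>"
  shows "\<exists>s\<in>splines. \<forall>T\<in>\<T>. \<forall>\<xi>\<in>free T. coeff_at T s \<xi> = c T \<xi>"
proof -
  \<comment> \<open>The non-buffer cells are fixed by the data, with zero for their boundary
    coefficients; buffers are filled in afterwards.\<close>
  define X where "X = \<T> - buffers n \<gamma> \<T>"
  have XT: "T \<in> \<T>" "T \<notin> buffers n \<gamma> \<T>" if "T \<in> X" for T using that by (auto simp: X_def)
  define c0 where "c0 T \<xi> = (if \<xi> \<in> free T then c T \<xi> else 0)" for T \<xi>
  define p where "p T = cell_sum T (c0 T)" for T
  have ord_free: "free T = points T - frontier \<Omega>" if "T \<in> X" "T \<notin> pies n \<gamma> \<T>" for T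
    using that XT by (simp add: free_def)
  have vertex_free: "u \<in> free T" if "T \<in> X" "u \<in> verts T" "u \<notin> frontier \<Omega>" for T u
    using cell_sum_vertex(2)[OF XT(1)[OF that(1)] that(2,3)] that XT(2)[OF that(1)] by (simp add: free_def)
  have p_vertex: "p T u = c T u" if "T \<in> X" "u \<in> verts T" "u \<notin> frontier \<Omega>" for T u
    using cell_sum_vertex(1)[OF XT(1)[OF that(1)] that(2,3)] vertex_free[OF that] by (simp add: p_def c0_def)
  have p_frontier: "p T x = 0" if T: "T \<in> X" and x: "x \<in> region T" "x \<in> frontier \<Omega>" for T x
  proof (cases "T \<in> pies n \<gamma> \<T>")
    case True
    then show ?thesis using weight_frontier[OF True x] by (simp add: p_def cell_sum_def)
  next
    case False
    show ?thesis unfolding p_def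
      by (rule cell_sum_frontier[OF XT(1)[OF T] False _ x]) (simp add: c0_def ord_free[OF T False])
  qed
  \<comment> \<open>For cells of any kind both coefficients at a common interior vertex are the
    value of the spline, so the compatibility assumption applies.\<close>
  have vertex_comp: "c T u = c T' u"
    if "T \<in> \<T>" "T' \<in> \<T>" "u \<in> verts T" "u \<in> verts T'" "u \<notin> frontier \<Omega>" "u \<in> free T" "u \<in> free T'" for T T' u
    using comp[OF that(1,2,6,7)] region_regular(4)[OF that(1)] region_regular(4)[OF that(2)] that(3,4)
      coeff_at_vertex[OF that(1,3,5)] coeff_at_vertex[OF that(2,4,5)] by (metis subsetD)
  have p_agree: "p T x = p T' x" if T: "T \<in> X" "T' \<in> X" and x: "x \<in> region T" "x \<in> region T'" for T T' x
  proof (cases "T = T'")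
    case False
    have b: "T \<in> buffers n \<gamma> \<T> \<longleftrightarrow> T' \<in> buffers n \<gamma> \<T>" using XT T by simp
    show ?thesis
    proof (rule mesh_Int_same_form[OF XT(1)[OF T(1)] XT(1)[OF T(2)] False x b])
      fix F assume F: "F \<subseteq> verts T" "F \<subseteq> verts T'" "region T \<inter> region T' = convex hull F" "same_form T T' F"
      have sub: "convex hull F \<subseteq> region T" "convex hull F \<subseteq> region T'" using F(3) by auto
      show "p T x = p T' x" unfolding p_def
      proof (rule same_form_agree[OF F(4)])
        show "x \<in> convex hull F" using x F(3) by blast
        fix \<xi> assume xi: "\<xi> \<in> points T" "\<xi> \<in> points T'" "\<xi> \<in> convex hull F"
        have iff: "T \<in> pies n \<gamma> \<T> \<longleftrightarrow> T' \<in> pies n \<gamma> \<T>"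
        proof -
          have "T \<in> pies n \<gamma> \<T> \<longleftrightarrow> cell_degree T = d - 1" "T' \<in> pies n \<gamma> \<T> \<longleftrightarrow> cell_degree T' = d - 1"
            using degree_pos XT(2)[OF T(1)] XT(2)[OF T(2)] by (auto simp: cell_degree_def)
          then show ?thesis using F(4) by (simp add: same_form_def)
        qed
        show "c0 T \<xi> = c0 T' \<xi>"
        proof (cases "T \<in> pies n \<gamma> \<T> \<or> \<xi> \<notin> frontier \<Omega>")
          case True
          then have f: "\<xi> \<in> free T" "\<xi> \<in> free T'"
            using xi iff ord_free[OF T(1)] ord_free[OF T(2)] by (auto simp: free_def)
          have "c T \<xi> = c T' \<xi>"
            by (rule comp[OF XT(1)[OF T(1)] XT(1)[OF T(2)] f subsetD[OF sub(1) xi(3)] subsetD[OF sub(2) xi(3)]])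
               (rule same_form_coeff_at[OF F(4) sub _ xi(1,3)])
          then show ?thesis using f by (simp add: c0_def)
        next
          case False
          then show ?thesis using iff ord_free[OF T(1)] ord_free[OF T(2)] by (simp add: c0_def)
        qed
      qed
    next
      assume u: "x \<in> verts T" "x \<in> verts T'"
      show "p T x = p T' x"
      proof (cases "x \<in> frontier \<Omega>")
        case True
        then show ?thesis using p_frontier T x by simp
      next
        case False
        then show ?thesis
          using p_vertex[OF T(1) u(1) False] p_vertex[OF T(2) u(2) False]
            vertex_comp[OF XT(1)[OF T(1)] XT(1)[OF T(2)] u False vertex_free[OF T(1) u(1) False] vertex_free[OF T(2) u(2) False]]
          by simp
      qed
    qed
  qed simp
  \<comment> \<open>A neighbouring piece is a polynomial on the whole plane of degree at most
    \<open>d + 1\<close>, so it can be re-expanded over the buffer triangle.\<close>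
  have "\<exists>b. \<forall>x. p T' x = cell_sum T b x" if "T \<in> buffers n \<gamma> \<T>" "T' \<in> X" for T T'
  proof -
    have T: "T \<in> \<T>" "T \<notin> pies n \<gamma> \<T>" using that buffer_in_mesh buffer_not_pie by auto
    have k: "cell_degree T = d + 1" using that(1) T(2) by (simp add: cell_degree_def)
    have "p T' \<in> poly2 (d + 1)" unfolding p_def
      by (rule poly2_mono[OF cell_sum_poly2[OF XT(1)[OF that(2)]]]) simp
    then show ?thesis
      using poly2_bb_sum[OF independent_cell[OF T(1)]] unfolding straight_bb_sum(1)[OF T(2), where w = "apex T"] k by blast
  qed
  then obtain b where b: "\<And>T T' x. T \<in> buffers n \<gamma> \<T> \<Longrightarrow> T' \<in> X \<Longrightarrow> p T' x = cell_sum T (b T T') x" by metis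
  \<comment> \<open>Inheritance comes first, even on the boundary, where the inherited coefficient
    is zero anyway; \<open>b_eq\<close> makes the choice by \<open>SOME\<close> harmless.\<close>
  define e where "e T \<xi> = (if \<exists>T'\<in>X. \<xi> \<in> region T' then b T (SOME T'. T' \<in> X \<and> \<xi> \<in> region T') \<xi>
      else if \<xi> \<in> frontier \<Omega> then 0 else c T \<xi>)" for T \<xi>
  have bT: "T \<in> \<T>" "T \<notin> pies n \<gamma> \<T>" "cell_degree T = d + 1" "free T = buffer_points \<Omega> n \<gamma> \<T> (d + 1) T"
    "T \<notin> X" if "T \<in> buffers n \<gamma> \<T>" for T
    using that buffer_in_mesh[OF that] buffer_not_pie[OF that] by (auto simp: cell_degree_def free_def X_def)
  \<comment> \<open>Two neighbours through \<open>\<xi>\<close> agree on the intersection of their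
    faces, which is again a face containing \<open>\<xi>\<close>.\<close>
  have b_eq: "b T T' \<xi> = b T T'' \<xi>"
    if T: "T \<in> buffers n \<gamma> \<T>" "T' \<in> X" "T'' \<in> X"
      and x: "\<xi> \<in> points T" "\<xi> \<in> region T" "\<xi> \<in> region T'" "\<xi> \<in> region T''" for T T' T'' \<xi>
  proof -
    note V = independent_cell(1)[OF bT(1)[OF T(1)]]
    have ne: "T \<noteq> T'" "T \<noteq> T''" using T bT(5) by blast+
    obtain F where F: "F \<subseteq> verts T" "region T \<inter> region T' = convex hull F"
      using mesh_Int[OF bT(1)[OF T(1)] XT(1)[OF T(2)] ne(1)] x by blast
    obtain G where G: "G \<subseteq> verts T" "region T \<inter> region T'' = convex hull G"
      using mesh_Int[OF bT(1)[OF T(1)] XT(1)[OF T(3)] ne(2)] x by blast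
    have "\<xi> \<in> convex hull F" "\<xi> \<in> convex hull G" using F G x by blast+
    note FG = convex_hull_Int_face[OF V F(1) G(1) this]
    show ?thesis
    proof (rule same_form_coeff_eq[OF same_form_straight[OF bT(1)[OF T(1)] bT(1)[OF T(1)] bT(2)[OF T(1)] bT(2)[OF T(1)] refl _ _ FG(1)] _ x(1) FG(2)])
      show "F \<inter> G \<subseteq> verts T" "F \<inter> G \<subseteq> verts T" using F by auto
      fix y assume "y \<in> convex hull (F \<inter> G)"
      then have "y \<in> convex hull F" "y \<in> convex hull G" using hull_mono[of "F \<inter> G"] by blast+
      then have "y \<in> region T'" "y \<in> region T''" using F(2) G(2) by blast+
      then show "cell_sum T (b T T') y = cell_sum T (b T T'') y"
        using p_agree[OF T(2,3)] b[OF T(1)] T(2,3) by metis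
    qed
  qed
  have e_eq: "e T \<xi> = b T T' \<xi>"
    if T: "T \<in> buffers n \<gamma> \<T>" "T' \<in> X" and x: "\<xi> \<in> points T" "\<xi> \<in> region T" "\<xi> \<in> region T'" for T T' \<xi>
  proof -
    define T'' where "T'' = (SOME T'. T' \<in> X \<and> \<xi> \<in> region T')"
    have "T'' \<in> X \<and> \<xi> \<in> region T''" unfolding T''_def by (rule someI[of _ T']) (use T x in blast)
    moreover have "e T \<xi> = b T T'' \<xi>" using T x by (auto simp: e_def T''_def)
    ultimately show ?thesis using b_eq[OF T(1) _ T(2) x(1,2) _ x(3)] by simp
  qed
  define Q where "Q T = (if T \<in> X then p T else cell_sum T (e T))" for T
  have pts: "points T \<subseteq> region T" if "T \<in> buffers n \<gamma> \<T>" for T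
    using points_in_star_triangle[OF bT(1)[OF that]] straight_boundary[OF bT(1)[OF that] bT(2)[OF that]] by simp
  have e_sum: "cell_sum T (e T) x = p T' x"
    if T: "T \<in> buffers n \<gamma> \<T>" "T' \<in> X" and x: "x \<in> region T" "x \<in> region T'" for T T' x
  proof -
    have ne: "T \<noteq> T'" using T bT(5) by blast
    obtain F where F: "F \<subseteq> verts T" "F \<noteq> {}" "region T \<inter> region T' = convex hull F"
      using mesh_Int[OF bT(1)[OF T(1)] XT(1)[OF T(2)] ne] x by blast
    have "cell_sum T (e T) x = cell_sum T (b T T') x"
    proof (rule same_form_agree[OF same_form_straight[OF bT(1)[OF T(1)] bT(1)[OF T(1)] bT(2)[OF T(1)] bT(2)[OF T(1)] refl F(1,1,2)]])
      show "x \<in> convex hull F" using x F(3) by blast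
      fix \<xi> assume "\<xi> \<in> points T" "\<xi> \<in> convex hull F"
      then show "e T \<xi> = b T T' \<xi>" using e_eq[OF T] F(3) by blast
    qed
    then show ?thesis using b[OF T] by simp
  qed
  have Q_frontier: "Q T x = 0" if T: "T \<in> \<T>" and x: "x \<in> region T" "x \<in> frontier \<Omega>" for T x
  proof (cases "T \<in> X")
    case True
    then show ?thesis using p_frontier[OF True x] by (simp add: Q_def)
  next
    case False
    then have B: "T \<in> buffers n \<gamma> \<T>" using T by (simp add: X_def)
    have "cell_sum T (e T) x = 0"
    proof (rule cell_sum_frontier[OF T bT(2)[OF B] _ x])
      fix \<xi> assume xi: "\<xi> \<in> points T" "\<xi> \<in> frontier \<Omega>"
      have xr: "\<xi> \<in> region T" using pts[OF B] xi by blast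
      show "e T \<xi> = 0"
      proof (cases "\<exists>T'\<in>X. \<xi> \<in> region T'")
        case True
        then obtain T' where T': "T' \<in> X" "\<xi> \<in> region T'" by blast
        have ne: "T \<noteq> T'" using T'(1) bT(5)[OF B] by blast
        note V = independent_cell(1)[OF T]
        obtain F where F: "F \<subseteq> verts T" "F \<noteq> {}" "region T \<inter> region T' = convex hull F"
          using mesh_Int[OF T XT(1)[OF T'(1)] ne] xr T'(2) by blast
        have xh: "\<xi> \<in> convex hull (verts T)" using points_in_star_triangle[OF T] xi(1) by blast
        \<comment> \<open>The inherited coefficient at a boundary point depends only on the smallest
          face through it, where the neighbouring piece vanishes.\<close>
        define G where "G = {u\<in>verts T. 0 < bary (verts T) u \<xi>}"
        have "\<xi> \<in> convex hull F" using F(3) xr T'(2) by blast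
        then have "\<forall>u\<in>verts T - F. bary (verts T) u \<xi> = 0" using in_convex_hull_face[OF V F(1,2) xh] by blast
        then have "G \<subseteq> F" by (force simp: G_def)
        have "b T T' \<xi> = 0"
        proof (rule bb_coeff_zero_on_support[OF V cell_degree_straight[OF bT(2)[OF B]] xi(1) xh, folded G_def])
          fix y assume y: "y \<in> convex hull G"
          then have "y \<in> region T'" using hull_mono[OF \<open>G \<subseteq> F\<close>] F(3) by blast
          moreover have "y \<in> frontier \<Omega>"
            using straight_region_frontier[OF T bT(2)[OF B] xr xi(2)] y by (auto simp: G_def)
          ultimately have "p T' y = 0" using p_frontier[OF T'(1)] by blast
          then show "bb_sum (apex T) (verts T) (cell_degree T) (b T T') y = 0"
            using b[OF B T'(1), of y] straight_bb_sum(1)[OF bT(2)[OF B], of _ _ "apex T"] by simp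
        qed
        then show ?thesis using e_eq[OF B T'(1) xi(1) xr T'(2)] by simp
      next
        case False
        then show ?thesis using xi(2) by (simp add: e_def)
      qed
    qed
    then show ?thesis using False by (simp add: Q_def)
  qed
  have Q_agree: "Q T x = Q T' x" if T: "T \<in> \<T>" "T' \<in> \<T>" and x: "x \<in> region T" "x \<in> region T'" for T T' x
  proof -
    consider "T \<in> X" "T' \<in> X" | "T \<in> X" "T' \<in> buffers n \<gamma> \<T>" | "T \<in> buffers n \<gamma> \<T>" "T' \<in> X"
      | "T \<in> buffers n \<gamma> \<T>" "T' \<in> buffers n \<gamma> \<T>" using T by (auto simp: X_def)
    then show ?thesis
    proof cases
      case 1
      then show ?thesis using p_agree[OF 1 x] by (simp add: Q_def)
    next
      case 2
      then show ?thesis using e_sum[OF 2(2,1) x(2,1)] bT(5)[OF 2(2)] by (simp add: Q_def)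
    next
      case 3
      then show ?thesis using e_sum[OF 3 x] bT(5)[OF 3(1)] by (simp add: Q_def)
    next
      case B: 4
      have "cell_sum T (e T) x = cell_sum T' (e T') x"
      proof (cases "T = T'")
        case False
        obtain F where F: "F \<subseteq> verts T" "F \<subseteq> verts T'" "F \<noteq> {}" "region T \<inter> region T' = convex hull F"
          using mesh_Int[OF T False] x by blast
        have sub: "convex hull F \<subseteq> region T" "convex hull F \<subseteq> region T'" using F(4) by auto
        have sf: "same_form T T' F"
          using same_form_straight[OF T bT(2)[OF B(1)] bT(2)[OF B(2)] _ F(1,2,3)] bT(3)[OF B(1)] bT(3)[OF B(2)] by simp
        show ?thesis
        proof (rule same_form_agree[OF sf])
          show "x \<in> convex hull F" using x F(4) by blast
          fix \<xi> assume xi: "\<xi> \<in> points T" "\<xi> \<in> points T'" "\<xi> \<in> convex hull F"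
          have xr: "\<xi> \<in> region T" "\<xi> \<in> region T'" using xi(3) sub by blast+
          show "e T \<xi> = e T' \<xi>"
          proof (cases "\<exists>T''\<in>X. \<xi> \<in> region T''")
            case True
            then obtain T'' where T'': "T'' \<in> X" "\<xi> \<in> region T''" by blast
            have "b T T'' \<xi> = b T' T'' \<xi>"
              by (rule same_form_coeff_eq[OF sf _ xi(1,3)]) (use b[OF B(1) T''(1)] b[OF B(2) T''(1)] in simp)
            then show ?thesis using e_eq[OF B(1) T''(1) xi(1) xr(1) T''(2)] e_eq[OF B(2) T''(1) xi(2) xr(2) T''(2)] by simp
          next
            case no: False
            show ?thesis
            proof (cases "\<xi> \<in> frontier \<Omega>")
              case True
              then show ?thesis using no by (simp add: e_def)
            next
              case nf: False
              \<comment> \<open>A point in no non-buffer cell lies on no removed edge; off the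
                boundary it is therefore free and the data apply.\<close>
              have fr: "\<xi> \<in> free T''" if T'': "T'' \<in> buffers n \<gamma> \<T>" "\<xi> \<in> points T''" for T''
              proof -
                have "\<xi> \<in> domain_points (verts T'') (d + 1)" using T'' points_straight[OF bT(2)[OF T''(1)]] bT(3)[OF T''(1)] by simp
                moreover have "\<xi> \<notin> A" if "T0 \<in> ordinaries n \<gamma> \<T> \<union> pies n \<gamma> \<T>" "A \<in> edges T0" for T0 A
                proof -
                  have "T0 \<in> X" using that(1) buffer_not_pie by (auto simp: X_def ordinary_iff pies_iff)
                  then show ?thesis using no edge_subset_region'[OF XT(1) that(2)] by blast
                qed
                ultimately show ?thesis using nf unfolding bT(4)[OF T''(1)] buffer_points_def by blast
              qed
              have "c T \<xi> = c T' \<xi>"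
                by (rule comp[OF T fr[OF B(1) xi(1)] fr[OF B(2) xi(2)] xr])
                   (rule same_form_coeff_at[OF sf sub _ xi(1,3)])
              then show ?thesis using no nf by (simp add: e_def)
            qed
          qed
        qed
      qed simp
      then show ?thesis using bT(5)[OF B(1)] bT(5)[OF B(2)] by (simp add: Q_def)
    qed
  qed
  define s where "s x = (if x \<in> closure \<Omega> then Q (SOME T. T \<in> \<T> \<and> x \<in> region T) x else 0)" for x
  have s_eq: "s x = Q T x" if T: "T \<in> \<T>" "x \<in> region T" for T x
  proof -
    define T' where "T' = (SOME T. T \<in> \<T> \<and> x \<in> region T)"
    have T': "T' \<in> \<T> \<and> x \<in> region T'" unfolding T'_def by (rule someI[of _ T]) (use T in blast)
    have "x \<in> closure \<Omega>" using region_regular(6)[OF T(1)] T(2) by blast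
    then have "s x = Q T' x" by (simp add: s_def T'_def)
    then show ?thesis using Q_agree[of T' T x] T T' by simp
  qed
  define f where "f T = (if T \<in> X then c0 T else e T)" for T
  have Qf: "Q T = cell_sum T (f T)" for T by (simp add: Q_def p_def f_def)
  have "s \<in> splines"
    unfolding spline_space_def
  proof (intro CollectI conjI ballI)
    have "continuous_on (\<Union>T\<in>\<T>. region T) s"
    proof (rule continuous_on_closed_Union[OF finite_mesh])
      fix T assume T: "T \<in> \<T>"
      show "closed (region T)" by (rule region_regular(1)[OF T])
      have "continuous_on (region T) (Q T)" unfolding Qf
        by (rule continuous_on_poly2[OF cell_sum_poly2[OF T]])
      then show "continuous_on (region T) s" using s_eq[OF T] by (simp cong: continuous_on_cong)
    qed
    then show "continuous_on (closure \<Omega>) s" by (simp add: mesh_cover)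
    show "s x = 0" if "x \<in> - closure \<Omega>" for x using that by (simp add: s_def)
    show "s x = 0" if x: "x \<in> frontier \<Omega>" for x
    proof -
      have "x \<in> (\<Union>T\<in>\<T>. region T)" using x by (simp add: mesh_cover frontier_def)
      then obtain T where T: "T \<in> \<T>" "x \<in> region T" by blast
      then show ?thesis using s_eq[OF T] Q_frontier[OF T x] by simp
    qed
    show "\<exists>p\<in>poly2 d. \<forall>x\<in>region T. s x = p x" if "T \<in> ordinaries n \<gamma> \<T>" for T
    proof -
      have T: "T \<in> \<T>" "T \<notin> pies n \<gamma> \<T> \<union> buffers n \<gamma> \<T>" using that by (auto simp: ordinary_iff)
      then have "Q T \<in> poly2 d" using cell_sum_poly2[OF T(1)] by (simp add: Qf)
      then show ?thesis by (rule bexI[rotated]) (simp add: s_eq[OF T(1)])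
    qed
    show "\<exists>p\<in>poly2 (d + 1). \<forall>x\<in>region T. s x = p x" if "T \<in> pies n \<gamma> \<T> \<union> buffers n \<gamma> \<T>" for T
    proof -
      have T: "T \<in> \<T>" using that buffer_in_mesh by (auto simp: pies_iff)
      then have "Q T \<in> poly2 (d + 1)" using cell_sum_poly2[OF T] that by (simp add: Qf)
      then show ?thesis by (rule bexI[rotated]) (simp add: s_eq[OF T])
    qed
  qed
  moreover have "coeff_at T s \<xi> = c T \<xi>" if T: "T \<in> \<T>" and x: "\<xi> \<in> free T" for T \<xi>
  proof -
    have xp: "\<xi> \<in> points T" using free_subset[OF T] x by blast
    have "coeff_at T s \<xi> = f T \<xi>"
      using coeff_at_eq[OF T, of s "f T" \<xi>] s_eq[OF T] xp by (simp add: Qf)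
    also have "f T \<xi> = c T \<xi>"
    proof (cases "T \<in> X")
      case True
      then show ?thesis using x by (simp add: f_def c0_def)
    next
      case False
      then have B: "T \<in> buffers n \<gamma> \<T>" using T by (simp add: X_def)
      have nf: "\<xi> \<notin> frontier \<Omega>" by (rule free_not_frontier[OF T bT(2)[OF B] x])
      have xr: "\<xi> \<in> region T" using pts[OF B] xp by blast
      have "e T \<xi> = c T \<xi>"
      proof (cases "\<exists>T'\<in>X. \<xi> \<in> region T'")
        case True
        then obtain T' where T': "T' \<in> X" "\<xi> \<in> region T'" by blast
        have ne: "T \<noteq> T'" using T'(1) bT(5)[OF B] by blast
        obtain F where F: "F \<subseteq> verts T \<inter> verts T'" "region T \<inter> region T' = convex hull F"
          "card F = 1 \<or> card F = 2 \<and> convex hull F \<in> edges T \<inter> edges T'"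
          using mesh_Int[OF T XT(1)[OF T'(1)] ne] xr T'(2) by blast
        have xF: "\<xi> \<in> convex hull F" using F(2) xr T'(2) by blast
        have "T' \<in> ordinaries n \<gamma> \<T> \<union> pies n \<gamma> \<T>" using XT[OF T'(1)] by (auto simp: ordinary_iff)
        \<comment> \<open>Shared edges were removed from the free points, so a non-buffer cell can
          contain a free point of a buffer only as a common vertex.\<close>
        then have "convex hull F \<notin> edges T \<inter> edges T'"
          using x xF unfolding bT(4)[OF B] buffer_points_def by blast
        then obtain u where u: "F = {u}" using F(3) by (auto simp: card_1_singleton_iff)
        then have xu: "\<xi> = u" using xF by simp
        have vt: "\<xi> \<in> verts T" "\<xi> \<in> verts T'" using F(1) u xu by auto
        have "e T \<xi> = b T T' \<xi>" by (rule e_eq[OF B T'(1) xp xr T'(2)])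
        also have "\<dots> = p T' \<xi>" using b[OF B T'(1), of \<xi>] cell_sum_vertex(1)[OF T vt(1) nf] by simp
        also have "\<dots> = c T' \<xi>" by (rule p_vertex[OF T'(1) vt(2) nf])
        also have "\<dots> = c T \<xi>"
          by (rule vertex_comp[OF XT(1)[OF T'(1)] T vt(2,1) nf vertex_free[OF T'(1) vt(2) nf] x])
        finally show ?thesis .
      next
        case False
        then show ?thesis using nf by (simp add: e_def)
      qed
      then show ?thesis using False by (simp add: f_def)
    qed
    finally show ?thesis .
  qed
  ultimately show ?thesis by blast
qed

end

subsection \<open>Stability\<close>

text \<open>Along a line a quadratic is fixed by its values at the ends and the midpoint. The
  derivative condition on the curved side thus becomes an inequality between values, which passes to
  the closure.\<close>

lemma quadratic_dir_deriv:
  assumes "f \<in> poly2 2"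
  shows "dir_deriv (v - z) f z = 4 * f ((z + v) / 2) - 3 * f z - f v"
proof -
  obtain a b c d e h where f:
    "\<And>x. f x = a + b * Re x + c * Im x + d * (Re x)\<^sup>2 + e * Re x * Im x + h * (Im x)\<^sup>2"
    using assms by (rule poly2_2E) blast
  have "f = (\<lambda>x. a + b * Re x + c * Im x + d * (Re x * Re x) + e * (Re x * Im x) + h * (Im x * Im x))"
    by (simp add: f fun_eq_iff power2_eq_square)
  moreover have "((\<lambda>x. a + b * Re x + c * Im x + d * (Re x * Re x) + e * (Re x * Im x) + h * (Im x * Im x))
      has_derivative (\<lambda>y. b * Re y + c * Im y + d * (Re z * Re y + Re y * Re z) + e * (Re z * Im y + Re y * Im z)
        + h * (Im z * Im y + Im y * Im z))) (at z)"
    by (auto intro!: derivative_eq_intros)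
  ultimately have "(f has_derivative (\<lambda>y. b * Re y + c * Im y + d * (Re z * Re y + Re y * Re z)
      + e * (Re z * Im y + Re y * Im z) + h * (Im z * Im y + Im y * Im z))) (at z)" by simp
  note frechet_derivative_at[OF this, symmetric]
  then have D: "dir_deriv (v - z) f z = (\<lambda>y. b * Re y + c * Im y + d * (Re z * Re y + Re y * Re z)
      + e * (Re z * Im y + Re y * Im z) + h * (Im z * Im y + Im y * Im z)) (v - z)"
    unfolding dir_deriv_def by (rule fun_cong)
  define m1 m2 where "m1 = Re ((z + v) / 2)" and "m2 = Im ((z + v) / 2)"
  have v: "Re v = 2 * m1 - Re z" "Im v = 2 * m2 - Im z" by (simp_all add: m1_def m2_def)
  show ?thesis unfolding D f minus_complex.sel m1_def[symmetric] m2_def[symmetric] v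
    by (simp only: power2_eq_square) (simp add: algebra_simps)
qed

lemma quadratic_on_segment:
  assumes "f \<in> poly2 2"
  shows "f (z + t *\<^sub>R (v - z)) =
    f z + (4 * f ((z + v) / 2) - 3 * f z - f v) * t + (2 * f z + 2 * f v - 4 * f ((z + v) / 2)) * t\<^sup>2"
proof -
  obtain a where a: "\<And>t. f (z + t *\<^sub>R (v - z)) = (\<Sum>i\<le>2. a i * t ^ i)" using poly2_on_line[OF assms] by blast
  have e: "f (z + t *\<^sub>R (v - z)) = a 0 + a 1 * t + a 2 * t\<^sup>2" for t by (simp add: a eval_nat_numeral)
  have mid: "z + (1/2) *\<^sub>R (v - z) = (z + v) / 2"
    by (rule complex_eqI) (simp_all add: add_divide_distrib diff_divide_distrib)
  have "f ((z + v) / 2) = a 0 + a 1 / 2 + a 2 / 4"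
    using e[of "1/2"] unfolding mid by (simp add: power2_eq_square)
  moreover have "f z = a 0" "f v = a 0 + a 1 + a 2" using e[of 0] e[of 1] by simp_all
  ultimately show ?thesis unfolding e by (simp add: algebra_simps)
qed

lemma open_arc_of_arc: "arc c \<Longrightarrow> open_arc c \<subseteq> path_image c - {pathstart c, pathfinish c}"
proof
  fix x assume c: "arc c" and "x \<in> open_arc c"
  then obtain t where t: "0 < t" "t < 1" "x = c t" by (auto simp: open_arc_def)
  have inj: "inj_on c {0..1}" using c by (simp add: arc_def)
  have "c t \<noteq> c 0" "c t \<noteq> c 1" using inj_onD[OF inj, of t 0] inj_onD[OF inj, of t 1] t by auto
  then show "x \<in> path_image c - {pathstart c, pathfinish c}"
    using t by (auto simp: path_image_def pathstart_def pathfinish_def)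
qed

locale conic_stable = conic_spline +
  fixes R A B :: real
  assumes shape: "shape_constants n \<gamma> q \<T> R A B"
begin

lemma constants_pos: "0 < R" "0 < A" "0 < B"
  using shape by (auto simp: shape_constants_def)

text \<open>Origin of 6: a point of the straight triangle has distance at most 3/2 of the diameter
  from the centre \<open>c'\<close> of the disc of radius \<open>r / 2\<close> in
  \<open>coeff_at_le\<close>, and the diameter is at most \<open>2 * R * r\<close>. The maximum with
  1 meets the condition on \<open>L\<close> in \<open>poly2_growth\<close>.\<close>

definition spread :: real where
  "spread = max 1 (6 * R)"

lemma diameter_bound:
  assumes "T \<in> \<T>" "x \<in> region T" "y \<in> region T"
  shows "dist x y \<le> diameter (region T)"
  using diameter_bounded_bound[OF compact_imp_bounded[OF region_regular(5)[OF assms(1)]] assms(2,3)] .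

text \<open>A radius above half the supremum spares a proof that the supremum is attained, at the
  price of the factor 2.\<close>

lemma inscribed_disc:
  assumes T: "T \<in> \<T>"
  obtains c r where "0 < r" "cball c r \<subseteq> region T" "cball c r \<subseteq> convex hull (verts T)"
    "diameter (region T) \<le> 2 * R * r"
proof -
  define S where "S = {r. 0 \<le> r \<and> (\<exists>c. cball c r \<subseteq> region T \<inter> star_triangle T)}"
  have V: "verts T \<subseteq> region T" "finite (verts T)" "card (verts T) = 3"
    using region_regular(4)[OF T] independent_cell[OF T] by (auto simp: independent_verts_def)
  obtain u w where uw: "u \<in> verts T" "w \<in> verts T" "u \<noteq> w"
    using V(3) by (auto simp: card_3_iff)
  then have "0 < diameter (region T)"
    using diameter_bound[OF T, of u w] V(1) by (metis subsetD less_le_trans zero_less_dist_iff)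
  moreover have d: "diameter (region T) \<le> R * rho T" using shape T by (simp add: shape_constants_def)
  ultimately have "0 < rho T" using constants_pos(1) by (metis less_le_trans zero_less_mult_pos)
  have rS: "rho T = Sup S" by (simp add: rho_def inradius_def S_def)
  have "cball u 0 \<subseteq> region T \<inter> star_triangle T" using uw(1) V(1) by (auto simp: star_triangle_def hull_inc)
  then have "0 \<in> S" unfolding S_def by blast
  then have ne: "S \<noteq> {}" by blast
  have lt: "rho T / 2 < Sup S" using \<open>0 < rho T\<close> rS by simp
  obtain r where r: "r \<in> S" "rho T / 2 < r" using less_cSupD[OF ne lt] by blast
  then obtain c where c: "cball c r \<subseteq> region T \<inter> star_triangle T" by (auto simp: S_def)
  have "R * rho T \<le> R * (2 * r)" using r(2) constants_pos(1) by (intro mult_left_mono) auto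
  then have "diameter (region T) \<le> 2 * R * r" using d by simp
  moreover have "0 < r" using r(2) \<open>0 < rho T\<close> by simp
  ultimately show thesis using that c by (auto simp: star_triangle_def)
qed

lemma weight_le:
  assumes T: "T \<in> \<T>" and x: "x \<in> region T"
  shows "\<bar>weight T x\<bar> \<le> max 1 A"
proof (cases "T \<in> pies n \<gamma> \<T>")
  case True
  then obtain j v where p: "pie j v T" by (rule pieE)
  have "q j x \<le> A * q j v" using shape T p x unfolding shape_constants_def by blast
  then have "weight T x \<le> A" using q_apex_pos[OF T p] by (simp add: pie_eq[OF T p] divide_le_eq)
  moreover have "0 \<le> weight T x"
    using weight_pos[OF T x] weight_frontier[OF True x] by (cases "x \<in> frontier \<Omega>") auto
  ultimately show ?thesis by simp
qed (simp add: weight_straight)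

text \<open>The derivative condition is given on the open arc, where \<open>q j z = 0\<close>;
  written with the midpoint value it extends by continuity to the ends of the curved side.\<close>

lemma pie_midpoint:
  assumes T: "T \<in> \<T>" and p: "pie j v T" and Bd: "pie_boundary j v T a b c" and z: "z \<in> path_image c"
  shows "(1 + B) * q j v \<le> 4 * q j ((z + v) / 2)"
proof -
  have j: "j < n" by (rule pie_index[OF p])
  have q2: "q j \<in> poly2 2" using q_conic[OF j pie_conic[OF p]] by simp
  have pc: "path_image c = closure (open_arc c)"
    using closure_open_arc[OF arc_imp_path[OF pie_boundaryD(2)[OF Bd]]] by simp
  have "open_arc c \<subseteq> {z. (1 + B) * q j v \<le> 4 * q j ((z + v) / 2)}"
  proof
    fix z assume "z \<in> open_arc c"
    then have zc: "z \<in> path_image c - {a, b}"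
      using open_arc_of_arc[OF pie_boundaryD(2)[OF Bd]] pie_boundaryD(3,4)[OF Bd] by blast
    have "z \<in> region T" using zc pie_region_frontier[OF T p Bd] by blast
    moreover have "z \<in> open_arc (\<gamma> j)" using zc pie_boundaryD(6)[OF Bd] by blast
    ultimately have "B * q j v \<le> dir_deriv (v - z) (q j) z"
      using shape T p unfolding shape_constants_def by blast
    moreover have "q j z = 0" using q_zero[OF j _ q2] zc pie_boundaryD(5)[OF Bd] by blast
    ultimately show "z \<in> {z. (1 + B) * q j v \<le> 4 * q j ((z + v) / 2)}"
      unfolding quadratic_dir_deriv[OF q2] by (simp add: algebra_simps)
  qed
  moreover have "closed {z. (1 + B) * q j v \<le> 4 * q j ((z + v) / 2)}"
  proof (rule closed_Collect_le)
    have "(\<lambda>z. q j ((z + v) / 2)) \<in> poly2 2"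
    proof (rule poly2_comp[OF q2])
      show "(\<lambda>z. Re ((z + v) / 2)) \<in> poly2 1" using poly2_linear[of "Re v / 2" "1/2" 0] by (simp add: add_divide_distrib add.commute)
      show "(\<lambda>z. Im ((z + v) / 2)) \<in> poly2 1" using poly2_linear[of "Im v / 2" 0 "1/2"] by (simp add: add_divide_distrib add.commute)
    qed
    then show "continuous_on UNIV (\<lambda>z. 4 * q j ((z + v) / 2))" by (intro continuous_on_mult_left continuous_on_poly2)
  qed simp
  ultimately have "path_image c \<subseteq> {z. (1 + B) * q j v \<le> 4 * q j ((z + v) / 2)}"
    unfolding pc by (rule closure_minimal)
  then show ?thesis using z by blast
qed

text \<open>The last point of the cell on a ray from the apex lies on the curved side.\<close>

lemma pie_ray_exit:
  assumes T: "T \<in> \<T>" and p: "pie j v T" and Bd: "pie_boundary j v T a b c"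
    and x: "x \<in> region T" "x \<noteq> v"
  obtains t where "1 \<le> t" "v + t *\<^sub>R (x - v) \<in> path_image c"
proof -
  define S where "S = {t. v + t *\<^sub>R (x - v) \<in> region T} \<inter> {1..}"
  have cont: "continuous_on UNIV (\<lambda>t. v + t *\<^sub>R (x - v))" by (intro continuous_intros)
  have "closed S" unfolding S_def
    using closed_vimage[OF region_regular(1)[OF T] cont] by (auto simp: vimage_def intro: closed_Int)
  moreover have "bounded S"
  proof (rule boundedI)
    fix t assume t: "t \<in> S"
    have "v \<in> region T" using region_regular(4)[OF T] pie_vertex_in_verts[OF p] by blast
    then have "dist v (v + t *\<^sub>R (x - v)) \<le> diameter (region T)" using t diameter_bound[OF T] by (auto simp: S_def)
    then have "\<bar>t\<bar> * norm (x - v) \<le> diameter (region T)" by (simp add: dist_norm)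
    then show "norm t \<le> diameter (region T) / norm (x - v)" using x(2) by (simp add: field_simps)
  qed
  ultimately have "compact S" by (simp add: compact_eq_bounded_closed)
  moreover have "1 \<in> S" using x(1) by (simp add: S_def)
  ultimately obtain m where m: "m \<in> S" "\<And>t. t \<in> S \<Longrightarrow> t \<le> m" using compact_attains_sup[of S] by blast
  define z where "z = v + m *\<^sub>R (x - v)"
  have z: "z \<in> region T" "1 \<le> m" using m(1) by (auto simp: S_def z_def)
  have zv: "z \<noteq> v" using z(2) x(2) by (simp add: z_def)
  have "z \<notin> interior (region T)"
  proof
    assume "z \<in> interior (region T)"
    then have mem: "m \<in> (\<lambda>t. v + t *\<^sub>R (x - v)) -` interior (region T)" by (simp add: z_def)
    obtain e where e: "0 < e" "ball m e \<subseteq> (\<lambda>t. v + t *\<^sub>R (x - v)) -` interior (region T)"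
      by (rule openE[OF open_vimage[OF open_interior cont] mem])
    have "m + e / 2 \<in> ball m e" using e(1) by (simp add: dist_norm)
    then have "m + e / 2 \<in> (\<lambda>t. v + t *\<^sub>R (x - v)) -` interior (region T)" using e(2) by blast
    then have "v + (m + e / 2) *\<^sub>R (x - v) \<in> region T" using interior_subset[of "region T"] by blast
    then have "m + e / 2 \<in> S" using z(2) e(1) by (simp add: S_def)
    from m(2)[OF this] show False using e(1) by simp
  qed
  then have zf: "z \<in> frontier (region T)" using z(1) closure_subset[of "region T"] unfolding frontier_def by blast
  obtain g where g: "enclosed_by (region T) g" "path_image g = closed_segment v a \<union> closed_segment v b \<union> path_image c"
    using pie_boundaryD(11)[OF Bd] by blast
  have "frontier (region T) = path_image g" using interior_Un_inside(3)[of g] g(1) by (simp add: enclosed_by_def)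
  then have cases: "z \<in> closed_segment v a \<or> z \<in> closed_segment v b \<or> z \<in> path_image c" using zf g(2) by blast
  \<comment> \<open>If \<open>z\<close> lies on a straight side from \<open>v\<close> to
    \<open>e\<close>, then \<open>e\<close> is no closer to \<open>v\<close> on the same ray, and
    maximality of \<open>m\<close> gives \<open>z = e\<close>, an end of the curved side.\<close>
  have last: "z = e" if e: "z \<in> closed_segment v e" "e \<in> region T" for e
  proof -
    obtain t where t: "0 \<le> t" "t \<le> 1" "z = (1 - t) *\<^sub>R v + t *\<^sub>R e" using e(1) by (auto simp: closed_segment_def)
    have "t \<noteq> 0" using t(3) zv by auto
    then have t0: "0 < t" using t(1) by simp
    have zt: "z - v = t *\<^sub>R (e - v)" using t(3) by (simp add: algebra_simps)
    have "e = v + (1 / t) *\<^sub>R (z - v)" unfolding zt using t0 by simp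
    also have "\<dots> = v + (m / t) *\<^sub>R (x - v)" by (simp add: z_def)
    finally have ev: "e = v + (m / t) *\<^sub>R (x - v)" .
    have "m \<le> m / t" using t0 t(2) z(2) by (simp add: le_divide_eq mult_left_le)
    then have "m / t \<in> S" using ev e(2) z(2) by (simp add: S_def)
    then have "m / t \<le> m" using m(2) by blast
    then have "m \<le> m * t" using t0 by (simp add: divide_le_eq)
    then have "m * 1 \<le> m * t" by simp
    moreover have "0 < m" using z(2) by simp
    ultimately have "1 \<le> t" using mult_le_cancel_left_pos[of m 1 t] by blast
    then have "t = 1" using t(2) by simp
    then show ?thesis using t(3) by simp
  qed
  have "a \<in> path_image c" "b \<in> path_image c" "a \<in> region T" "b \<in> region T"
    using pie_boundaryD(1,3,4)[OF Bd] pathstart_in_path_image[of c] pathfinish_in_path_image[of c] region_regular(4)[OF T] by auto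
  then have "z \<in> path_image c" using cases last by blast
  then show thesis using that[OF z(2)] by (simp add: z_def)
qed

text \<open>From the exit point \<open>z\<close> (parameter 0) to the apex (parameter 1) the weight
  is r (\<alpha> (1 - r) + r) with \<alpha> \<ge> B. The bracket is a convex combination of \<alpha>
  and 1, and points at most halfway out from the apex have r \<ge> 1/2.\<close>

lemma weight_half:
  assumes T: "T \<in> pies n \<gamma> \<T>" and x: "x \<in> region T"
  shows "min 1 B / 2 \<le> weight T (apex T + (1/2) *\<^sub>R (x - apex T))"
proof -
  obtain j v where p: "T \<in> \<T>" "pie j v T" using T by (rule pieE)
  have v: "apex T = v" and w: "weight T = (\<lambda>x. q j x / q j v)" using pie_eq[OF p] by auto
  have qv: "0 < q j v" by (rule q_apex_pos[OF p])
  show ?thesis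
  proof (cases "x = v")
    case True
    then show ?thesis using qv by (simp add: v w)
  next
    case False
    obtain a b c where Bd: "pie_boundary j v T a b c" using pie_boundary_exists[OF p] by blast
    obtain t where t: "1 \<le> t" "v + t *\<^sub>R (x - v) \<in> path_image c" using pie_ray_exit[OF p Bd x False] by blast
    define z where "z = v + t *\<^sub>R (x - v)"
    \<comment> \<open>The midpoint of \<open>v\<close> and \<open>x\<close> divides the segment from
      \<open>v\<close> to \<open>z\<close> at 1 / (2 t), counted from \<open>v\<close>.\<close>
    define r where "r = 1 - 1 / (2 * t)"
    have r: "1/2 \<le> r" "r \<le> 1" using t(1) by (auto simp: r_def field_simps)
    have y: "v + (1/2) *\<^sub>R (x - v) = z + r *\<^sub>R (v - z)"
    proof -
      have "v - z = - t *\<^sub>R (x - v)" by (simp add: z_def)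
      then have "z + r *\<^sub>R (v - z) = v + (t - r * t) *\<^sub>R (x - v)" by (simp add: z_def algebra_simps)
      moreover have "t - r * t = 1/2" using t(1) by (simp add: r_def field_simps)
      ultimately show ?thesis by simp
    qed
    have q2: "q j \<in> poly2 2" using q_conic[OF pie_index[OF p(2)] pie_conic[OF p(2)]] by simp
    have qz: "q j z = 0" using q_zero[OF pie_index[OF p(2)] _ q2] t(2) pie_boundaryD(5)[OF Bd] by (auto simp: z_def)
    define \<alpha> where "\<alpha> = 4 * q j ((z + v) / 2) / q j v - 1"
    have \<alpha>: "B \<le> \<alpha>" using pie_midpoint[OF p Bd, of z] t(2) qv by (simp add: \<alpha>_def z_def field_simps)
    have "q j (z + r *\<^sub>R (v - z)) = q j v * (r * (\<alpha> * (1 - r) + r))"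
      unfolding quadratic_on_segment[OF q2] qz \<alpha>_def using qv by (simp add: field_simps power2_eq_square)
    then have wy: "weight T (v + (1/2) *\<^sub>R (x - v)) = r * (\<alpha> * (1 - r) + r)" using qv by (simp add: w y)
    have "min 1 B * (1 - r) + min 1 B * r \<le> \<alpha> * (1 - r) + 1 * r"
      using \<alpha> r by (intro add_mono mult_right_mono) auto
    then have "min 1 B \<le> \<alpha> * (1 - r) + r" by (simp add: algebra_simps)
    then have "1/2 * min 1 B \<le> r * (\<alpha> * (1 - r) + r)" using r constants_pos(3) by (intro mult_mono) auto
    then show ?thesis unfolding v wy by simp
  qed
qed

lemma abs_le_sup_norm:
  assumes "T \<in> \<T>" "s \<in> splines" "x \<in> region T"
  shows "\<bar>s x\<bar> \<le> sup_norm (region T) s"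
proof -
  have "continuous_on (region T) s"
    using assms(2) region_regular(6)[OF assms(1)] continuous_on_subset by (auto simp: spline_space_def)
  then have "compact ((\<lambda>x. \<bar>s x\<bar>) ` region T)"
    using region_regular(5)[OF assms(1)] by (intro compact_continuous_image continuous_intros)
  then have "bdd_above ((\<lambda>x. \<bar>s x\<bar>) ` region T)" by (intro bounded_imp_bdd_above compact_imp_bounded)
  then show ?thesis unfolding sup_norm_def by (intro cSUP_upper[OF assms(3)])
qed

text \<open>A sum over the three kinds of cells in place of a maximum. The factor
  \<open>2 / min 1 B\<close> inverts the bound of \<open>weight_half\<close>, and
  \<open>growth\<close> leads from the half-size disc to the straight triangle.\<close>

definition coeff_constant :: real where
  "coeff_constant = bb_bound 3 d + bb_bound 3 (d + 1)
     + bb_bound 3 (d - 1) * (growth (d - 1) spread * (2 / min 1 B))"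

lemma coeff_at_le:
  assumes T: "T \<in> \<T>" and s: "s \<in> splines" and x: "\<xi> \<in> points T"
  shows "\<bar>coeff_at T s \<xi>\<bar> \<le> coeff_constant * sup_norm (region T) s"
proof -
  define N where "N = sup_norm (region T) s"
  have N: "\<bar>s x\<bar> \<le> N" if "x \<in> region T" for x using abs_le_sup_norm[OF T s that] by (simp add: N_def)
  have N0: "0 \<le> N"
    using N region_regular(3)[OF T] interior_subset by (metis abs_ge_zero all_not_in_conv order_trans subsetD)
  note V = independent_cell[OF T]
  have g0: "0 \<le> growth (d - 1) spread * (2 / min 1 B)"
    using growth_nonneg[of spread] constants_pos(3) by (auto simp: spread_def intro!: mult_nonneg_nonneg)
  define k1 k2 k3 where "k1 = bb_bound 3 d" and "k2 = bb_bound 3 (d + 1)"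
    and "k3 = bb_bound 3 (d - 1) * (growth (d - 1) spread * (2 / min 1 B))"
  have k: "0 \<le> k1" "0 \<le> k2" "0 \<le> k3" 
    unfolding k1_def k2_def k3_def using bb_bound_nonneg mult_nonneg_nonneg[OF bb_bound_nonneg g0] by blast+
  have K: "coeff_constant = k1 + k2 + k3" by (simp add: coeff_constant_def k1_def k2_def k3_def)
  have "\<exists>k'\<in>{k1, k2, k3}. \<bar>coeff_at T s \<xi>\<bar> \<le> k' * N"
  proof (cases "T \<in> pies n \<gamma> \<T>")
    case False
    have "\<bar>coeff_at T s \<xi>\<bar> \<le> bb_bound (card (verts T)) (cell_degree T) * N"
    proof (rule bb_coeff_le[OF V(1) _ x])
      fix y assume "y \<in> convex hull verts T"
      then have "y \<in> region T" using straight_boundary[OF T False] by simp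
      then show "\<bar>bb_sum (apex T) (verts T) (cell_degree T) (coeff_at T s) y\<bar> \<le> N"
        using N[of y] spline_eq_cell_sum[OF s T, of y] straight_bb_sum(1)[OF False, of _ _ "apex T"] by simp
    qed
    then show ?thesis using False
      by (cases "T \<in> buffers n \<gamma> \<T>") (simp_all add: V(2) cell_degree_def k1_def k2_def)
  next
    case True
    then obtain j v where p: "pie j v T" by (rule pieE)
    have v: "apex T = v" "cell_degree T = d - 1" using pie_eq[OF T p] by auto
    define P where "P = bb_sum v (verts T) (d - 1) (coeff_at T s)"
    have sP: "s y = weight T y * P y" if "y \<in> region T" for y
      using spline_eq_cell_sum[OF s T that] by (simp add: cell_sum_def v P_def)
    obtain c r where cr: "0 < r" "cball c r \<subseteq> region T" "cball c r \<subseteq> convex hull (verts T)"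
      "diameter (region T) \<le> 2 * R * r" by (rule inscribed_disc[OF T])
    \<comment> \<open>Centre of the disc contracted by 1/2 towards the apex, where the weight is
      bounded below.\<close>
    define c' where "c' = v + (1/2) *\<^sub>R (c - v)"
    have half: "\<bar>P y\<bar> \<le> 2 / min 1 B * N" if y: "dist c' y \<le> r / 2" for y
    proof -
      define x where "x = v + 2 *\<^sub>R (y - v)"
      have yx: "y = v + (1/2) *\<^sub>R (x - v)" by (simp add: x_def)
      have "c - x = 2 *\<^sub>R (c' - y)" by (simp add: c'_def x_def algebra_simps scaleR_2)
      then have "dist c x = 2 * dist c' y" by (simp add: dist_norm)
      then have x: "x \<in> region T" using y cr(2) by (auto simp: mem_cball)
      have "v + t *\<^sub>R (x - v) = (1 - t) *\<^sub>R v + t *\<^sub>R x" for t by (simp add: algebra_simps)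
      then have "y = (1 - 1/2) *\<^sub>R v + (1/2) *\<^sub>R x" unfolding yx .
      then have "y \<in> closed_segment v x" unfolding closed_segment_def
        by (intro CollectI exI[of _ "1/2"] conjI) simp_all
      then have yr: "y \<in> region T" using pie_star_shaped[OF T p x] by blast
      have w: "min 1 B / 2 \<le> weight T y" using weight_half[OF True x] by (simp add: v yx)
      have m: "0 < min 1 B / 2" using constants_pos(3) by simp
      have "min 1 B / 2 * \<bar>P y\<bar> \<le> \<bar>weight T y\<bar> * \<bar>P y\<bar>" using w by (intro mult_right_mono) auto
      also have "\<dots> = \<bar>s y\<bar>" by (simp add: sP[OF yr] abs_mult)
      also have "\<dots> \<le> N" by (rule N[OF yr])
      finally show ?thesis using m by (simp add: field_simps)
    qed
    have vr: "v \<in> region T" using region_regular(4)[OF T] pie_vertex_in_verts[OF p] by blast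
    have cr': "c \<in> region T" using cr(1,2) by auto
    \<comment> \<open>The straight triangle may protrude from the cell, but being the hull of points
      of the cell it lies in the ball about \<open>v\<close> whose radius is the diameter of the
      cell.\<close>
    have near: "dist c' y \<le> spread * (r / 2)" if y: "y \<in> convex hull (verts T)" for y
    proof -
      have "verts T \<subseteq> cball v (diameter (region T))"
        using diameter_bound[OF T vr] region_regular(4)[OF T] by auto
      then have "convex hull (verts T) \<subseteq> cball v (diameter (region T))" by (intro hull_minimal convex_cball)
      then have "dist v y \<le> diameter (region T)" using y by auto
      moreover have "dist c' v = dist c v / 2" by (simp add: c'_def dist_norm)
      moreover have "dist c v \<le> diameter (region T)" by (rule diameter_bound[OF T cr' vr])
      ultimately have "dist c' y \<le> 3 / 2 * (2 * R * r)" using dist_triangle[of c' y v] cr(4) by linarith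
      also have "\<dots> = 6 * R * (r / 2)" by simp
      also have "\<dots> \<le> spread * (r / 2)" using cr(1) by (intro mult_right_mono) (auto simp: spread_def)
      finally show ?thesis .
    qed
    have "\<bar>coeff_at T s \<xi>\<bar> \<le> bb_bound (card (verts T)) (d - 1) * (growth (d - 1) spread * (2 / min 1 B * N))"
    proof (rule bb_coeff_le[OF V(1) _ x[unfolded v]])
      fix y assume "y \<in> convex hull verts T"
      then have "\<bar>P y\<bar> \<le> growth (d - 1) spread * (2 / min 1 B * N)"
        using near half cr(1) by (intro poly2_growth[of P "d - 1" "r / 2" spread c' y])
          (auto simp: P_def bb_sum_poly2[OF V] spread_def)
      then show "\<bar>bb_sum v (verts T) (d - 1) (coeff_at T s) y\<bar> \<le> growth (d - 1) spread * (2 / min 1 B * N)"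
        by (simp add: P_def)
    qed
    then show ?thesis by (simp add: V(2) k3_def mult.assoc)
  qed
  moreover have "k' * N \<le> coeff_constant * N" if "k' \<in> {k1, k2, k3}" for k'
    using that k N0 unfolding K by (intro mult_right_mono) auto
  ultimately show ?thesis unfolding N_def by (meson order_trans)
qed

end

subsection \<open>Determining sets in finite dimension\<close>

text \<open>Gaussian elimination: one equation eliminates one unknown from the others.\<close>

lemma underdetermined_system:
  fixes a :: "'j \<Rightarrow> 'i \<Rightarrow> real"
  assumes "finite J" "finite I" "card J < card I"
  shows "\<exists>x. (\<exists>i\<in>I. x i \<noteq> 0) \<and> (\<forall>j\<in>J. (\<Sum>i\<in>I. a j i * x i) = 0)"
  using assms
proof (induction J arbitrary: I a rule: finite_induct)
  case empty
  then have "I \<noteq> {}" by auto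
  then show ?case by (intro exI[of _ "\<lambda>_. 1"]) auto
next
  case (insert j J)
  show ?case
  proof (cases "\<forall>i\<in>I. a j i = 0")
    case True
    have "card J < card I" using insert.hyps insert.prems by simp
    from insert.IH[OF insert.prems(1) this, of a] show ?thesis using True by auto
  next
    case False
    then obtain k where k: "k \<in> I" "a j k \<noteq> 0" by blast
    define b where "b l i = a l i - a l k * (a j i / a j k)" for l i
    have "card J < card (I - {k})" using insert.hyps insert.prems k by simp
    then obtain x where x: "\<exists>i\<in>I - {k}. x i \<noteq> 0" "\<forall>l\<in>J. (\<Sum>i\<in>I - {k}. b l i * x i) = 0"
      using insert.IH[of "I - {k}" b] insert.prems(1) by auto
    define y where "y = x(k := - (\<Sum>i\<in>I - {k}. a j i * x i) / a j k)"
    have split: "(\<Sum>i\<in>I. a l i * y i) = a l k * y k + (\<Sum>i\<in>I - {k}. a l i * x i)" for l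
      unfolding sum.remove[OF insert.prems(1) k(1)] by (auto simp: y_def intro!: sum.cong)
    have yk: "y k = - (\<Sum>i\<in>I - {k}. a j i * x i) / a j k" by (simp add: y_def)
    have "(\<Sum>i\<in>I. a l i * y i) = 0" if l: "l \<in> insert j J" for l
    proof (cases "l = j")
      case True
      then show ?thesis unfolding split yk using k(2) by simp
    next
      case False
      then have "(\<Sum>i\<in>I - {k}. a l i * x i) - a l k / a j k * (\<Sum>i\<in>I - {k}. a j i * x i) = 0"
        using x(2) l by (simp add: b_def left_diff_distrib sum_subtractf sum_distrib_left mult.assoc)
      then show ?thesis unfolding split yk by simp
    qed
    moreover have "\<exists>i\<in>I. y i \<noteq> 0" using x(1) by (auto simp: y_def)
    ultimately show ?thesis by blast
  qed
qed

lemma dual_space_sum: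
  assumes S: "\<And>s t. s \<in> S \<Longrightarrow> t \<in> S \<Longrightarrow> (\<lambda>x. s x + t x) \<in> S" "\<And>a s. s \<in> S \<Longrightarrow> (\<lambda>x. a * s x) \<in> S" "(\<lambda>x. 0) \<in> S"
    and f: "f \<in> dual_space S" and I: "finite I" and s: "\<And>i. i \<in> I \<Longrightarrow> s i \<in> S"
  shows "f (\<lambda>x. \<Sum>i\<in>I. c i * s i x) = (\<Sum>i\<in>I. c i * f (s i))" "(\<lambda>x. \<Sum>i\<in>I. c i * s i x) \<in> S"
proof -
  have z: "f (\<lambda>x. 0) = 0"
  proof -
    have "\<forall>c. \<forall>s\<in>S. f (\<lambda>x. c * s x) = c * f s" using f by (simp add: dual_space_def)
    from this[rule_format, OF S(3), of 0] show ?thesis by simp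
  qed
  have "f (\<lambda>x. \<Sum>i\<in>I. c i * s i x) = (\<Sum>i\<in>I. c i * f (s i)) \<and> (\<lambda>x. \<Sum>i\<in>I. c i * s i x) \<in> S"
    using I s
  proof (induction I rule: finite_induct)
    case empty
    then show ?case using z S(3) by simp
  next
    case (insert i I)
    have si: "(\<lambda>x. c i * s i x) \<in> S" using S(2) insert.prems by simp
    have IH: "f (\<lambda>x. \<Sum>i\<in>I. c i * s i x) = (\<Sum>i\<in>I. c i * f (s i))" "(\<lambda>x. \<Sum>i\<in>I. c i * s i x) \<in> S"
      using insert.IH insert.prems by simp_all
    have "f (\<lambda>x. c i * s i x + (\<Sum>i\<in>I. c i * s i x)) = f (\<lambda>x. c i * s i x) + f (\<lambda>x. \<Sum>i\<in>I. c i * s i x)"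
      using f si IH(2) by (simp add: dual_space_def)
    moreover have "f (\<lambda>x. c i * s i x) = c i * f (s i)" using f insert.prems by (simp add: dual_space_def)
    ultimately show ?case using insert.hyps IH S(1)[OF si IH(2)] by simp
  qed
  then show "f (\<lambda>x. \<Sum>i\<in>I. c i * s i x) = (\<Sum>i\<in>I. c i * f (s i))" "(\<lambda>x. \<Sum>i\<in>I. c i * s i x) \<in> S" by auto
qed

text \<open>Interpolation provides a dual family indexed by \<open>\<Lambda>\<close>. A smaller
  determining set would annihilate a nontrivial combination of it; that combination would be zero,
  against duality.\<close>

lemma minimal_determining_setI:
  assumes S: "\<And>s t. s \<in> S \<Longrightarrow> t \<in> S \<Longrightarrow> (\<lambda>x. s x + t x) \<in> S" "\<And>a s. s \<in> S \<Longrightarrow> (\<lambda>x. a * s x) \<in> S" "(\<lambda>x. 0) \<in> S"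
    and det: "determining_set S \<Lambda>" and fin: "finite \<Lambda>"
    and interp: "\<And>g. \<exists>s\<in>S. \<forall>f\<in>\<Lambda>. f s = g f"
  shows "minimal_determining_set S \<Lambda>"
  unfolding minimal_determining_set_def
proof (intro conjI allI impI fin det)
  fix \<Lambda>' assume \<Lambda>': "finite \<Lambda>' \<and> determining_set S \<Lambda>'"
  show "card \<Lambda> \<le> card \<Lambda>'"
  proof (rule ccontr)
    assume "\<not> card \<Lambda> \<le> card \<Lambda>'"
    have "\<forall>f. \<exists>s\<in>S. \<forall>g\<in>\<Lambda>. g s = (if g = f then 1 else 0)" by (intro allI interp)
    then obtain \<sigma> where \<sigma>: "\<And>f. \<sigma> f \<in> S" "\<And>f g. g \<in> \<Lambda> \<Longrightarrow> g (\<sigma> f) = (if g = f then 1 else 0)" by metis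
    have fin': "finite \<Lambda>'" and lt: "card \<Lambda>' < card \<Lambda>" using \<Lambda>' \<open>\<not> card \<Lambda> \<le> card \<Lambda>'\<close> by simp_all
    have "\<exists>x. (\<exists>f\<in>\<Lambda>. x f \<noteq> 0) \<and> (\<forall>g\<in>\<Lambda>'. (\<Sum>f\<in>\<Lambda>. g (\<sigma> f) * x f) = 0)"
      by (rule underdetermined_system[OF fin' fin lt])
    then obtain x where x: "\<exists>f\<in>\<Lambda>. x f \<noteq> 0" "\<forall>g\<in>\<Lambda>'. (\<Sum>f\<in>\<Lambda>. g (\<sigma> f) * x f) = 0"
      by (elim exE conjE)
    note d' = conjunct2[OF \<Lambda>', unfolded determining_set_def]
    note sub' = conjunct1[OF d'] and det' = conjunct2[OF d']
    define t where "t = (\<lambda>z. \<Sum>f\<in>\<Lambda>. x f * \<sigma> f z)"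
    have t0: "g t = 0" if "g \<in> \<Lambda>'" for g
    proof -
      have gd: "g \<in> dual_space S" using sub' that by blast
      have "g t = (\<Sum>f\<in>\<Lambda>. x f * g (\<sigma> f))"
        unfolding t_def by (rule dual_space_sum(1)[where s = \<sigma>, OF S gd fin \<sigma>(1)])
      also have "\<dots> = (\<Sum>f\<in>\<Lambda>. g (\<sigma> f) * x f)" by (rule sum.cong) simp_all
      also have "\<dots> = 0" using x(2) that by blast
      finally show ?thesis .
    qed
    note sub = conjunct1[OF det[unfolded determining_set_def]]
    obtain f where f: "f \<in> \<Lambda>" "x f \<noteq> 0" using x(1) by blast
    have fd: "f \<in> dual_space S" using sub f(1) by blast
    have "t \<in> S" unfolding t_def by (rule dual_space_sum(2)[where s = \<sigma>, OF S fd fin \<sigma>(1)])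
    then have "t = (\<lambda>x. 0)" using det' t0 by blast
    moreover have "f t = (\<Sum>g\<in>\<Lambda>. x g * f (\<sigma> g))"
      unfolding t_def by (rule dual_space_sum(1)[where s = \<sigma>, OF S fd fin \<sigma>(1)])
    moreover have "(\<Sum>g\<in>\<Lambda>. x g * f (\<sigma> g)) = x f"
    proof -
      have "(\<Sum>g\<in>\<Lambda>. x g * f (\<sigma> g)) = (\<Sum>g\<in>\<Lambda>. if g = f then x f else 0)"
        by (rule sum.cong[OF refl]) (simp add: \<sigma>(2)[OF f(1)])
      then show ?thesis using fin f by simp
    qed
    moreover have "f (\<lambda>x. 0) = 0"
    proof -
      have "\<forall>c. \<forall>s\<in>S. f (\<lambda>x. c * s x) = c * f s" using fd by (simp add: dual_space_def)
      from this[rule_format, OF S(3), of 0] show ?thesis by simp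
    qed
    ultimately have "x f = 0" by (simp only:)
    then show False using f(2) by blast
  qed
qed

subsection \<open>The determining set\<close>

context conic_stable
begin

definition functional :: "cell \<Rightarrow> complex \<Rightarrow> functional" where
  "functional T \<xi> = (\<lambda>s\<in>splines. coeff_at T s \<xi>)"

definition MDS :: "functional set" where
  "MDS = {functional T \<xi> | T \<xi>. T \<in> \<T> \<and> \<xi> \<in> free T}"

lemma functional_apply: "s \<in> splines \<Longrightarrow> functional T \<xi> s = coeff_at T s \<xi>"
  by (simp add: functional_def)

lemma functional_eqI: "(\<And>s. s \<in> splines \<Longrightarrow> coeff_at T s \<xi> = coeff_at T' s \<xi>') \<Longrightarrow> functional T \<xi> = functional T' \<xi>'"
  unfolding functional_def by (rule restrict_ext)

lemma straight_functional_eq: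
  assumes "T \<notin> pies n \<gamma> \<T>" "cell_degree T = k"
  shows "straight_functional splines k T \<xi> = functional T \<xi>"
proof -
  have "weight T = (\<lambda>x. 1)" using assms(1) by (simp add: weight_def)
  then show ?thesis
    using assms points_straight[OF assms(1)] by (simp add: straight_functional_def functional_def coeff_at_def)
qed

lemma pie_functional_eq:
  assumes "T \<in> \<T>" "pie j v T"
  shows "pie_functional splines (q j) v (d - 1) T \<xi> = functional T \<xi>"
  by (simp add: pie_functional_def functional_def coeff_at_def pie_eq[OF assms])

lemma M0_eq: "M0 \<Omega> n \<gamma> q \<T> d = MDS"
proof -
  have o: "T \<in> \<T> \<and> T \<notin> pies n \<gamma> \<T> \<and> cell_degree T = d \<and> free T = domain_points (verts T) d - frontier \<Omega>"
    if "T \<in> ordinaries n \<gamma> \<T>" for T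
    using that degree_pos by (auto simp: ordinary_iff cell_degree_def free_def pie_points_pos)
  have b: "T \<in> \<T> \<and> T \<notin> pies n \<gamma> \<T> \<and> cell_degree T = d + 1 \<and> free T = buffer_points \<Omega> n \<gamma> \<T> (d + 1) T"
    if "T \<in> buffers n \<gamma> \<T>" for T
    using that buffer_not_pie[OF that] buffer_in_mesh[OF that] by (auto simp: cell_degree_def free_def)
  have p: "T \<in> \<T> \<and> free T = pie_points v (verts T) (d - 1)" if "T \<in> pies n \<gamma> \<T>" "pie j v T" for T j v
    using that pie_eq[of T j v] by (auto simp: pies_iff free_def)
  show ?thesis
  proof (intro equalityI subsetI)
    fix f assume "f \<in> M0 \<Omega> n \<gamma> q \<T> d"
    then consider T \<xi> where "f = straight_functional splines d T \<xi>" "T \<in> ordinaries n \<gamma> \<T>" "\<xi> \<in> domain_points (verts T) d - frontier \<Omega>"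
      | T j v \<xi> where "f = pie_functional splines (q j) v (d - 1) T \<xi>" "T \<in> pies n \<gamma> \<T>" "pie j v T" "\<xi> \<in> pie_points v (verts T) (d - 1)"
      | T \<xi> where "f = straight_functional splines (d + 1) T \<xi>" "T \<in> buffers n \<gamma> \<T>" "\<xi> \<in> buffer_points \<Omega> n \<gamma> \<T> (d + 1) T"
      unfolding M0_def Let_def by blast
    then show "f \<in> MDS"
    proof cases
      case 1
      then show ?thesis using o[OF 1(2)] straight_functional_eq[of T d \<xi>] unfolding MDS_def by auto
    next
      case 2
      then show ?thesis using p[OF 2(2,3)] pie_functional_eq[of T j v \<xi>] unfolding MDS_def by auto
    next
      case 3
      then show ?thesis using b[OF 3(2)] straight_functional_eq[of T "d + 1" \<xi>] unfolding MDS_def by auto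
    qed
  next
    fix f assume "f \<in> MDS"
    then obtain T \<xi> where f: "f = functional T \<xi>" "T \<in> \<T>" "\<xi> \<in> free T" unfolding MDS_def by blast
    show "f \<in> M0 \<Omega> n \<gamma> q \<T> d"
    proof (rule mesh_cases[OF f(2)])
      assume T: "T \<in> ordinaries n \<gamma> \<T>"
      then have "f = straight_functional splines d T \<xi>" "\<xi> \<in> domain_points (verts T) d - frontier \<Omega>"
        using o[OF T] straight_functional_eq[of T d \<xi>] f by simp_all
      then show ?thesis using T unfolding M0_def Let_def by blast
    next
      assume T: "T \<in> pies n \<gamma> \<T>"
      then obtain j v where j: "pie j v T" by (rule pieE)
      then have "f = pie_functional splines (q j) v (d - 1) T \<xi>" "\<xi> \<in> pie_points v (verts T) (d - 1)"
        using p[OF T j] pie_functional_eq[OF f(2) j, of \<xi>] f by simp_all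
      then show ?thesis using T j unfolding M0_def Let_def by blast
    next
      assume T: "T \<in> buffers n \<gamma> \<T>"
      then have "f = straight_functional splines (d + 1) T \<xi>" "\<xi> \<in> buffer_points \<Omega> n \<gamma> \<T> (d + 1) T"
        using b[OF T] straight_functional_eq[of T "d + 1" \<xi>] f by simp_all
      then show ?thesis using T unfolding M0_def Let_def by blast
    qed
  qed
qed

lemma finite_free: "T \<in> \<T> \<Longrightarrow> finite (free T)"
  using finite_subset[OF free_subset finite_pie_points[OF independent_cell(1)]] .

lemma finite_MDS: "finite MDS"
proof -
  have "MDS = (\<Union>T\<in>\<T>. functional T ` free T)" by (auto simp: MDS_def)
  then show ?thesis using finite_mesh finite_free by simp
qed

lemma MDS_dual: "MDS \<subseteq> dual_space splines"
proof
  fix f assume "f \<in> MDS"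
  then obtain T \<xi> where f: "f = functional T \<xi>" "T \<in> \<T>" by (auto simp: MDS_def)
  show "f \<in> dual_space splines" unfolding dual_space_def f(1)
    by (auto simp: functional_apply splines_add splines_scale coeff_at_add[OF _ _ f(2)] coeff_at_scale[OF _ f(2)])
       (simp add: functional_def)
qed

text \<open>Data that depend on the functional only are compatible by construction.\<close>

lemma MDS_interpolation: "\<exists>s\<in>splines. \<forall>f\<in>MDS. f s = g f"
proof -
  have "\<exists>s\<in>splines. \<forall>T\<in>\<T>. \<forall>\<xi>\<in>free T. coeff_at T s \<xi> = g (functional T \<xi>)"
  proof (rule spline_interpolation)
    fix T T' \<xi> assume "\<And>s. s \<in> splines \<Longrightarrow> coeff_at T s \<xi> = coeff_at T' s \<xi>"
    then have "functional T \<xi> = functional T' \<xi>" by (rule functional_eqI)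
    then show "g (functional T \<xi>) = g (functional T' \<xi>)" by simp
  qed
  then obtain s where s: "s \<in> splines" "\<forall>T\<in>\<T>. \<forall>\<xi>\<in>free T. coeff_at T s \<xi> = g (functional T \<xi>)" by blast
  have "f s = g f" if f: "f \<in> MDS" for f
  proof -
    obtain T \<xi> where "f = functional T \<xi>" "T \<in> \<T>" "\<xi> \<in> free T" using f unfolding MDS_def by blast
    then show ?thesis using s(2) functional_apply[OF s(1), of T \<xi>] by simp
  qed
  then show ?thesis using s(1) by blast
qed

text \<open>Cutting the indicator of a functional off outside of \<open>T1\<close> shows where a functional can be represented.\<close>

lemma functional_location:
  assumes T1: "T1 \<in> \<T>" "\<xi>1 \<in> free T1" and T2: "T2 \<in> \<T>" "\<xi>2 \<in> free T2"
    and eq: "functional T1 \<xi>1 = functional T2 \<xi>2"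
  shows "T1 = T2 \<or> \<xi>2 \<in> region T1 \<inter> region T2"
proof (rule ccontr)
  assume no: "\<not> ?thesis"
  \<comment> \<open>Compatibility survives the cut because it only compares points lying in both
    regions. The clause \<open>T = T1\<close> is there for pies, whose domain points may lie outside
    their region.\<close>
  define c where "c T \<xi> = (if (T = T1 \<or> \<xi> \<in> region T1 \<inter> region T) \<and> functional T \<xi> = functional T1 \<xi>1 then 1 else 0 :: real)" for T \<xi>
  have "\<exists>s\<in>splines. \<forall>T\<in>\<T>. \<forall>\<xi>\<in>free T. coeff_at T s \<xi> = c T \<xi>"
  proof (rule spline_interpolation)
    fix T T' \<xi> assume a: "\<xi> \<in> region T" "\<xi> \<in> region T'" "\<And>s. s \<in> splines \<Longrightarrow> coeff_at T s \<xi> = coeff_at T' s \<xi>"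
    then have "functional T \<xi> = functional T' \<xi>" by (intro functional_eqI)
    then show "c T \<xi> = c T' \<xi>" using a(1,2) by (auto simp: c_def)
  qed
  then obtain s where s: "s \<in> splines" "coeff_at T1 s \<xi>1 = c T1 \<xi>1" "coeff_at T2 s \<xi>2 = c T2 \<xi>2" using assms by blast
  have "c T1 \<xi>1 = 1" "c T2 \<xi>2 = 0" using no by (auto simp: c_def)
  then show False using s eq functional_apply[OF s(1), of T1 \<xi>1] functional_apply[OF s(1), of T2 \<xi>2] by simp
qed

text \<open>On an edge shared with an ordinary or pie-shaped triangle, the coefficients of a buffer triangle
  are not free: they are determined by the values of the neighbour along the edge.\<close>

definition neighbour :: "complex set \<Rightarrow> cell" where
  "neighbour e = (SOME T. T \<in> ordinaries n \<gamma> \<T> \<union> pies n \<gamma> \<T> \<and> e \<in> edges T)"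

definition shared_edges :: "cell \<Rightarrow> complex set set" where
  "shared_edges T = {e \<in> edges T. T \<in> buffers n \<gamma> \<T> \<and> (\<exists>T'\<in>ordinaries n \<gamma> \<T> \<union> pies n \<gamma> \<T>. e \<in> edges T')}"

text \<open>Enough to control a spline on \<open>T\<close>, yet bounded in number: one chosen
  neighbour per shared edge, and only its functionals at points of that edge.\<close>

definition local_set :: "cell \<Rightarrow> functional set" where
  "local_set T = functional T ` free T \<union> (\<Union>e\<in>shared_edges T. functional (neighbour e) ` (free (neighbour e) \<inter> e))"

lemma neighbour:
  assumes "e \<in> shared_edges T"
  shows "neighbour e \<in> \<T>" "neighbour e \<notin> buffers n \<gamma> \<T>" "e \<in> edges (neighbour e)"
proof -
  have "neighbour e \<in> ordinaries n \<gamma> \<T> \<union> pies n \<gamma> \<T> \<and> e \<in> edges (neighbour e)"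
    unfolding neighbour_def by (rule someI_ex) (use assms in \<open>auto simp: shared_edges_def\<close>)
  then show "neighbour e \<in> \<T>" "neighbour e \<notin> buffers n \<gamma> \<T>" "e \<in> edges (neighbour e)"
    using buffer_not_pie by (auto simp: ordinary_iff pies_iff)
qed

lemma local_setE:
  assumes T: "T \<in> \<T>" and f: "f \<in> local_set T"
  obtains T' \<xi> where "T' \<in> \<T>" "\<xi> \<in> free T'" "f = functional T' \<xi>" "T' = T \<or> \<xi> \<in> region T \<inter> region T'"
proof -
  consider \<xi> where "\<xi> \<in> free T" "f = functional T \<xi>"
    | e \<xi> where "e \<in> shared_edges T" "\<xi> \<in> free (neighbour e)" "\<xi> \<in> e" "f = functional (neighbour e) \<xi>"
    using f unfolding local_set_def by blast
  then show thesis
  proof cases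
    case 1
    then show thesis using that[OF T] by blast
  next
    case 2
    note nb = neighbour[OF 2(1)]
    have "e \<in> edges T" using 2(1) by (simp add: shared_edges_def)
    then have "\<xi> \<in> region T \<inter> region (neighbour e)"
      using edge_subset_region'[OF T] edge_subset_region'[OF nb(1,3)] 2(3) by blast
    then show thesis using that[OF nb(1) 2(2,4)] by blast
  qed
qed

lemma local_set_subset: "T \<in> \<T> \<Longrightarrow> local_set T \<subseteq> MDS"
proof
  fix f assume "T \<in> \<T>" "f \<in> local_set T"
  then obtain T' \<xi> where "T' \<in> \<T>" "\<xi> \<in> free T'" "f = functional T' \<xi>" by (rule local_setE)
  then show "f \<in> MDS" unfolding MDS_def by blast
qed

text \<open>Counted generously by the ordered pairs of the three vertices.\<close>

lemma finite_edges: "T \<in> \<T> \<Longrightarrow> finite (edges T) \<and> card (edges T) \<le> 9"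
proof -
  assume T: "T \<in> \<T>"
  have V: "finite (verts T)" "card (verts T) = 3" using independent_cell[OF T] by (auto simp: independent_verts_def)
  have sub: "edges T \<subseteq> (\<lambda>(u, w). closed_segment u w) ` (verts T \<times> verts T)"
    by (auto simp: straight_edges_def)
  have "card ((\<lambda>(u, w). closed_segment u w) ` (verts T \<times> verts T)) \<le> card (verts T \<times> verts T)"
    using V(1) by (intro card_image_le) simp
  also have "\<dots> = 9" by (simp add: V card_cartesian_product)
  finally have "card ((\<lambda>(u, w). closed_segment u w) ` (verts T \<times> verts T)) \<le> 9" .
  moreover have fin: "finite ((\<lambda>(u, w). closed_segment u w) ` (verts T \<times> verts T))" using V(1) by simp
  ultimately show ?thesis using card_mono[OF fin sub] finite_subset[OF sub fin] by linarith
qed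

lemma card_free: "T \<in> \<T> \<Longrightarrow> card (free T) \<le> (d + 2) ^ 3"
proof -
  assume T: "T \<in> \<T>"
  have "card (free T) \<le> card (points T)"
    by (rule card_mono[OF finite_pie_points[OF independent_cell(1)[OF T]] free_subset[OF T]])
  also have "\<dots> \<le> (cell_degree T + 1) ^ 3"
    using card_pie_points_le[OF independent_cell(1)[OF T]] by (simp add: independent_cell(2)[OF T])
  also have "\<dots> \<le> (d + 2) ^ 3" by (intro power_mono) (auto simp: cell_degree_def)
  finally show ?thesis .
qed

lemma card_local_set: 
  assumes T: "T \<in> \<T>"
  shows "finite (local_set T)" "card (local_set T) \<le> 10 * (d + 2) ^ 3"
proof -
  have se: "shared_edges T \<subseteq> edges T" by (auto simp: shared_edges_def)
  have fe: "finite (edges T)" "card (edges T) \<le> 9" using finite_edges[OF T] by simp_all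
  have fs: "finite (shared_edges T)" "card (shared_edges T) \<le> 9"
    using finite_subset[OF se fe(1)] order_trans[OF card_mono[OF fe(1) se] fe(2)] by simp_all
  have nb: "card (functional (neighbour e) ` (free (neighbour e) \<inter> e)) \<le> (d + 2) ^ 3" if "e \<in> shared_edges T" for e
  proof -
    have "card (functional (neighbour e) ` (free (neighbour e) \<inter> e)) \<le> card (free (neighbour e) \<inter> e)"
      using finite_free[OF neighbour(1)[OF that]] by (intro card_image_le) simp
    also have "\<dots> \<le> card (free (neighbour e))" using finite_free[OF neighbour(1)[OF that]] by (intro card_mono) auto
    finally show ?thesis using card_free[OF neighbour(1)[OF that]] by simp
  qed
  have "card (\<Union>e\<in>shared_edges T. functional (neighbour e) ` (free (neighbour e) \<inter> e)) \<le>
      (\<Sum>e\<in>shared_edges T. card (functional (neighbour e) ` (free (neighbour e) \<inter> e)))"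
    by (rule card_UN_le[OF fs(1)])
  also have "\<dots> \<le> of_nat (card (shared_edges T)) * (d + 2) ^ 3" by (rule sum_bounded_above) (rule nb)
  also have "\<dots> \<le> 9 * (d + 2) ^ 3" using fs(2) by (intro mult_right_mono) auto
  finally have 1: "card (\<Union>e\<in>shared_edges T. functional (neighbour e) ` (free (neighbour e) \<inter> e)) \<le> 9 * (d + 2) ^ 3" .
  have 2: "card (functional T ` free T) \<le> (d + 2) ^ 3"
    using card_image_le[OF finite_free[OF T], of "functional T"] card_free[OF T] by simp
  show "finite (local_set T)"
    unfolding local_set_def using finite_free[OF T] fs(1) finite_free neighbour(1) by auto
  have "card (local_set T) \<le> card (functional T ` free T) +
      card (\<Union>e\<in>shared_edges T. functional (neighbour e) ` (free (neighbour e) \<inter> e))"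
    unfolding local_set_def by (rule card_Un_le)
  then show "card (local_set T) \<le> 10 * (d + 2) ^ 3" using 1 2 by simp
qed

text \<open>Dominates the factor in \<open>abs_bb_sum_le\<close> for all degrees up to
  \<open>d + 1\<close>, on triangles and on edges.\<close>

definition sum_constant :: real where
  "sum_constant = real (d + 2) ^ 3 * fact (d + 1)"

lemma sum_constant_ge:
  assumes "k \<le> d + 1" "m \<le> 3"
  shows "(real k + 1) ^ m * fact k \<le> sum_constant"
proof -
  have "real (k + 1) ^ m \<le> real (d + 2) ^ m" using assms by (intro power_mono) auto
  also have "\<dots> \<le> real (d + 2) ^ 3" using assms by (intro power_increasing) auto
  finally have "real (k + 1) ^ m * fact k \<le> real (d + 2) ^ 3 * fact (d + 1)"
    using assms by (intro mult_mono fact_mono) auto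
  then show ?thesis by (simp only: sum_constant_def of_nat_add of_nat_1)
qed

lemma abs_bb_sum_le_const:
  assumes V: "independent_verts V" "card V \<le> 3" "k \<le> d + 1" and x: "x \<in> convex hull V"
    and c: "\<And>\<xi>. \<xi> \<in> pie_points v V k \<Longrightarrow> \<bar>c \<xi>\<bar> \<le> M" and M: "0 \<le> M"
  shows "\<bar>bb_sum v V k c x\<bar> \<le> sum_constant * M"
proof -
  have "\<bar>bb_sum v V k c x\<bar> \<le> (real k + 1) ^ card V * fact k * M" by (rule abs_bb_sum_le[OF V(1) x _ M]) (rule c)
  also have "\<dots> \<le> sum_constant * M" by (rule mult_right_mono[OF sum_constant_ge[OF V(3,2)] M])
  finally show ?thesis .
qed

text \<open>The first summand serves ordinary and buffer cells: its bracket turns the bound on a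
  shared edge, obtained from the neighbour, back into coefficients, with 2 for the vertices of an
  edge. The second serves pies.\<close>

definition norm_constant :: real where
  "norm_constant = sum_constant * (1 + bb_bound 2 (d + 1) * (max 1 A * sum_constant))
     + max 1 A * (growth (d - 1) spread * sum_constant)"

lemma sum_constant_pos: "0 < sum_constant"
  unfolding sum_constant_def by (intro mult_pos_pos zero_less_power fact_gt_zero) simp

lemma spread_ge_1: "1 \<le> spread"
  by (simp add: spread_def)

lemma norm_constant_ge:
  "sum_constant \<le> norm_constant"
  "max 1 A * (growth (d - 1) spread * sum_constant) \<le> norm_constant"
  "sum_constant * (1 + bb_bound 2 (d + 1) * (max 1 A * sum_constant)) \<le> norm_constant"
  "0 \<le> norm_constant"
proof -
  have mx: "0 \<le> max 1 A" by simp
  have "0 \<le> max 1 A * (growth (d - 1) spread * sum_constant)" "0 \<le> bb_bound 2 (d + 1) * (max 1 A * sum_constant)"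
    using growth_nonneg[of spread "d - 1"] sum_constant_pos bb_bound_nonneg[of 2 "d + 1"] spread_ge_1 mx
    by (intro mult_nonneg_nonneg; linarith)+
  moreover have "sum_constant * 1 \<le> sum_constant * (1 + bb_bound 2 (d + 1) * (max 1 A * sum_constant))"
    using calculation(2) sum_constant_pos by (intro mult_left_mono) auto
  ultimately show "sum_constant \<le> norm_constant"
    "max 1 A * (growth (d - 1) spread * sum_constant) \<le> norm_constant"
    "sum_constant * (1 + bb_bound 2 (d + 1) * (max 1 A * sum_constant)) \<le> norm_constant" "0 \<le> norm_constant"
    using sum_constant_pos unfolding norm_constant_def by linarith+
qed

text \<open>A coefficient of a non-buffer cell that is not free sits on the boundary and
  vanishes.\<close>

lemma coeff_bound_nonbuffer:
  assumes T: "T \<in> \<T>" "T \<notin> buffers n \<gamma> \<T>" and s: "s \<in> splines" and x: "\<xi> \<in> points T"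
    and f: "\<xi> \<in> free T \<Longrightarrow> \<bar>coeff_at T s \<xi>\<bar> \<le> M" and M: "0 \<le> M"
  shows "\<bar>coeff_at T s \<xi>\<bar> \<le> M"
proof (cases "\<xi> \<in> free T")
  case False
  then have "T \<notin> pies n \<gamma> \<T>" "\<xi> \<in> frontier \<Omega>" using T x by (auto simp: free_def split: if_splits)
  then show ?thesis using coeff_at_frontier[OF T(1) _ s x] M by simp
qed (rule f)

text \<open>On a buffer the coefficients along a shared edge are not given directly; the neighbour
  bounds the values of \<open>s\<close> on the edge, and these bound the coefficients. A pie may
  protrude from its straight triangle, so there the cofactor is extended from a common disc by
  \<open>poly2_growth\<close>.\<close>

lemma spline_norm_le:
  assumes T: "T \<in> \<T>" and s: "s \<in> splines" and M: "0 \<le> M"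
    and f: "\<And>f. f \<in> local_set T \<Longrightarrow> \<bar>f s\<bar> \<le> M" and x: "x \<in> region T"
  shows "\<bar>s x\<bar> \<le> norm_constant * M"
proof -
  note V = independent_cell[OF T]
  have own: "\<bar>coeff_at T s \<xi>\<bar> \<le> M" if "\<xi> \<in> free T" for \<xi>
    using f[of "functional T \<xi>"] that functional_apply[OF s] by (simp add: local_set_def)
  have deg: "cell_degree T \<le> d + 1" unfolding cell_degree_def by auto
  show ?thesis
  proof (rule mesh_cases[OF T])
    assume O: "T \<in> ordinaries n \<gamma> \<T>"
    then have nb: "T \<notin> pies n \<gamma> \<T>" "T \<notin> buffers n \<gamma> \<T>" by (auto simp: ordinary_iff)
    have "\<bar>bb_sum (apex T) (verts T) (cell_degree T) (coeff_at T s) x\<bar> \<le> sum_constant * M"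
      using x straight_boundary[OF T nb(1)] V deg coeff_bound_nonbuffer[OF T nb(2) s _ own M] M
      by (intro abs_bb_sum_le_const) auto
    then have "\<bar>s x\<bar> \<le> sum_constant * M"
      using spline_eq_cell_sum[OF s T x] straight_bb_sum(1)[OF nb(1), of _ _ "apex T"] by simp
    also have "\<dots> \<le> norm_constant * M" using norm_constant_ge(1) M by (rule mult_right_mono)
    finally show ?thesis .
  next
    assume P: "T \<in> pies n \<gamma> \<T>"
    then have nb: "T \<notin> buffers n \<gamma> \<T>" using buffer_not_pie by blast
    define p where "p = bb_sum (apex T) (verts T) (cell_degree T) (coeff_at T s)"
    have k: "cell_degree T = d - 1" using P by (simp add: cell_degree_def)
    have p2: "p \<in> poly2 (d - 1)" unfolding p_def k by (rule bb_sum_poly2[OF V])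
    have pT: "\<bar>p y\<bar> \<le> sum_constant * M" if "y \<in> convex hull (verts T)" for y
      unfolding p_def using that V deg coeff_bound_nonbuffer[OF T nb s _ own M] M
      by (intro abs_bb_sum_le_const) auto
    obtain c r where cr: "0 < r" "cball c r \<subseteq> region T" "cball c r \<subseteq> convex hull (verts T)"
      "diameter (region T) \<le> 2 * R * r" by (rule inscribed_disc[OF T])
    have "c \<in> region T" using cr(1,2) by auto
    then have "dist c x \<le> 2 * R * r" using diameter_bound[OF T _ x] cr(4) by fastforce
    also have "\<dots> \<le> spread * r" using cr(1) constants_pos(1) by (intro mult_right_mono) (auto simp: spread_def)
    finally have "\<bar>p x\<bar> \<le> growth (d - 1) spread * (sum_constant * M)"
      using cr(1,3) pT by (intro poly2_growth[of p "d - 1" r spread c x])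
        (use p2 spread_ge_1 in auto)
    then have "\<bar>weight T x\<bar> * \<bar>p x\<bar> \<le> max 1 A * (growth (d - 1) spread * (sum_constant * M))"
      using weight_le[OF T x] by (intro mult_mono) auto
    then have "\<bar>s x\<bar> \<le> max 1 A * (growth (d - 1) spread * sum_constant) * M"
      using spline_eq_cell_sum[OF s T x] by (simp add: cell_sum_def p_def abs_mult mult.assoc)
    also have "\<dots> \<le> norm_constant * M" using norm_constant_ge(2) M by (rule mult_right_mono)
    finally show ?thesis .
  next
    assume Bf: "T \<in> buffers n \<gamma> \<T>"
    have np: "T \<notin> pies n \<gamma> \<T>" using buffer_not_pie[OF Bf] .
    have k: "cell_degree T = d + 1" using Bf np by (simp add: cell_degree_def)
    define C where "C = 1 + bb_bound 2 (d + 1) * (max 1 A * sum_constant)"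
    have C: "0 \<le> bb_bound 2 (d + 1) * (max 1 A * sum_constant)"
      using bb_bound_nonneg[of 2 "d + 1"] sum_constant_pos by (intro mult_nonneg_nonneg) simp_all
    have "\<bar>coeff_at T s \<xi>\<bar> \<le> C * M" if xi: "\<xi> \<in> points T" for \<xi>
    proof -
      have MC: "M \<le> C * M" using C M by (simp add: C_def distrib_right)
      consider "\<xi> \<in> free T" | "\<xi> \<in> frontier \<Omega>" | e where "e \<in> shared_edges T" "\<xi> \<in> e"
      proof -
        have "free T = buffer_points \<Omega> n \<gamma> \<T> (d + 1) T" using Bf np by (simp add: free_def)
        moreover have "\<xi> \<in> domain_points (verts T) (d + 1)" using xi points_straight[OF np] k by simp
        ultimately have "\<xi> \<in> free T \<or> \<xi> \<in> frontier \<Omega> \<or> (\<exists>e. e \<in> shared_edges T \<and> \<xi> \<in> e)"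
          using Bf unfolding buffer_points_def shared_edges_def by blast
        then show thesis using that by blast
      qed
      then show ?thesis
      proof cases
        case 1
        then show ?thesis using own MC by fastforce
      next
        case 2
        then show ?thesis using coeff_at_frontier[OF T np s xi] MC M by simp
      next
        case (3 e)
        define T' where "T' = neighbour e"
        note nb = neighbour[OF 3(1), folded T'_def]
        have eT: "e \<in> edges T" using 3(1) by (simp add: shared_edges_def)
        obtain u w where uw: "u \<in> verts T" "w \<in> verts T" "u \<noteq> w" "e = closed_segment u w" "e = convex hull {u, w}"
          by (rule edgesE[OF T eT]) (rule that)
        define F where "F = {u, w}"
        have F: "F \<subseteq> verts T" "card F = 2" "e = convex hull F" using uw by (auto simp: F_def)
        note ev = edge_verts[OF nb(1), of u w, folded uw(4), OF nb(3)]
        have F': "F \<subseteq> verts T'" using ev by (simp add: F_def)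
        note V' = independent_cell[OF nb(1)]
        have I: "independent_verts F" using independent_verts_subset[OF V(1) F(1)] by (auto simp: F_def)
        have deg': "cell_degree T' \<le> d + 1" unfolding cell_degree_def by auto
        obtain z where z: "z \<in> F" "points T' = pie_points z (verts T') (cell_degree T')"
          "bb_sum (apex T') (verts T') (cell_degree T') = bb_sum z (verts T') (cell_degree T')"
        proof (cases "T' \<in> pies n \<gamma> \<T>")
          case True
          then obtain j v where p: "pie j v T'" by (rule pieE)
          then have "apex T' \<in> F" using ev(4)[OF p] by (auto simp: pie_eq[OF nb(1) p] F_def)
          then show ?thesis using that by blast
        next
          case False
          show ?thesis
            by (rule that[of u]) (simp_all add: F_def straight_bb_sum(2)[OF False] bb_sum_pos[OF cell_degree_straight[OF False]])
        qed
        \<comment> \<open>Only coefficients of the neighbour at points of the edge enter, and each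
          of them is given by \<open>local_set T\<close> or is zero.\<close>
        have sle: "\<bar>s y\<bar> \<le> max 1 A * (sum_constant * M)" if y: "y \<in> convex hull F" for y
        proof -
          have yr: "y \<in> region T'" using edge_subset_region'[OF nb(1,3)] y F(3) by blast
          have "\<bar>coeff_at T' s \<eta>\<bar> \<le> M" if eta: "\<eta> \<in> pie_points z F (cell_degree T')" for \<eta>
          proof -
            have eta': "\<eta> \<in> points T'" "\<eta> \<in> e"
              using eta pie_points_face[OF V'(1) F' z(1)] z(2) F(3) by auto
            have "\<bar>coeff_at T' s \<eta>\<bar> \<le> M" if "\<eta> \<in> free T'"
            proof -
              have "functional T' \<eta> \<in> local_set T" unfolding local_set_def T'_def
                using 3(1) that eta'(2) by (auto simp: T'_def)
              from f[OF this] show ?thesis by (simp add: functional_apply[OF s])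
            qed
            then show ?thesis by (rule coeff_bound_nonbuffer[OF nb(1,2) s eta'(1) _ M])
          qed
          then have "\<bar>bb_sum z F (cell_degree T') (coeff_at T' s) y\<bar> \<le> sum_constant * M"
            using F(2) by (intro abs_bb_sum_le_const[OF I _ deg' y _ M]) auto
          then have "\<bar>weight T' y\<bar> * \<bar>bb_sum z (verts T') (cell_degree T') (coeff_at T' s) y\<bar> \<le> max 1 A * (sum_constant * M)"
            using weight_le[OF nb(1) yr] bb_sum_face[OF V'(1) F' z(1) y] by (intro mult_mono) auto
          then show ?thesis using spline_eq_cell_sum[OF s nb(1) yr] z(3) by (simp add: cell_sum_def abs_mult)
        qed
        have uF: "u \<in> F" by (simp add: F_def)
        have "\<bar>coeff_at T s \<xi>\<bar> \<le> bb_bound (card F) (d + 1) * (max 1 A * (sum_constant * M))"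
        proof (rule bb_coeff_le[OF I])
          show "\<xi> \<in> pie_points u F (d + 1)"
          proof -
            have "\<xi> \<in> pie_points u (verts T) (d + 1)" using xi straight_bb_sum(2)[OF np, of u] k by simp
            then show ?thesis unfolding pie_points_face[OF V(1) F(1) uF] using 3(2) F(3) by blast
          qed
          fix y assume y: "y \<in> convex hull F"
          have yr: "y \<in> region T" using edge_subset_region'[OF T eT] y F(3) by blast
          have "s y = cell_sum T (coeff_at T s) y" by (rule spline_eq_cell_sum[OF s T yr])
          also have "\<dots> = bb_sum u (verts T) (cell_degree T) (coeff_at T s) y" by (rule straight_bb_sum(1)[OF np])
          also have "\<dots> = bb_sum u F (d + 1) (coeff_at T s) y"
            unfolding k by (rule bb_sum_face[OF V(1) F(1) uF y])
          finally show "\<bar>bb_sum u F (d + 1) (coeff_at T s) y\<bar> \<le> max 1 A * (sum_constant * M)" using sle[OF y] by simp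
        qed
        also have "\<dots> \<le> C * M" using M by (simp add: C_def F(2) distrib_right mult.assoc)
        finally show ?thesis .
      qed
    qed
    then have "\<bar>bb_sum (apex T) (verts T) (cell_degree T) (coeff_at T s) x\<bar> \<le> sum_constant * (C * M)"
      using x straight_boundary[OF T np] V deg C M by (intro abs_bb_sum_le_const) (auto simp: C_def)
    then have "\<bar>s x\<bar> \<le> sum_constant * C * M"
      using spline_eq_cell_sum[OF s T x] straight_bb_sum(1)[OF np, of _ _ "apex T"] by (simp add: mult.assoc)
    also have "\<dots> \<le> norm_constant * M" using norm_constant_ge(3) M unfolding C_def by (rule mult_right_mono)
    finally show ?thesis .
  qed
qed

end

section \<open>Dual splines, covering number and locality\<close>

lemma dual_space_linear:
  assumes "f \<in> dual_space S"
  shows "s \<in> S \<Longrightarrow> t \<in> S \<Longrightarrow> f (\<lambda>x. s x + t x) = f s + f t" "s \<in> S \<Longrightarrow> f (\<lambda>x. c * s x) = c * f s"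
  using assms by (simp_all add: dual_space_def)

context conic_stable
begin

text \<open>The stability estimate with bound 0.\<close>

lemma spline_zero_on_cell:
  assumes "T \<in> \<T>" "s \<in> splines" "\<And>f. f \<in> local_set T \<Longrightarrow> f s = 0" "x \<in> region T"
  shows "s x = 0"
proof -
  have "\<bar>s x\<bar> \<le> norm_constant * 0"
    by (rule spline_norm_le[OF assms(1,2) order_refl _ assms(4)]) (simp add: assms(3))
  then show ?thesis by simp
qed

lemma spline_zeroI:
  assumes s: "s \<in> splines" and f: "\<And>f. f \<in> MDS \<Longrightarrow> f s = 0"
  shows "s = (\<lambda>x. 0)"
proof
  fix x
  show "s x = 0"
  proof (cases "x \<in> closure \<Omega>")
    case True
    then obtain T where T: "T \<in> \<T>" "x \<in> region T" using mesh_cover by blast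
    show ?thesis
      by (rule spline_zero_on_cell[OF T(1) s _ T(2)]) (use local_set_subset[OF T(1)] f in blast)
  next
    case False
    then show ?thesis using s by (auto simp: spline_space_def)
  qed
qed

lemma determining_MDS: "determining_set splines MDS"
  unfolding determining_set_def using MDS_dual spline_zeroI by blast

lemma minimal_determining_MDS: "minimal_determining_set splines MDS"
  by (rule minimal_determining_setI[OF splines_add splines_scale splines_zero determining_MDS finite_MDS MDS_interpolation])

lemma MDS_sum:
  assumes "f \<in> MDS" "finite I" "\<And>i. i \<in> I \<Longrightarrow> \<sigma> i \<in> splines"
  shows "f (\<lambda>x. \<Sum>i\<in>I. c i * \<sigma> i x) = (\<Sum>i\<in>I. c i * f (\<sigma> i))" "(\<lambda>x. \<Sum>i\<in>I. c i * \<sigma> i x) \<in> splines"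
proof -
  have fd: "f \<in> dual_space splines" using assms(1) MDS_dual by blast
  show "f (\<lambda>x. \<Sum>i\<in>I. c i * \<sigma> i x) = (\<Sum>i\<in>I. c i * f (\<sigma> i))"
    by (rule dual_space_sum(1)[OF splines_add splines_scale splines_zero fd assms(2,3)])
  show "(\<lambda>x. \<Sum>i\<in>I. c i * \<sigma> i x) \<in> splines"
    by (rule dual_space_sum(2)[OF splines_add splines_scale splines_zero fd assms(2,3)])
qed

lemma spline_eqI:
  assumes s: "s \<in> splines" and t: "t \<in> splines" and f: "\<And>f. f \<in> MDS \<Longrightarrow> f s = f t"
  shows "s = t"
proof -
  have m: "(\<lambda>x. (-1) * t x) \<in> splines" by (rule splines_scale[OF t])
  have "(\<lambda>x. s x + (-1) * t x) = (\<lambda>x. 0)"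
  proof (rule spline_zeroI[OF splines_add[OF s m]])
    fix g assume g: "g \<in> MDS"
    then have gd: "g \<in> dual_space splines" by (rule subsetD[OF MDS_dual])
    have "g (\<lambda>x. s x + (-1) * t x) = g s + g (\<lambda>x. (-1) * t x)" by (rule dual_space_linear(1)[OF gd s m])
    also have "g (\<lambda>x. (-1) * t x) = (-1) * g t" by (rule dual_space_linear(2)[OF gd t])
    finally show "g (\<lambda>x. s x + (-1) * t x) = 0" using f[OF g] by simp
  qed
  then have "s x + (-1) * t x = 0" for x by (rule fun_cong)
  then show ?thesis by (intro ext) (simp add: algebra_simps)
qed

abbreviation dual :: "functional \<Rightarrow> complex \<Rightarrow> real" where
  "dual \<equiv> dual_spline splines MDS"

lemma dual_spline:
  shows "dual f \<in> splines" and "g \<in> MDS \<Longrightarrow> g (dual f) = (if g = f then 1 else 0)"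
proof -
  have "\<exists>!s. s \<in> splines \<and> (\<forall>g\<in>MDS. g s = (if g = f then 1 else 0))"
  proof (rule ex_ex1I)
    show "\<exists>s. s \<in> splines \<and> (\<forall>g\<in>MDS. g s = (if g = f then 1 else 0))"
      using MDS_interpolation[of "\<lambda>g. if g = f then 1 else 0"] by blast
    fix s t assume "s \<in> splines \<and> (\<forall>g\<in>MDS. g s = (if g = f then 1 else 0))"
      "t \<in> splines \<and> (\<forall>g\<in>MDS. g t = (if g = f then 1 else 0))"
    then show "s = t" by (intro spline_eqI) simp_all
  qed
  from theI'[OF this]
  have *: "dual f \<in> splines \<and> (\<forall>g\<in>MDS. g (dual f) = (if g = f then 1 else 0))"
    unfolding dual_spline_def .
  show "dual f \<in> splines" using * by blast
  show "g \<in> MDS \<Longrightarrow> g (dual f) = (if g = f then 1 else 0)" using * by blast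
qed

lemma dual_combination:
  assumes F: "F \<subseteq> MDS" and g: "g \<in> MDS"
  shows "g (\<lambda>x. \<Sum>f\<in>F. c f * dual f x) = (if g \<in> F then c g else 0)"
    "(\<lambda>x. \<Sum>f\<in>F. c f * dual f x) \<in> splines"
proof -
  have fin: "finite F" by (rule finite_subset[OF F finite_MDS])
  note sum = MDS_sum[where \<sigma> = dual and c = c, OF g fin dual_spline(1)]
  have "(\<Sum>f\<in>F. c f * g (dual f)) = (\<Sum>f\<in>F. if f = g then c g else 0)"
    by (rule sum.cong[OF refl]) (auto simp: dual_spline(2)[OF g])
  also have "\<dots> = (if g \<in> F then c g else 0)" using fin by simp
  finally show "g (\<lambda>x. \<Sum>f\<in>F. c f * dual f x) = (if g \<in> F then c g else 0)" using sum(1) by simp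
  show "(\<lambda>x. \<Sum>f\<in>F. c f * dual f x) \<in> splines" by (rule sum(2))
qed

lemma spline_expansion:
  assumes s: "s \<in> splines"
  shows "s x = (\<Sum>f\<in>MDS. f s * dual f x)"
proof (cases "MDS = {}")
  case True
  then have "s = (\<lambda>x. 0)" by (intro spline_zeroI[OF s]) simp
  then show ?thesis using True by simp
next
  case False
  then obtain f0 where f0: "f0 \<in> MDS" by blast
  have "s = (\<lambda>x. \<Sum>f\<in>MDS. f s * dual f x)"
  proof (rule spline_eqI[OF s dual_combination(2)[OF order_refl f0]])
    fix g assume g: "g \<in> MDS"
    show "g s = g (\<lambda>x. \<Sum>f\<in>MDS. f s * dual f x)"
      using dual_combination(1)[where c = "\<lambda>f. f s", OF order_refl g] g by simp
  qed
  then show ?thesis by (rule fun_cong)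
qed

abbreviation active_on :: "cell \<Rightarrow> functional set" where
  "active_on \<equiv> active splines MDS"

text \<open>A dual spline vanishes on every cell for which its functional is not local, and then its
  closed support misses the interior of that cell.\<close>

lemma active_subset_local: "T \<in> \<T> \<Longrightarrow> active_on T \<subseteq> local_set T"
proof
  fix f assume T: "T \<in> \<T>" and f: "f \<in> active_on T"
  show "f \<in> local_set T"
  proof (rule ccontr)
    assume no: "f \<notin> local_set T"
    have z: "dual f x = 0" if "x \<in> region T" for x
    proof (rule spline_zero_on_cell[OF T dual_spline(1) _ that])
      fix g assume g: "g \<in> local_set T"
      then have "g \<in> MDS" "g \<noteq> f" using local_set_subset[OF T] no by auto
      then show "g (dual f) = 0" by (simp add: dual_spline(2))
    qed
    have "{x. dual f x \<noteq> 0} \<subseteq> - interior (region T)" using z interior_subset by fastforce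
    then have "closure {x. dual f x \<noteq> 0} \<subseteq> - interior (region T)"
      by (rule closure_minimal) (simp add: closed_Compl)
    moreover have "region T \<subseteq> closure {x. dual f x \<noteq> 0}" using f by (simp add: active_def)
    ultimately show False using region_regular(3)[OF T] interior_subset[of "region T"] by blast
  qed
qed

text \<open>If the closed support leaves out a point of the cell, it leaves out an open part of it,
  since the region is the closure of its interior; a polynomial vanishing there vanishes on the
  whole cell.\<close>

lemma inactive_zero:
  assumes T: "T \<in> \<T>" and f: "f \<in> MDS" "f \<notin> active_on T" and x: "x \<in> region T"
  shows "dual f x = 0"
proof -
  obtain y where y: "y \<in> region T" "y \<notin> closure {x. dual f x \<noteq> 0}" using f by (auto simp: active_def)
  define O' where "O' = interior (region T) - closure {x. dual f x \<noteq> 0}"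
  have O: "open O'" by (simp add: O'_def open_Diff)
  have "O' \<noteq> {}"
  proof
    assume "O' = {}"
    then have "interior (region T) \<subseteq> closure {x. dual f x \<noteq> 0}" by (auto simp: O'_def)
    then have "closure (interior (region T)) \<subseteq> closure {x. dual f x \<noteq> 0}" by (rule closure_minimal) simp
    then show False using region_regular(2)[OF T] y by blast
  qed
  have eq: "dual f z = cell_sum T (coeff_at T (dual f)) z" if "z \<in> region T" for z
    by (rule spline_eq_cell_sum[OF dual_spline(1) T that])
  have "cell_sum T (coeff_at T (dual f)) x = 0"
  proof (rule poly2_zero_open[OF cell_sum_poly2[OF T] O \<open>O' \<noteq> {}\<close>])
    fix z assume "z \<in> O'"
    then have z: "z \<in> interior (region T)" "z \<notin> closure {x. dual f x \<noteq> 0}" by (simp_all add: O'_def)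
    have "z \<notin> {x. dual f x \<noteq> 0}" by (rule contra_subsetD[OF closure_subset z(2)])
    then have "dual f z = 0" by simp
    then show "cell_sum T (coeff_at T (dual f)) z = 0" using eq[OF subsetD[OF interior_subset z(1)]] by simp
  qed
  then show ?thesis using eq[OF x] by simp
qed

lemma active_subset: "active_on T \<subseteq> MDS"
  by (auto simp: active_def)

text \<open>The estimate by \<open>local_set\<close> may involve inactive functionals. The active
  part \<open>t\<close> of the expansion agrees with \<open>s\<close> on the cell, and every
  inactive functional vanishes on \<open>t\<close>.\<close>

lemma sup_norm_le_active:
  assumes T: "T \<in> \<T>" and s: "s \<in> splines"
  shows "sup_norm (region T) s \<le> norm_constant * Max (insert 0 ((\<lambda>f. \<bar>f s\<bar>) ` active_on T))"
proof -
  define M where "M = Max (insert 0 ((\<lambda>f. \<bar>f s\<bar>) ` active_on T))"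
  have fin: "finite (insert 0 ((\<lambda>f. \<bar>f s\<bar>) ` active_on T))"
    by (intro finite.insertI finite_imageI finite_subset[OF active_subset finite_MDS])
  have M0: "0 \<le> M" unfolding M_def by (rule Max_ge[OF fin insertI1])
  have M: "\<bar>f s\<bar> \<le> M" if "f \<in> active_on T" for f
    unfolding M_def by (rule Max_ge[OF fin insertI2[OF imageI[OF that]]])
  define t where "t = (\<lambda>x. \<Sum>f\<in>active_on T. f s * dual f x)"
  have le: "\<bar>s x\<bar> \<le> norm_constant * M" if x: "x \<in> region T" for x
  \<comment> \<open>Without active functionals the maximum defaults to 0, and the expansion shows
    that the spline vanishes on the cell.\<close>
  proof (cases "active_on T = {}")
    case True
    have "(\<Sum>f\<in>MDS. f s * dual f x) = 0"
    proof (rule sum.neutral, rule ballI)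
      fix f assume "f \<in> MDS"
      from inactive_zero[OF T this _ x] True show "f s * dual f x = 0" by simp
    qed
    then have "s x = 0" by (simp only: spline_expansion[OF s])
    then show ?thesis using M0 norm_constant_ge(4) by simp
  next
    case False
    then obtain f0 where f0: "f0 \<in> MDS" using active_subset by blast
    have "(\<Sum>f\<in>MDS. f s * dual f x) = t x" unfolding t_def
    proof (rule sum.mono_neutral_right[OF finite_MDS active_subset], rule ballI)
      fix f assume "f \<in> MDS - active_on T"
      then have "dual f x = 0" by (intro inactive_zero[OF T _ _ x]) simp_all
      then show "f s * dual f x = 0" by simp
    qed
    then have "s x = t x" by (simp only: spline_expansion[OF s])
    moreover have "t \<in> splines" unfolding t_def by (rule dual_combination(2)[OF active_subset f0])
    moreover have "\<bar>g t\<bar> \<le> M" if "g \<in> local_set T" for g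
    proof -
      have "g \<in> MDS" using that local_set_subset[OF T] by blast
      from dual_combination(1)[where c = "\<lambda>f. f s", OF active_subset[of T] this]
      have "g t = (if g \<in> active_on T then g s else 0)" unfolding t_def .
      then show ?thesis using M M0 by simp
    qed
    ultimately show ?thesis using spline_norm_le[OF T _ M0 _ x, of t] by simp
  qed
  have "region T \<noteq> {}" using region_regular(3)[OF T] interior_subset by blast
  then show ?thesis unfolding sup_norm_def M_def[symmetric] using le by (intro cSUP_least)
qed

lemma covering_number_le: "covering_number splines \<T> MDS \<le> 10 * (d + 2) ^ 3"
  unfolding covering_number_def
proof (rule Max.boundedI)
  show "finite ((\<lambda>T. card (active_on T)) ` \<T>)" using finite_mesh by simp
  show "(\<lambda>T. card (active_on T)) ` \<T> \<noteq> {}" using mesh_nonempty by simp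
  fix k assume "k \<in> (\<lambda>T. card (active_on T)) ` \<T>"
  then obtain T where T: "T \<in> \<T>" "k = card (active_on T)" by blast
  have "card (active_on T) \<le> card (local_set T)"
    using card_local_set[OF T(1)] active_subset_local[OF T(1)] by (intro card_mono) auto
  also have "\<dots> \<le> 10 * (d + 2) ^ 3" using card_local_set[OF T(1)] by auto
  finally show "k \<le> 10 * (d + 2) ^ 3" using T(2) by simp
qed

text \<open>The region of this cell serves as supporting set. Several cells can represent the same
  functional, hence the choice.\<close>

definition home :: "functional \<Rightarrow> cell" where
  "home f = (SOME T. T \<in> \<T> \<and> (\<exists>\<xi>\<in>free T. f = functional T \<xi>))"

lemma home:
  assumes "f \<in> MDS"
  obtains \<xi> where "home f \<in> \<T>" "\<xi> \<in> free (home f)" "f = functional (home f) \<xi>"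
proof -
  have "\<exists>T. T \<in> \<T> \<and> (\<exists>\<xi>\<in>free T. f = functional T \<xi>)" using assms unfolding MDS_def by blast
  from someI_ex[OF this] have "home f \<in> \<T> \<and> (\<exists>\<xi>\<in>free (home f). f = functional (home f) \<xi>)"
    unfolding home_def .
  then show thesis using that by blast
qed

lemma home_bound:
  assumes f: "f \<in> MDS" and s: "s \<in> splines"
  shows "\<bar>f s\<bar> \<le> coeff_constant * sup_norm (region (home f)) s"
proof -
  obtain \<xi> where h: "home f \<in> \<T>" "\<xi> \<in> free (home f)" "f = functional (home f) \<xi>" by (rule home[OF f])
  have "\<xi> \<in> points (home f)" using free_subset[OF h(1)] h(2) by blast
  from coeff_at_le[OF h(1) s this] functional_apply[OF s, of "home f" \<xi>] h(3) show ?thesis by simp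
qed

text \<open>The choice in \<open>home\<close> is arbitrary, but by
  \<open>functional_location\<close> the chosen region contains the point that represents
  \<open>f\<close> near \<open>T\<close>, unless the cells coincide.\<close>

lemma home_meets:
  assumes T: "T \<in> \<T>" and f: "f \<in> local_set T"
  shows "region (home f) \<inter> region T \<noteq> {}"
proof -
  have fM: "f \<in> MDS" using local_set_subset[OF T] f by blast
  obtain \<xi> where h: "home f \<in> \<T>" "\<xi> \<in> free (home f)" "f = functional (home f) \<xi>" by (rule home[OF fM])
  obtain T' \<eta> where t: "T' \<in> \<T>" "\<eta> \<in> free T'" "f = functional T' \<eta>" "T' = T \<or> \<eta> \<in> region T \<inter> region T'"
    by (rule local_setE[OF T f])
  have "functional (home f) \<xi> = functional T' \<eta>" using h(3) t(3) by simp
  from functional_location[OF h(1,2) t(1,2) this] t(4)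
  have "home f = T \<or> (\<exists>x. x \<in> region (home f) \<inter> region T)" by auto
  then show ?thesis
    using region_regular(3)[OF T] interior_subset[of "region T"] by auto
qed

text \<open>That a functional kills every spline vanishing on its home cell is the stability bound
  with norm 0; locality is \<open>home_meets\<close>.\<close>

lemma local_MDS: "local_wrt splines \<Omega> \<T> MDS 1 (\<lambda>f. region (home f))"
  unfolding local_wrt_def
proof (intro conjI ballI)
  fix f assume f: "f \<in> MDS"
  obtain \<xi> where h: "home f \<in> \<T>" by (rule home[OF f])
  have "f s = 0" if s: "s \<in> splines" and z: "\<forall>x\<in>region (home f). s x = 0" for s
  proof -
    have ne: "region (home f) \<noteq> {}" using region_regular(3)[OF h] interior_subset by blast
    have "sup_norm (region (home f)) s = (SUP x\<in>region (home f). 0)"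
      unfolding sup_norm_def using z by (intro SUP_cong) auto
    also have "\<dots> = 0" by (rule cSUP_const[OF ne])
    finally show ?thesis using home_bound[OF f s] by simp
  qed
  then show "supporting_set splines \<Omega> f (region (home f))"
    unfolding supporting_set_def using region_regular(6)[OF h] by blast
next
  fix T f assume T: "T \<in> \<T>" and f: "f \<in> active_on T"
  have fl: "f \<in> local_set T" using active_subset_local[OF T] f by blast
  have fM: "f \<in> MDS" using active_subset f by blast
  obtain \<xi> where h: "home f \<in> \<T>" by (rule home[OF fM])
  show "region (home f) \<subseteq> (star \<T> ^^ 1) (region T)"
    using home_meets[OF T fl] h by (auto simp: star_def)
qed

lemma stable_local_M0:
  "stable_local_MDS splines \<Omega> \<T> (M0 \<Omega> n \<gamma> q \<T> d) 1 (10 * (d + 2) ^ 3) coeff_constant norm_constant"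
  unfolding M0_eq stable_local_MDS_def
proof (intro conjI exI ballI)
  show "minimal_determining_set splines MDS" by (rule minimal_determining_MDS)
  show "covering_number splines \<T> MDS \<le> 10 * (d + 2) ^ 3" by (rule covering_number_le)
  show "local_wrt splines \<Omega> \<T> MDS 1 (\<lambda>f. region (home f))" by (rule local_MDS)
  show "\<bar>f s\<bar> \<le> coeff_constant * sup_norm (region (home f)) s" if "f \<in> MDS" "s \<in> splines" for f s
    by (rule home_bound[OF that])
  show "sup_norm (region T) s \<le> norm_constant * Max (insert 0 ((\<lambda>f. \<bar>f s\<bar>) ` active_on T))"
    if "T \<in> \<T>" "s \<in> splines" for T s
    by (rule sup_norm_le_active[OF that])
qed

end

theorem theorem4p7:
  shows "\<exists>\<kappa> :: nat \<Rightarrow> nat. \<forall>R :: real. \<exists>K1 K2 :: nat \<Rightarrow> real \<Rightarrow> real.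
    \<forall>(d :: nat) (\<Omega> :: complex set) (n :: nat) (\<gamma> :: nat \<Rightarrow> real \<Rightarrow> complex)
      (q :: nat \<Rightarrow> complex \<Rightarrow> real) (\<T> :: cell set) (A :: real) (B :: real).
      1 \<le> d \<and> piecewise_conic_domain \<Omega> n \<gamma> q \<and> conic_triangulation \<Omega> n \<gamma> q \<T> \<and>
      shape_constants n \<gamma> q \<T> R A B \<longrightarrow>
      stable_local_MDS (spline_space \<Omega> n \<gamma> \<T> d) \<Omega> \<T> (M0 \<Omega> n \<gamma> q \<T> d) 1 (\<kappa> d) (K1 d B) (K2 d A)"
proof (rule exI[of _ "\<lambda>d. 10 * (d + 2) ^ 3"], rule allI, goal_cases)
  case (1 R)
  show ?case
  \<comment> \<open>\<open>R\<close> is fixed before \<open>K1\<close> and \<open>K2\<close>, since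
    both contain \<open>spread\<close>; apart from it each depends only on \<open>d\<close> and its
    own shape constant.\<close>
  proof (rule exI[of _ "\<lambda>d B. conic_stable.coeff_constant d R B"],
      rule exI[of _ "\<lambda>d A. conic_stable.norm_constant d R A"], intro allI impI, elim conjE)
    fix d :: nat and \<Omega> :: "complex set" and n :: nat and \<gamma> :: "nat \<Rightarrow> real \<Rightarrow> complex"
      and q :: "nat \<Rightarrow> complex \<Rightarrow> real" and \<T> :: "cell set" and A B :: real
    assume "1 \<le> d" "piecewise_conic_domain \<Omega> n \<gamma> q" "conic_triangulation \<Omega> n \<gamma> q \<T>"
      "shape_constants n \<gamma> q \<T> R A B"
    then interpret conic_stable \<Omega> n \<gamma> q \<T> d R A B by unfold_locales
    show "stable_local_MDS (spline_space \<Omega> n \<gamma> \<T> d) \<Omega> \<T> (M0 \<Omega> n \<gamma> q \<T> d) 1 (10 * (d + 2) ^ 3)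
      coeff_constant norm_constant"
      by (rule stable_local_M0)
  qed
qed

end
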